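(* Let $\overline{A}=(A_0,A_1)$, $\overline{B}=(B_0,B_1)$, $\overline{C}=(C_0,C_1)$ be compatible couples of Banach spaces and let $T$ be a bounded bilinear operator acting between these couples, i.e. $T:A_i\times B_i\to C_i$ is bilinear and bounded with norm $\|T\|_i$ for $i=0,1$. Let $0\le\theta\le1$, let $\varphi$ be a slowly varying function on $(0,\infty)$, let $E$ be a rearrangement invariant space on $\mathbb{R}$ with associate space $E'$, and let $\mathcal{F}$ be an exact interpolation functor. Then $$T:\ \overline{A}^{J}_{\theta,m_\varphi,E}\times\overline{B}^{K}_{\theta,\varphi,\mathcal{F}(L^1,E')}\longrightarrow\overline{C}^{K}_{\theta,\varphi,\mathcal{F}(E,L^\infty)}$$ is a bounded bilinear operator with norm no greater than $\max\{\|T\|_0,\|T\|_1\}$.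
   Context: $L^1$, $L^\infty$, $E$, $E'$ are over $\mathbb{R}$ with Lebesgue measure; $E'$ is normed by $\|g\|_{E'}=\sup\{\int_{\mathbb{R}}|fg|:\|f\|_E\le1\}$. A compatible couple $(X_0,X_1)$ consists of Banach spaces continuously embedded in a common Hausdorff topological vector space. An exact interpolation functor $\mathcal{F}$ assigns to each compatible couple $(X_0,X_1)$ a Banach space $\mathcal{F}(X_0,X_1)$ with $X_0\cap X_1\hookrightarrow\mathcal{F}(X_0,X_1)\hookrightarrow X_0+X_1$ such that each linear $S:X_0+X_1\to Y_0+Y_1$ bounded from $X_i$ to $Y_i$ ($i=0,1$) maps $\mathcal{F}(X_0,X_1)$ into $\mathcal{F}(Y_0,Y_1)$ with norm at most $\max_i\|S\|_{X_i\to Y_i}$. A positive measurable $b$ on $(0,\infty)$ is slowly varying if for every $\varepsilon>0$ the function $t^\varepsilon b(t)$ is equivalent (up to multiplicative constants) to an increasing function and $t^{-\varepsilon}b(t)$ to a decreasing function. For slowly varying $\varphi$, $m_\varphi(t)=\sup_{s>0}\frac{\varphi(ts)}{\varphi(s)}$, $t>0$. $K(t,f)=\inf\{\|f_0\|_{X_0}+t\|f_1\|_{X_1}: f=f_0+f_1,\ f_i\in X_i\}$ for $f\in X_0+X_1$, and $J(t,f)=\max\{\|f\|_{X_0},t\|f\|_{X_1}\}$ for $f\in X_0\cap X_1$. For a function space $G$ on $\mathbb{R}$ (here $G=E$, $\mathcal{F}(L^1,E')$ or $\mathcal{F}(E,L^\infty)$): - $\overline{X}^{K}_{\theta,b,G}$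 is the set of $f\in X_0+X_1$ with $\|f\|^K_{\theta,b,G}=\|e^{-\theta t}b(e^t)K(e^t,f)\|_G<\infty$ (norm in the variable $t\in\mathbb{R}$); - $\overline{X}^{J}_{\theta,b,G}$ is the set of $a\in X_0+X_1$ that admit a representation $a=\int_{\mathbb{R}}u(e^t)\,dt$ (convergence in $X_0+X_1$) with $u$ strongly measurable with values in $X_0\cap X_1$ and $\|e^{-\theta t}b(e^t)J(e^t,u(e^t))\|_G<\infty$; $\|a\|^J_{\theta,b,G}$ is the infimum of these quantities over all such representations. The operators $T:A_0\times B_0\to C_0$ and $T:A_1\times B_1\to C_1$ agree on the common part of their domains. For $u\in A_0\cap A_1$ and $b=b_0+b_1\in B_0+B_1$, $T(u,b)=T(u,b_0)+T(u,b_1)\in C_0+C_1$; for $a=\int_{\mathbb{R}}u(e^t)\,dt$ in the $J$-space and $b$ in the $K$-space, $T(a,b)=\int_{\mathbb{R}}T(u(e^t),b)\,dt$. *)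

theory Defs
  imports "HOL-Probability.Essential_Supremum"
begin

section \<open>Normed spaces as carriers in a vector space\<close>

text \<open>
  The spaces \<open>X\<^sub>0 + X\<^sub>1\<close>, \<open>X\<^sub>0 \<inter> X\<^sub>1\<close>, \<open>E\<close> and the values of an interpolation functor depend on
  parameters, so a normed space is a subset of an ambient real vector space together with a norm.
  Values of \<open>nrm\<close> outside \<open>pts\<close> are irrelevant.
\<close>

record 'v nspace =
  pts :: "'v set"
  nrm :: "'v \<Rightarrow> real"

text \<open>The value off the carrier only serves to satisfy the axioms of \<open>Metric_space\<close>.\<close>

definition ndist :: "'v::real_vector nspace \<Rightarrow> 'v \<Rightarrow> 'v \<Rightarrow> real" where
  "ndist X x y = (if x \<in> pts X \<and> y \<in> pts X then nrm X (x - y) else 0)"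

definition normed_space :: "'v::real_vector nspace \<Rightarrow> bool" where
  "normed_space X \<longleftrightarrow>
     subspace (pts X) \<and>
     (\<forall>x\<in>pts X. 0 \<le> nrm X x \<and> (nrm X x = 0 \<longleftrightarrow> x = 0)) \<and>
     (\<forall>x\<in>pts X. \<forall>c. nrm X (c *\<^sub>R x) = \<bar>c\<bar> * nrm X x) \<and>
     (\<forall>x\<in>pts X. \<forall>y\<in>pts X. nrm X (x + y) \<le> nrm X x + nrm X y)"

definition banach_space :: "'v::real_vector nspace \<Rightarrow> bool" where
  "banach_space X \<longleftrightarrow> normed_space X \<and> Metric_space.mcomplete (pts X) (ndist X)"

definition norm_topology :: "'v::real_vector nspace \<Rightarrow> 'v topology" where
  "norm_topology X = Metric_space.mtopology (pts X) (ndist X)"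

definition linear_on :: "'v::real_vector set \<Rightarrow> ('v \<Rightarrow> 'w::real_vector) \<Rightarrow> bool" where
  "linear_on V S \<longleftrightarrow>
     (\<forall>x\<in>V. \<forall>y\<in>V. S (x + y) = S x + S y) \<and> (\<forall>x\<in>V. \<forall>c. S (c *\<^sub>R x) = c *\<^sub>R S x)"

definition bounded_linear_on ::
  "'v::real_vector nspace \<Rightarrow> 'w::real_vector nspace \<Rightarrow> ('v \<Rightarrow> 'w) \<Rightarrow> bool" where
  "bounded_linear_on X Y S \<longleftrightarrow>
     linear_on (pts X) S \<and> (\<forall>x\<in>pts X. S x \<in> pts Y) \<and>
     (\<exists>M. \<forall>x\<in>pts X. nrm Y (S x) \<le> M * nrm X x)"

definition op_norm :: "'v nspace \<Rightarrow> 'w nspace \<Rightarrow> ('v \<Rightarrow> 'w) \<Rightarrow> real" where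
  "op_norm X Y S = Inf {M. 0 \<le> M \<and> (\<forall>x\<in>pts X. nrm Y (S x) \<le> M * nrm X x)}"

definition bounded_bilinear_on ::
  "'a::real_vector nspace \<Rightarrow> 'b::real_vector nspace \<Rightarrow> 'c::real_vector nspace
     \<Rightarrow> ('a \<Rightarrow> 'b \<Rightarrow> 'c) \<Rightarrow> bool" where
  "bounded_bilinear_on X Y Z T \<longleftrightarrow>
     (\<forall>y\<in>pts Y. linear_on (pts X) (\<lambda>x. T x y)) \<and>
     (\<forall>x\<in>pts X. linear_on (pts Y) (\<lambda>y. T x y)) \<and>
     (\<forall>x\<in>pts X. \<forall>y\<in>pts Y. T x y \<in> pts Z) \<and>
     (\<exists>M. \<forall>x\<in>pts X. \<forall>y\<in>pts Y. nrm Z (T x y) \<le> M * nrm X x * nrm Y y)"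

definition bilinear_op_norm ::
  "'a nspace \<Rightarrow> 'b nspace \<Rightarrow> 'c nspace \<Rightarrow> ('a \<Rightarrow> 'b \<Rightarrow> 'c) \<Rightarrow> real" where
  "bilinear_op_norm X Y Z T =
     Inf {M. 0 \<le> M \<and> (\<forall>x\<in>pts X. \<forall>y\<in>pts Y. nrm Z (T x y) \<le> M * nrm X x * nrm Y y)}"


section \<open>Compatible couples and the K- and J-functionals\<close>

definition topological_vector_space :: "'v::real_vector topology \<Rightarrow> bool" where
  "topological_vector_space \<tau> \<longleftrightarrow>
     subspace (topspace \<tau>) \<and>
     continuous_map (prod_topology \<tau> \<tau>) \<tau> (\<lambda>(x, y). x + y) \<and>
     continuous_map (prod_topology euclideanreal \<tau>) \<tau> (\<lambda>(c, x). c *\<^sub>R x)"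

definition compatible_couple :: "'v::real_vector nspace \<Rightarrow> 'v nspace \<Rightarrow> bool" where
  "compatible_couple X0 X1 \<longleftrightarrow>
     banach_space X0 \<and> banach_space X1 \<and>
     (\<exists>\<tau>. topological_vector_space \<tau> \<and> Hausdorff_space \<tau> \<and>
        continuous_map (norm_topology X0) \<tau> (\<lambda>x. x) \<and>
        continuous_map (norm_topology X1) \<tau> (\<lambda>x. x))"

definition K_functional :: "'v::real_vector nspace \<Rightarrow> 'v nspace \<Rightarrow> real \<Rightarrow> 'v \<Rightarrow> real" where
  "K_functional X0 X1 t f =
     Inf {nrm X0 f0 + t * nrm X1 f1 | f0 f1. f0 \<in> pts X0 \<and> f1 \<in> pts X1 \<and> f = f0 + f1}"

definition J_functional :: "'v nspace \<Rightarrow> 'v nspace \<Rightarrow> real \<Rightarrow> 'v \<Rightarrow> real" where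
  "J_functional X0 X1 t f = max (nrm X0 f) (t * nrm X1 f)"

definition sum_space :: "'v::real_vector nspace \<Rightarrow> 'v nspace \<Rightarrow> 'v nspace" where
  "sum_space X0 X1 =
     \<lparr>pts = {f0 + f1 | f0 f1. f0 \<in> pts X0 \<and> f1 \<in> pts X1}, nrm = K_functional X0 X1 1\<rparr>"

definition inter_space :: "'v nspace \<Rightarrow> 'v nspace \<Rightarrow> 'v nspace" where
  "inter_space X0 X1 = \<lparr>pts = pts X0 \<inter> pts X1, nrm = J_functional X0 X1 1\<rparr>"

text \<open>
  The functor acts on the couples living in one fixed but arbitrary vector space \<open>'v\<close>. A functor
  on all compatible couples restricts to one in this sense, so a theorem that assumes only this
  covers it.
\<close>

definition exact_interpolation_functor ::
  "('v::real_vector nspace \<Rightarrow> 'v nspace \<Rightarrow> 'v nspace) \<Rightarrow> bool" where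
  "exact_interpolation_functor F \<longleftrightarrow>
     (\<forall>X0 X1. compatible_couple X0 X1 \<longrightarrow>
        banach_space (F X0 X1) \<and>
        bounded_linear_on (inter_space X0 X1) (F X0 X1) (\<lambda>x. x) \<and>
        bounded_linear_on (F X0 X1) (sum_space X0 X1) (\<lambda>x. x)) \<and>
     (\<forall>X0 X1 Y0 Y1 S.
        compatible_couple X0 X1 \<and> compatible_couple Y0 Y1 \<and>
        linear_on (pts (sum_space X0 X1)) S \<and>
        bounded_linear_on X0 Y0 S \<and> bounded_linear_on X1 Y1 S \<longrightarrow>
        bounded_linear_on (F X0 X1) (F Y0 Y1) S \<and>
        op_norm (F X0 X1) (F Y0 Y1) S \<le> max (op_norm X0 Y0 S) (op_norm X1 Y1 S))"


section \<open>Bochner integrals with values in a carrier\<close>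

definition strongly_measurable_in :: "'v::real_vector nspace \<Rightarrow> (real \<Rightarrow> 'v) \<Rightarrow> bool" where
  "strongly_measurable_in X f \<longleftrightarrow>
     range f \<subseteq> pts X \<and>
     (\<exists>s. (\<forall>i. simple_function lebesgue (s i) \<and> range (s i) \<subseteq> pts X) \<and>
        (AE t in lebesgue. (\<lambda>i. nrm X (s i t - f t)) \<longlonglongrightarrow> 0))"

text \<open>The library's \<^const>\<open>has_bochner_integral\<close>, relative to a carrier and without separability.\<close>

definition has_bochner_integral_in ::
  "'v::real_vector nspace \<Rightarrow> (real \<Rightarrow> 'v) \<Rightarrow> 'v \<Rightarrow> bool" where
  "has_bochner_integral_in X f a \<longleftrightarrow>
     a \<in> pts X \<and> strongly_measurable_in X f \<and>
     (\<exists>s. (\<forall>i. Bochner_Integration.simple_bochner_integrable lebesgue (s i) \<and> range (s i) \<subseteq> pts X) \<and>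
        (\<lambda>i. \<integral>\<^sup>+t. ennreal (nrm X (f t - s i t)) \<partial>lebesgue) \<longlonglongrightarrow> 0 \<and>
        (\<lambda>i. nrm X (Bochner_Integration.simple_bochner_integral lebesgue (s i) - a)) \<longlonglongrightarrow> 0)"


section \<open>Lebesgue measurable functions modulo equality almost everywhere\<close>

definition ae_rel :: "(real \<Rightarrow> real) \<Rightarrow> (real \<Rightarrow> real) \<Rightarrow> bool" where
  "ae_rel f g \<longleftrightarrow>
     f \<in> borel_measurable lebesgue \<and> g \<in> borel_measurable lebesgue \<and> (AE x in lebesgue. f x = g x)"

quotient_type aefun = "real \<Rightarrow> real" / partial: ae_rel
proof (rule part_equivpI)
  show "\<exists>f. ae_rel f f"
    by (rule exI[of _ "\<lambda>_. 0"]) (simp add: ae_rel_def)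
  show "symp ae_rel"
    unfolding ae_rel_def by (rule sympI) (auto elim: AE_mp)
  show "transp ae_rel"
    unfolding ae_rel_def by (rule transpI) auto
qed

instantiation aefun :: real_vector
begin

lift_definition zero_aefun :: aefun is "\<lambda>_. 0"
  by (simp add: ae_rel_def)

lift_definition plus_aefun :: "aefun \<Rightarrow> aefun \<Rightarrow> aefun" is "\<lambda>f g x. f x + g x"
  by (auto simp: ae_rel_def)

lift_definition minus_aefun :: "aefun \<Rightarrow> aefun \<Rightarrow> aefun" is "\<lambda>f g x. f x - g x"
  by (auto simp: ae_rel_def)

lift_definition uminus_aefun :: "aefun \<Rightarrow> aefun" is "\<lambda>f x. - f x"
  by (auto simp: ae_rel_def)

lift_definition scaleR_aefun :: "real \<Rightarrow> aefun \<Rightarrow> aefun" is "\<lambda>c f x. c * f x"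
  by (auto simp: ae_rel_def)

instance
  by standard (transfer, auto simp: ae_rel_def algebra_simps)+

end

text \<open>\<open>h\<close> represents an element of the function space \<open>G\<close>, i.e. \<open>\<parallel>h\<parallel>\<^sub>G < \<infinity>\<close>.\<close>

definition in_fspace :: "aefun nspace \<Rightarrow> (real \<Rightarrow> real) \<Rightarrow> bool" where
  "in_fspace G h \<longleftrightarrow> h \<in> borel_measurable lebesgue \<and> abs_aefun h \<in> pts G"

definition fnrm :: "aefun nspace \<Rightarrow> (real \<Rightarrow> real) \<Rightarrow> real" where
  "fnrm G h = nrm G (abs_aefun h)"


section \<open>Rearrangement invariant spaces\<close>

text \<open>
  Banach function norms in the sense of Bennett and Sharpley: functionals on the nonnegative
  (extended real valued) measurable functions, with the Fatou property.
\<close>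

definition banach_function_norm :: "((real \<Rightarrow> ennreal) \<Rightarrow> ennreal) \<Rightarrow> bool" where
  "banach_function_norm \<rho> \<longleftrightarrow>
     (\<forall>f\<in>borel_measurable lebesgue. \<rho> f = 0 \<longleftrightarrow> (AE x in lebesgue. f x = 0)) \<and>
     (\<forall>f\<in>borel_measurable lebesgue. \<forall>c::real. 0 \<le> c \<longrightarrow>
        \<rho> (\<lambda>x. ennreal c * f x) = ennreal c * \<rho> f) \<and>
     (\<forall>f\<in>borel_measurable lebesgue. \<forall>g\<in>borel_measurable lebesgue.
        \<rho> (\<lambda>x. f x + g x) \<le> \<rho> f + \<rho> g) \<and>
     (\<forall>f\<in>borel_measurable lebesgue. \<forall>g\<in>borel_measurable lebesgue.
        (AE x in lebesgue. g x \<le> f x) \<longrightarrow> \<rho> g \<le> \<rho> f) \<and>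
     (\<forall>s. \<forall>f\<in>borel_measurable lebesgue.
        (\<forall>n::nat. s n \<in> borel_measurable lebesgue) \<and>
        (AE x in lebesgue. incseq (\<lambda>n. s n x) \<and> (\<lambda>n. s n x) \<longlonglongrightarrow> f x) \<longrightarrow>
        incseq (\<lambda>n. \<rho> (s n)) \<and> (\<lambda>n. \<rho> (s n)) \<longlonglongrightarrow> \<rho> f) \<and>
     (\<forall>D\<in>sets lebesgue. emeasure lebesgue D < \<infinity> \<longrightarrow>
        \<rho> (indicator D) < \<infinity> \<and>
        (\<exists>c::real. \<forall>f\<in>borel_measurable lebesgue.
           (\<integral>\<^sup>+x\<in>D. f x \<partial>lebesgue) \<le> ennreal c * \<rho> f))"

definition equimeasurable :: "(real \<Rightarrow> ennreal) \<Rightarrow> (real \<Rightarrow> ennreal) \<Rightarrow> bool" where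
  "equimeasurable f g \<longleftrightarrow>
     (\<forall>y::real. 0 \<le> y \<longrightarrow>
        emeasure lebesgue {x. ennreal y < f x} = emeasure lebesgue {x. ennreal y < g x})"

definition rearrangement_invariant_norm :: "((real \<Rightarrow> ennreal) \<Rightarrow> ennreal) \<Rightarrow> bool" where
  "rearrangement_invariant_norm \<rho> \<longleftrightarrow>
     banach_function_norm \<rho> \<and>
     (\<forall>f\<in>borel_measurable lebesgue. \<forall>g\<in>borel_measurable lebesgue.
        equimeasurable f g \<longrightarrow> \<rho> f = \<rho> g)"

definition associate_norm ::
  "((real \<Rightarrow> ennreal) \<Rightarrow> ennreal) \<Rightarrow> (real \<Rightarrow> ennreal) \<Rightarrow> ennreal" where
  "associate_norm \<rho> g =
     (SUP f\<in>{f. f \<in> borel_measurable lebesgue \<and> \<rho> f \<le> 1}. \<integral>\<^sup>+x. f x * g x \<partial>lebesgue)"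

definition function_space :: "((real \<Rightarrow> ennreal) \<Rightarrow> ennreal) \<Rightarrow> aefun nspace" where
  "function_space \<rho> =
     (let N = (\<lambda>f. \<rho> (\<lambda>x. ennreal \<bar>rep_aefun f x\<bar>))
      in \<lparr>pts = {f. N f < \<infinity>}, nrm = (\<lambda>f. enn2real (N f))\<rparr>)"

definition L1_space :: "aefun nspace" where
  "L1_space = function_space (\<lambda>f. \<integral>\<^sup>+x. f x \<partial>lebesgue)"

definition Linf_space :: "aefun nspace" where
  "Linf_space = function_space (esssup lebesgue)"


section \<open>Slowly varying functions\<close>

definition equivalent_on_pos :: "(real \<Rightarrow> real) \<Rightarrow> (real \<Rightarrow> real) \<Rightarrow> bool" where
  "equivalent_on_pos f g \<longleftrightarrow> (\<exists>c C. 0 < c \<and> 0 < C \<and> (\<forall>t>0. c * g t \<le> f t \<and> f t \<le> C * g t))"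

definition slowly_varying :: "(real \<Rightarrow> real) \<Rightarrow> bool" where
  "slowly_varying b \<longleftrightarrow>
     (\<forall>t>0. 0 < b t) \<and> b \<in> borel_measurable (lebesgue_on {0<..}) \<and>
     (\<forall>\<epsilon>>0.
        (\<exists>g. monotone_on {0<..} (\<le>) (\<le>) g \<and> equivalent_on_pos (\<lambda>t. t powr \<epsilon> * b t) g) \<and>
        (\<exists>g. monotone_on {0<..} (\<le>) (\<ge>) g \<and> equivalent_on_pos (\<lambda>t. t powr (- \<epsilon>) * b t) g))"

text \<open>For slowly varying \<open>\<phi>\<close> and \<open>t > 0\<close> the supremum is finite.\<close>

definition m_sv :: "(real \<Rightarrow> real) \<Rightarrow> real \<Rightarrow> real" where
  "m_sv \<phi> t = (SUP s\<in>{0<..}. \<phi> (t * s) / \<phi> s)"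


section \<open>The K- and J-spaces\<close>

definition K_weighted ::
  "'v::real_vector nspace \<Rightarrow> 'v nspace \<Rightarrow> real \<Rightarrow> (real \<Rightarrow> real) \<Rightarrow> 'v \<Rightarrow> real \<Rightarrow> real" where
  "K_weighted X0 X1 \<theta> b f = (\<lambda>t. exp (- \<theta> * t) * b (exp t) * K_functional X0 X1 (exp t) f)"

definition K_space ::
  "'v::real_vector nspace \<Rightarrow> 'v nspace \<Rightarrow> real \<Rightarrow> (real \<Rightarrow> real) \<Rightarrow> aefun nspace \<Rightarrow> 'v nspace" where
  "K_space X0 X1 \<theta> b G =
     \<lparr>pts = {f \<in> pts (sum_space X0 X1). in_fspace G (K_weighted X0 X1 \<theta> b f)},
      nrm = (\<lambda>f. fnrm G (K_weighted X0 X1 \<theta> b f))\<rparr>"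

definition J_weighted ::
  "'v nspace \<Rightarrow> 'v nspace \<Rightarrow> real \<Rightarrow> (real \<Rightarrow> real) \<Rightarrow> (real \<Rightarrow> 'v) \<Rightarrow> real \<Rightarrow> real" where
  "J_weighted X0 X1 \<theta> b u =
     (\<lambda>t. exp (- \<theta> * t) * b (exp t) * J_functional X0 X1 (exp t) (u (exp t)))"

text \<open>Only the values of \<open>u\<close> on \<open>(0, \<infinity>)\<close> matter.\<close>

definition J_representation ::
  "'v::real_vector nspace \<Rightarrow> 'v nspace \<Rightarrow> real \<Rightarrow> (real \<Rightarrow> real) \<Rightarrow> aefun nspace
     \<Rightarrow> 'v \<Rightarrow> (real \<Rightarrow> 'v) \<Rightarrow> bool" where
  "J_representation X0 X1 \<theta> b G a u \<longleftrightarrow>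
     strongly_measurable_in (inter_space X0 X1) (\<lambda>t. u (exp t)) \<and>
     has_bochner_integral_in (sum_space X0 X1) (\<lambda>t. u (exp t)) a \<and>
     in_fspace G (J_weighted X0 X1 \<theta> b u)"

definition J_space ::
  "'v::real_vector nspace \<Rightarrow> 'v nspace \<Rightarrow> real \<Rightarrow> (real \<Rightarrow> real) \<Rightarrow> aefun nspace \<Rightarrow> 'v nspace" where
  "J_space X0 X1 \<theta> b G =
     \<lparr>pts = {a. \<exists>u. J_representation X0 X1 \<theta> b G a u},
      nrm = (\<lambda>a. Inf {fnrm G (J_weighted X0 X1 \<theta> b u) | u. J_representation X0 X1 \<theta> b G a u})\<rparr>"

text \<open>
  \<open>T\<close> is the operator on the product of the \<open>J\<close>-space \<open>X\<close> and the \<open>K\<close>-space \<open>Y\<close> given by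
  \<open>T(a, b) = \<integral> T(u(e\<^sup>t), b) dt\<close>, where \<open>T(u, b) = T\<^sub>0(u, b\<^sub>0) + T\<^sub>1(u, b\<^sub>1)\<close> for \<open>b = b\<^sub>0 + b\<^sub>1\<close>. Quantifying
  over all representations \<open>u\<close> of \<open>a\<close> and all decompositions of \<open>b\<close> asserts in particular that the
  value does not depend on these choices; it determines \<open>T\<close> on the product.
\<close>

definition bilinear_extension ::
  "'a::real_vector nspace \<Rightarrow> 'a nspace \<Rightarrow> 'b::real_vector nspace \<Rightarrow> 'b nspace
     \<Rightarrow> 'c::real_vector nspace \<Rightarrow> 'c nspace
     \<Rightarrow> real \<Rightarrow> (real \<Rightarrow> real) \<Rightarrow> aefun nspace \<Rightarrow> 'b nspace
     \<Rightarrow> ('a \<Rightarrow> 'b \<Rightarrow> 'c) \<Rightarrow> ('a \<Rightarrow> 'b \<Rightarrow> 'c) \<Rightarrow> ('a \<Rightarrow> 'b \<Rightarrow> 'c) \<Rightarrow> bool" where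
  "bilinear_extension A0 A1 B0 B1 C0 C1 \<theta> m G Y T0 T1 T \<longleftrightarrow>
     (\<forall>a u b b0 b1.
        J_representation A0 A1 \<theta> m G a u \<and>
        b \<in> pts Y \<and> b0 \<in> pts B0 \<and> b1 \<in> pts B1 \<and> b = b0 + b1 \<longrightarrow>
        has_bochner_integral_in (sum_space C0 C1)
          (\<lambda>t. T0 (u (exp t)) b0 + T1 (u (exp t)) b1) (T a b))"

end

theory Submission
  imports Defs
begin

text \<open>
  Let \<open>f\<close> be the weighted \<open>J\<close>-functional of a representation \<open>u\<close> of \<open>a\<close> and \<open>g\<close> the weighted
  \<open>K\<close>-functional of \<open>b\<close>. The bound \<open>K(t, T(x, b)) \<le> M J(s, x) K(t / s, b)\<close> and the definition of
  \<open>m\<^sub>\<phi>\<close> dominate the weighted \<open>K\<close>-functional of \<open>T(a, b)\<close> by \<open>M (f * g)\<close>. Convolution with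
  \<open>f \<in> E\<close> maps \<open>L\<^sup>1\<close> to \<open>E\<close> (Minkowski) and \<open>E'\<close> to \<open>L\<^sup>\<infinity>\<close> (by the definition of \<open>E'\<close>), with norm at
  most \<open>\<parallel>f\<parallel>\<^sub>E\<close> in both cases, and the functor interpolates. Minkowski's inequality follows from
  translation invariance and the Fatou property, by approximating \<open>f * g\<close> with Riemann sums.

  That \<open>T(a, b)\<close> does not depend on \<open>u\<close> needs an argument of its own, since \<open>T(\<cdot>, b)\<close> is not defined
  on \<open>A\<^sub>0 + A\<^sub>1\<close>. If \<open>u\<close> has integral \<open>0\<close>, its integrals over \<open>s < 0\<close> (in \<open>A\<^sub>0\<close>) and over \<open>s \<ge> 0\<close>
  (in \<open>A\<^sub>1\<close>) are opposite, hence both in \<open>A\<^sub>0 \<inter> A\<^sub>1\<close>. On each half-line \<open>T(\<cdot>, b)\<close> commutes with the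
  integral: either \<open>u\<close> is integrable in both spaces there, or the remainders \<open>R\<close> of the integral over
  \<open>\<bar>s\<bar> \<le> n\<close> satisfy \<open>J(e\<^sup>s, R) K(e\<^sup>-\<^sup>s, b) \<rightarrow> 0\<close> at the end point \<open>\<bar>s\<bar> = n\<close>.
\<close>

section \<open>Normed spaces as carriers\<close>

text \<open>The functor is arbitrary: all that is known of an element of F(L1, E') is that it lies
  in L1 + E' and that operators bounded at both end points act on it. So the convolution has to be a
  linear operator on all of L1 + E', defined on classes modulo null sets, and the estimate of the
  K-functional has to be recast as the action of such an operator. Membership in L1 + E' is also the
  source of convergence: it makes the convolution finite almost everywhere, and one finite value
  already bounds the integral of J(e^s, u(e^s)) K(e^-s, b), on which the construction of T(a, b)
  rests.

  The split at s = 0 comes from the two monotonicities of K. For b \<noteq> 0 the positive number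
  K(1, b) is at most K(e^-s, b) when s \<le> 0, and at most e^s K(e^-s, b) when s \<ge> 0. Hence the
  integrand controls the norm of u in A_0 on one half-line and in A_1 on the other.

  No constant is lost: apart from M, the passage from J and K to the convolution and the two end
  point estimates have constant 1, and the functor is exact.\<close>

lemma LIMSEQ_zero_le:
  fixes f g :: "nat \<Rightarrow> real"
  assumes "\<And>n. 0 \<le> f n" "\<And>n. f n \<le> g n" "g \<longlonglongrightarrow> 0"
  shows "f \<longlonglongrightarrow> 0"
  by (rule tendsto_sandwich[OF _ _ tendsto_const assms(3)]) (simp_all add: assms(1,2))

lemma normed_spaceD:
  assumes "normed_space X"
  shows normed_zero: "0 \<in> pts X"
    and normed_add: "x \<in> pts X \<Longrightarrow> y \<in> pts X \<Longrightarrow> x + y \<in> pts X"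
    and normed_diff: "x \<in> pts X \<Longrightarrow> y \<in> pts X \<Longrightarrow> x - y \<in> pts X"
    and normed_scale: "x \<in> pts X \<Longrightarrow> c *\<^sub>R x \<in> pts X"
    and normed_uminus: "x \<in> pts X \<Longrightarrow> - x \<in> pts X"
    and nrm_nonneg: "x \<in> pts X \<Longrightarrow> 0 \<le> nrm X x"
    and nrm_eq_0: "x \<in> pts X \<Longrightarrow> nrm X x = 0 \<longleftrightarrow> x = 0"
    and nrm_zero: "nrm X 0 = 0"
    and nrm_scaleR: "x \<in> pts X \<Longrightarrow> nrm X (c *\<^sub>R x) = \<bar>c\<bar> * nrm X x"
    and nrm_triangle: "x \<in> pts X \<Longrightarrow> y \<in> pts X \<Longrightarrow> nrm X (x + y) \<le> nrm X x + nrm X y"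
  using assms unfolding normed_space_def
  by (auto simp: subspace_0 subspace_add subspace_diff subspace_scale subspace_neg)

lemma nrm_uminus:
  assumes "normed_space X" "x \<in> pts X"
  shows "nrm X (- x) = nrm X x"
  using nrm_scaleR[OF assms, of "-1"] by simp

lemma nrm_minus_commute:
  assumes "normed_space X" "x \<in> pts X" "y \<in> pts X"
  shows "nrm X (x - y) = nrm X (y - x)"
  using nrm_uminus[OF assms(1) normed_diff[OF assms]] by simp

lemma nrm_diff_triangle:
  assumes "normed_space X" "x \<in> pts X" "y \<in> pts X" "z \<in> pts X"
  shows "nrm X (x - z) \<le> nrm X (x - y) + nrm X (y - z)"
  using nrm_triangle[OF assms(1) normed_diff[OF assms(1-3)] normed_diff[OF assms(1,3,4)]] by simp

lemma nrm_diff_le: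
  assumes "normed_space X" "x \<in> pts X" "y \<in> pts X"
  shows "nrm X (x - y) \<le> nrm X x + nrm X y"
  using nrm_triangle[OF assms(1,2) normed_uminus[OF assms(1,3)]] nrm_uminus[OF assms(1,3)] by simp

lemma nrm_triangle_sub:
  assumes "normed_space X" "x \<in> pts X" "y \<in> pts X"
  shows "nrm X x \<le> nrm X y + nrm X (x - y)"
  using nrm_triangle[OF assms(1,3) normed_diff[OF assms]] by simp

lemma nrm_abs_diff:
  assumes "normed_space X" "x \<in> pts X" "y \<in> pts X"
  shows "\<bar>nrm X x - nrm X y\<bar> \<le> nrm X (x - y)"
  using nrm_triangle_sub[OF assms] nrm_triangle_sub[OF assms(1,3,2)] nrm_minus_commute[OF assms]
  by linarith

lemma normed_sum:
  assumes "normed_space X" "\<And>i. i \<in> I \<Longrightarrow> f i \<in> pts X"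
  shows "sum f I \<in> pts X" "nrm X (sum f I) \<le> (\<Sum>i\<in>I. nrm X (f i))"
proof -
  have "(\<forall>i\<in>I. f i \<in> pts X) \<longrightarrow> sum f I \<in> pts X \<and> nrm X (sum f I) \<le> (\<Sum>i\<in>I. nrm X (f i))"
    by (induction I rule: infinite_finite_induct)
      (auto simp: assms(1) normed_zero nrm_zero normed_add intro: order_trans[OF nrm_triangle[OF assms(1)]])
  then show "sum f I \<in> pts X" "nrm X (sum f I) \<le> (\<Sum>i\<in>I. nrm X (f i))" using assms(2) by auto
qed

lemma Metric_space_ndist:
  assumes "normed_space X"
  shows "Metric_space (pts X) (ndist X)"
proof
  fix x y z
  show "0 \<le> ndist X x y" by (simp add: ndist_def assms nrm_nonneg normed_diff)
  show "ndist X x y = ndist X y x"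
    using nrm_minus_commute[OF assms] by (simp add: ndist_def)
  assume "x \<in> pts X" "y \<in> pts X"
  then show "ndist X x y = 0 \<longleftrightarrow> x = y"
    by (simp add: ndist_def assms nrm_eq_0 normed_diff)
  assume "z \<in> pts X"
  then show "ndist X x z \<le> ndist X x y + ndist X y z"
    using \<open>x \<in> pts X\<close> \<open>y \<in> pts X\<close> by (simp add: ndist_def nrm_diff_triangle assms)
qed

lemma nrm_tendsto_iff:
  assumes "normed_space X" "\<And>n. x n \<in> pts X" "a \<in> pts X"
  shows "limitin (norm_topology X) x a sequentially \<longleftrightarrow> (\<lambda>n. nrm X (x n - a)) \<longlonglongrightarrow> 0"
proof -
  interpret Metric_space "pts X" "ndist X" by (rule Metric_space_ndist[OF assms(1)])
  show ?thesis
    unfolding norm_topology_def limitin_metric_dist_null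
    using assms by (simp add: ndist_def)
qed

lemma topspace_norm_topology:
  assumes "normed_space X"
  shows "topspace (norm_topology X) = pts X"
proof -
  interpret Metric_space "pts X" "ndist X" by (rule Metric_space_ndist[OF assms])
  show ?thesis unfolding norm_topology_def by simp
qed

lemma banach_space_normed: "banach_space X \<Longrightarrow> normed_space X"
  by (simp add: banach_space_def)

lemma banach_spaceD:
  assumes "banach_space X" and x: "\<And>n. x n \<in> pts X"
    and Cauchy: "\<And>e. 0 < e \<Longrightarrow> \<exists>N. \<forall>m\<ge>N. \<forall>n\<ge>N. nrm X (x m - x n) < e"
  obtains a where "a \<in> pts X" "(\<lambda>n. nrm X (x n - a)) \<longlonglongrightarrow> 0"
proof -
  have X: "normed_space X" using assms(1) by (rule banach_space_normed)
  interpret Metric_space "pts X" "ndist X" by (rule Metric_space_ndist[OF X])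
  have "MCauchy x"
    unfolding MCauchy_def using x Cauchy by (auto simp: ndist_def) 
  then obtain a where a: "limitin mtopology x a sequentially"
    using assms(1) unfolding banach_space_def mcomplete_def by blast
  then have "a \<in> pts X" by (simp add: limitin_metric)
  moreover have "(\<lambda>n. nrm X (x n - a)) \<longlonglongrightarrow> 0"
    using a nrm_tendsto_iff[OF X x \<open>a \<in> pts X\<close>] by (simp add: norm_topology_def)
  ultimately show ?thesis by (rule that)
qed

lemma nrm_sum_geometric:
  assumes X: "normed_space X" "\<And>k. x k \<in> pts X" "\<And>k. nrm X (x k) \<le> (1/2)^k" and "m \<le> n"
  shows "nrm X ((\<Sum>k<n. x k) - (\<Sum>k<m. x k)) \<le> 2 * (1/2)^m"
proof -
  have eq: "(\<Sum>k<n. x k) - (\<Sum>k<m. x k) = (\<Sum>k=m..<n. x k)"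
    using sum_diff_nat_ivl[of 0 m n x] \<open>m \<le> n\<close> by (simp add: atLeast0LessThan)
  have "nrm X (\<Sum>k=m..<n. x k) \<le> (\<Sum>k=m..<n. (1/2)^k)"
    using normed_sum(2)[OF X(1,2)] sum_mono[OF X(3)] by (rule order_trans)
  also have "\<dots> \<le> 2 * (1/2)^m"
  proof -
    have "(\<Sum>k=m..<n. (1/2::real)^k) = 2 * (1/2)^m - 2 * (1/2)^n"
      using \<open>m \<le> n\<close> by (induction rule: dec_induct) auto
    then show ?thesis by simp
  qed
  finally show ?thesis unfolding eq .
qed

lemma banach_space_series:
  assumes X: "banach_space X" and x: "\<And>k. x k \<in> pts X" "\<And>k. nrm X (x k) \<le> (1/2)^k"
  obtains a where "a \<in> pts X" "(\<lambda>n. nrm X ((\<Sum>k<n. x k) - a)) \<longlonglongrightarrow> 0"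
proof -
  have X': "normed_space X" using X by (rule banach_space_normed)
  let ?s = "\<lambda>n. \<Sum>k<n. x k"
  have s: "?s n \<in> pts X" for n by (rule normed_sum(1)[OF X' x(1)])
  have "\<exists>N. \<forall>m\<ge>N. \<forall>n\<ge>N. nrm X (?s m - ?s n) < e" if "0 < e" for e
  proof -
    have "0 < e / 4" using that by simp
    then obtain N where N: "(1/2)^N < e / 4"
      using real_arch_pow_inv[of "e/4" "1/2"] by auto
    have "nrm X (?s m - ?s n) < e" if "m \<ge> N" "n \<ge> N" for m n
    proof -
      have "nrm X (?s m - ?s n) \<le> nrm X (?s m - ?s N) + nrm X (?s N - ?s n)"
        by (rule nrm_diff_triangle[OF X' s s s])
      also have "nrm X (?s N - ?s n) = nrm X (?s n - ?s N)"
        by (rule nrm_minus_commute[OF X' s s])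
      finally show ?thesis
        using nrm_sum_geometric[OF X' x \<open>m \<ge> N\<close>] nrm_sum_geometric[OF X' x \<open>n \<ge> N\<close>] N by linarith
    qed
    then show ?thesis by blast
  qed
  then show ?thesis using banach_spaceD[OF X, of ?s] s that by blast
qed

text \<open>A Cauchy sequence has a subsequence with increments below \<open>(1/2)^k\<close>; its
  telescoping series has such terms, and a Cauchy sequence with a convergent subsequence converges.
  The criterion suits sum spaces and function spaces, where the terms of a series can be decomposed
  one by one or summed pointwise.\<close>

lemma banach_spaceI_series:
  fixes X :: "'v::real_vector nspace"
  assumes X: "normed_space X"
    and series: "\<And>x :: nat \<Rightarrow> 'v. (\<And>k. x k \<in> pts X) \<Longrightarrow> (\<And>k. nrm X (x k) \<le> (1/2)^k) \<Longrightarrow>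
       \<exists>a\<in>pts X. (\<lambda>n. nrm X ((\<Sum>k<n. x k) - a)) \<longlonglongrightarrow> 0"
  shows "banach_space X"
proof -
  interpret Metric_space "pts X" "ndist X" by (rule Metric_space_ndist[OF X])
  have "\<exists>a. limitin mtopology y a sequentially" if y: "MCauchy y" for y
  proof -
    have yX: "y n \<in> pts X" for n using y unfolding MCauchy_def by auto
    have "\<exists>N. \<forall>m\<ge>N. \<forall>n\<ge>N. nrm X (y m - y n) < (1/2)^k" for k
    proof -
      have "0 < (1/2::real)^k" by simp
      then show ?thesis using y yX unfolding MCauchy_def ndist_def by fastforce
    qed
    then obtain M where M: "\<And>k m n. M k \<le> m \<Longrightarrow> M k \<le> n \<Longrightarrow> nrm X (y m - y n) < (1/2)^k" by metis
    \<comment> \<open>The summand \<open>k\<close> makes \<open>N\<close> strictly increasing, and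
      the sum of the thresholds keeps it above \<open>M k\<close>.\<close>
    define N where "N k = k + (\<Sum>i\<le>k. M i)" for k
    have NM: "M k \<le> N k" for k
      unfolding N_def by (metis member_le_sum atMost_iff finite_atMost le_refl trans_le_add2 zero_le)
    have N: "strict_mono N" unfolding N_def by (rule strict_monoI_Suc) simp
    let ?x = "\<lambda>k. y (N (Suc k)) - y (N k)"
    have x: "?x k \<in> pts X" for k by (intro normed_diff X yX)
    have "nrm X (?x k) \<le> (1/2)^k" for k
      using M[of k "N (Suc k)" "N k"] NM[of k] N by (meson le_trans less_imp_le lessI strict_mono_less)
    then obtain a where a: "a \<in> pts X" "(\<lambda>n. nrm X ((\<Sum>k<n. ?x k) - a)) \<longlonglongrightarrow> 0"
      using series[of ?x] x by blast
    let ?b = "a + y (N 0)"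
    have b: "?b \<in> pts X" by (intro normed_add X a yX)
    have eq: "(\<Sum>k<n. ?x k) - a = (y \<circ> N) n - ?b" for n
      using sum_lessThan_telescope[of "\<lambda>k. y (N k)" n] by simp
    have "limitin (norm_topology X) (y \<circ> N) ?b sequentially"
      using a(2) yX unfolding eq by (subst nrm_tendsto_iff[OF X _ b]) auto
    then have "limitin mtopology (y \<circ> N) ?b sequentially" by (simp add: norm_topology_def)
    then show ?thesis
      using MCauchy_convergent_subsequence[OF y N] by blast
  qed
  then show ?thesis using X by (auto simp: banach_space_def mcomplete_def)
qed

section \<open>Linear and bilinear operators on carriers\<close>

lemma linear_on_zero:
  assumes "linear_on V S" "0 \<in> V"
  shows "S 0 = 0"
proof -
  have "S (0 *\<^sub>R 0) = 0 *\<^sub>R S 0" using assms unfolding linear_on_def by blast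
  then show ?thesis by simp
qed

lemma linear_on_diff:
  assumes "linear_on V S" "x \<in> V" "y \<in> V" "subspace V"
  shows "S (x - y) = S x - S y"
proof -
  have "S (x + (-1) *\<^sub>R y) = S x + S ((-1) *\<^sub>R y)"
    using assms unfolding linear_on_def by (meson subspace_scale)
  moreover have "S ((-1) *\<^sub>R y) = (-1) *\<^sub>R S y" using assms unfolding linear_on_def by blast
  ultimately show ?thesis by simp
qed

lemma linear_on_sum:
  assumes "linear_on V S" "subspace V" "\<And>i. i \<in> I \<Longrightarrow> f i \<in> V"
  shows "S (\<Sum>i\<in>I. f i) = (\<Sum>i\<in>I. S (f i))"
  using assms(3)
proof (induction I rule: infinite_finite_induct)
  case (insert i I)
  then have "S (f i + sum f I) = S (f i) + S (sum f I)"
    using assms(1,2) unfolding linear_on_def by (meson insertCI subspace_sum)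
  then show ?case using insert by simp
qed (auto intro!: linear_on_zero[OF assms(1)] subspace_0[OF assms(2)])

lemma normed_subspace: "normed_space X \<Longrightarrow> subspace (pts X)"
  by (simp add: normed_space_def)

lemma bounded_linear_onE:
  assumes "bounded_linear_on X Y S" "normed_space X"
  obtains M where "0 \<le> M" "\<And>x. x \<in> pts X \<Longrightarrow> nrm Y (S x) \<le> M * nrm X x"
proof -
  obtain M where M: "\<And>x. x \<in> pts X \<Longrightarrow> nrm Y (S x) \<le> M * nrm X x"
    using assms(1) unfolding bounded_linear_on_def by blast
  have "nrm Y (S x) \<le> \<bar>M\<bar> * nrm X x" if "x \<in> pts X" for x
    using M[OF that] nrm_nonneg[OF assms(2) that] by (meson abs_ge_self mult_right_mono order_trans)
  then show ?thesis using that[of "\<bar>M\<bar>"] by simp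
qed

lemma op_norm_le:
  assumes "0 \<le> M" "\<And>x. x \<in> pts X \<Longrightarrow> nrm Y (S x) \<le> M * nrm X x"
  shows "op_norm X Y S \<le> M"
  unfolding op_norm_def using assms by (intro cInf_lower bdd_belowI[of _ 0]) auto

text \<open>Passes an estimate to the best constant: it serves for operator norms, for infima over
  decompositions (the K-functional) and for infima over representations (the J-norm). Dividing by
  \<open>c\<close> gives a lower bound of \<open>A\<close>; for \<open>c = 0\<close> the single
  element \<open>M0\<close> gives the claim.\<close>

lemma Inf_mult_bound:
  fixes a c :: real
  assumes "M0 \<in> A" "\<And>M. M \<in> A \<Longrightarrow> a \<le> M * c" "0 \<le> c"
  shows "a \<le> Inf A * c"
proof (cases "c = 0")
  case True
  then show ?thesis using assms(1,2) by force
next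
  case False
  then have "a / c \<le> Inf A" using assms by (intro cInf_greatest) (auto simp: field_simps)
  then show ?thesis using False assms(3) by (simp add: field_simps)
qed

lemma op_norm_bound:
  assumes S: "bounded_linear_on X Y S" and X: "normed_space X" "x \<in> pts X"
  shows "nrm Y (S x) \<le> op_norm X Y S * nrm X x"
proof -
  obtain M where "0 \<le> M" "\<And>x. x \<in> pts X \<Longrightarrow> nrm Y (S x) \<le> M * nrm X x"
    using bounded_linear_onE[OF S X(1)] by blast
  then show ?thesis unfolding op_norm_def using X
    by (intro Inf_mult_bound[of M]) (auto intro: nrm_nonneg)
qed

lemma bilinear_op_norm_le:
  assumes "0 \<le> M" "\<And>x y. x \<in> pts X \<Longrightarrow> y \<in> pts Y \<Longrightarrow> nrm Z (T x y) \<le> M * nrm X x * nrm Y y"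
  shows "bilinear_op_norm X Y Z T \<le> M"
  unfolding bilinear_op_norm_def using assms by (intro cInf_lower bdd_belowI[of _ 0]) auto

lemma bilinear_op_norm_bound:
  assumes T: "bounded_bilinear_on X Y Z T" and XY: "normed_space X" "normed_space Y"
  shows "0 \<le> bilinear_op_norm X Y Z T"
    and "x \<in> pts X \<Longrightarrow> y \<in> pts Y \<Longrightarrow> nrm Z (T x y) \<le> bilinear_op_norm X Y Z T * nrm X x * nrm Y y"
proof -
  let ?A = "{M. 0 \<le> M \<and> (\<forall>x\<in>pts X. \<forall>y\<in>pts Y. nrm Z (T x y) \<le> M * nrm X x * nrm Y y)}"
  obtain M where M: "\<And>x y. x \<in> pts X \<Longrightarrow> y \<in> pts Y \<Longrightarrow> nrm Z (T x y) \<le> M * nrm X x * nrm Y y"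
    using T unfolding bounded_bilinear_on_def by blast
  \<comment> \<open>The constant provided by \<open>bounded_bilinear_on\<close> may be negative,
    whereas the infimum runs over nonnegative ones.\<close>
  have "nrm Z (T x y) \<le> \<bar>M\<bar> * nrm X x * nrm Y y" if "x \<in> pts X" "y \<in> pts Y" for x y
  proof -
    have "M * (nrm X x * nrm Y y) \<le> \<bar>M\<bar> * (nrm X x * nrm Y y)"
      using that XY by (intro mult_right_mono) (auto simp: nrm_nonneg)
    then show ?thesis using M[OF that] by (simp add: mult.assoc)
  qed
  then have A: "\<bar>M\<bar> \<in> ?A" by simp
  then show "0 \<le> bilinear_op_norm X Y Z T"
    unfolding bilinear_op_norm_def by (intro cInf_greatest) blast+
  show "nrm Z (T x y) \<le> bilinear_op_norm X Y Z T * nrm X x * nrm Y y" if "x \<in> pts X" "y \<in> pts Y"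
  proof -
    have "nrm Z (T x y) \<le> bilinear_op_norm X Y Z T * (nrm X x * nrm Y y)"
      unfolding bilinear_op_norm_def using that XY
      by (intro Inf_mult_bound[OF A]) (auto simp: nrm_nonneg mult.assoc)
    then show ?thesis by (simp add: mult.assoc)
  qed
qed

section \<open>The K-functional and the sum of a couple\<close>

lemma K_functional_nonneg:
  assumes "normed_space X0" "normed_space X1" "0 \<le> t" "x \<in> pts (sum_space X0 X1)"
  shows "0 \<le> K_functional X0 X1 t x"
  using assms unfolding K_functional_def sum_space_def
  by (intro cInf_greatest) (auto intro!: add_nonneg_nonneg mult_nonneg_nonneg nrm_nonneg)

lemma K_functional_le:
  assumes "normed_space X0" "normed_space X1" "0 \<le> t" "x0 \<in> pts X0" "x1 \<in> pts X1"
  shows "K_functional X0 X1 t (x0 + x1) \<le> nrm X0 x0 + t * nrm X1 x1"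
  using assms unfolding K_functional_def
  by (intro cInf_lower bdd_belowI[of _ 0])
    (auto intro!: add_nonneg_nonneg mult_nonneg_nonneg nrm_nonneg)

lemma K_functional_approx:
  assumes "x \<in> pts (sum_space X0 X1)" "K_functional X0 X1 t x < c"
  obtains x0 x1 where "x0 \<in> pts X0" "x1 \<in> pts X1" "x = x0 + x1" "nrm X0 x0 + t * nrm X1 x1 < c"
proof -
  let ?A = "{nrm X0 f0 + t * nrm X1 f1 | f0 f1. f0 \<in> pts X0 \<and> f1 \<in> pts X1 \<and> x = f0 + f1}"
  have "?A \<noteq> {}" using assms(1) by (auto simp: sum_space_def)
  then have "\<exists>y\<in>?A. y < c" using assms(2) unfolding K_functional_def by (rule cInf_lessD)
  then show ?thesis using that by blast
qed

lemma K_functional_greatest: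
  assumes "x \<in> pts (sum_space X0 X1)"
    and "\<And>x0 x1. x0 \<in> pts X0 \<Longrightarrow> x1 \<in> pts X1 \<Longrightarrow> x = x0 + x1 \<Longrightarrow> c \<le> nrm X0 x0 + t * nrm X1 x1"
  shows "c \<le> K_functional X0 X1 t x"
proof (rule ccontr)
  assume "\<not> ?thesis"
  then have "K_functional X0 X1 t x < c" by simp
  then show False using K_functional_approx[OF assms(1)] assms(2) by (metis not_le)
qed

lemma K_functional_swap: "K_functional X1 X0 1 = K_functional X0 X1 1"
  unfolding K_functional_def
  by (rule ext, rule arg_cong[where f=Inf]) (auto, (metis add.commute)+)

lemma sum_space_swap: "sum_space X1 X0 = sum_space X0 X1"
proof -
  have "pts (sum_space X1 X0) = pts (sum_space X0 X1)"
    unfolding sum_space_def by (auto, (metis add.commute)+)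
  then show ?thesis by (simp add: sum_space_def K_functional_swap[of X1 X0])
qed

text \<open>Two normed spaces whose sum carries a genuine norm; this is all of the compatibility of a
  couple that matters below.\<close>

locale separated_couple =
  fixes X0 X1 :: "'v::real_vector nspace"
  assumes n0: "normed_space X0" and n1: "normed_space X1"
    and separated: "\<And>x. x \<in> pts (sum_space X0 X1) \<Longrightarrow> K_functional X0 X1 1 x = 0 \<Longrightarrow> x = 0"
begin

abbreviation S where "S \<equiv> pts (sum_space X0 X1)"
abbreviation K where "K \<equiv> K_functional X0 X1"

text \<open>Every \<open>K t\<close> with \<open>t > 0\<close> is an equivalent norm on the sum. As
  a space of its own it makes the norm inequality for vector-valued integrals available for each
  \<open>K t\<close>, and not only for \<open>t = 1\<close>.\<close>

definition K_normed :: "real \<Rightarrow> 'v nspace" where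
  "K_normed t = \<lparr>pts = S, nrm = K t\<rparr>"

lemma K_normed_simps [simp]: "pts (K_normed t) = S" "nrm (K_normed t) = K t"
  by (simp_all add: K_normed_def)

lemma sum_space_eq: "sum_space X0 X1 = K_normed 1"
  by (simp add: K_normed_def sum_space_def)

lemma swapped: "separated_couple X1 X0"
proof
  fix x assume "x \<in> pts (sum_space X1 X0)" "K_functional X1 X0 1 x = 0"
  then show "x = 0"
    by (intro separated) (simp_all add: sum_space_swap[of X1 X0] K_functional_swap[of X1 X0])
qed (rule n1 n0)+

lemma mem_S: "x0 \<in> pts X0 \<Longrightarrow> x1 \<in> pts X1 \<Longrightarrow> x0 + x1 \<in> S"
  by (auto simp: sum_space_def)

lemma mem_S0: "x \<in> pts X0 \<Longrightarrow> x \<in> S"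
  using mem_S[of x 0] normed_zero[OF n1] by simp

lemma mem_S1: "x \<in> pts X1 \<Longrightarrow> x \<in> S"
  using mem_S[of 0 x] normed_zero[OF n0] by simp

lemma K_nonneg: "0 \<le> t \<Longrightarrow> x \<in> S \<Longrightarrow> 0 \<le> K t x"
  by (rule K_functional_nonneg[OF n0 n1])

lemma K_le: "0 \<le> t \<Longrightarrow> x0 \<in> pts X0 \<Longrightarrow> x1 \<in> pts X1 \<Longrightarrow> K t (x0 + x1) \<le> nrm X0 x0 + t * nrm X1 x1"
  by (rule K_functional_le[OF n0 n1])

lemma K_le0: "0 \<le> t \<Longrightarrow> x \<in> pts X0 \<Longrightarrow> K t x \<le> nrm X0 x"
  using K_le[of t x 0] normed_zero[OF n1] nrm_zero[OF n1] by simp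

lemma K_le1: "0 \<le> t \<Longrightarrow> x \<in> pts X1 \<Longrightarrow> K t x \<le> t * nrm X1 x"
  using K_le[of t 0 x] normed_zero[OF n0] nrm_zero[OF n0] by simp

lemma K_mono:
  assumes "0 \<le> s" "s \<le> t" "x \<in> S"
  shows "K s x \<le> K t x"
  using assms(3)
proof (rule K_functional_greatest)
  fix x0 x1 assume x: "x0 \<in> pts X0" "x1 \<in> pts X1" "x = x0 + x1"
  have "s * nrm X1 x1 \<le> t * nrm X1 x1" using assms x n1 by (intro mult_right_mono) (auto simp: nrm_nonneg)
  then show "K s x \<le> nrm X0 x0 + t * nrm X1 x1"
    using K_le[OF assms(1) x(1,2)] x(3) by simp
qed

text \<open>For every decomposition of \<open>x\<close>, the factor \<open>s / t \<le> 1\<close>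
  only decreases the first norm and turns the weight \<open>t\<close> of the second into
  \<open>s\<close>. Together with \<open>K_mono\<close> this is the quasi-concavity of the
  K-functional.\<close>

lemma K_ratio:
  assumes "0 < s" "s \<le> t" "x \<in> S"
  shows "s * K t x \<le> t * K s x"
proof -
  have "s / t * K t x \<le> K s x"
    using assms(3)
  proof (rule K_functional_greatest)
    fix x0 x1 assume x: "x0 \<in> pts X0" "x1 \<in> pts X1" "x = x0 + x1"
    have "s / t * K t x \<le> s / t * (nrm X0 x0 + t * nrm X1 x1)"
      using K_le[of t x0 x1] x assms by (intro mult_left_mono) auto
    also have "\<dots> = s / t * nrm X0 x0 + s * nrm X1 x1" using assms by (simp add: field_simps)
    also have "\<dots> \<le> nrm X0 x0 + s * nrm X1 x1"
      using assms nrm_nonneg[OF n0 x(1)] mult_right_mono[of "s/t" 1 "nrm X0 x0"] by simp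
    finally show "s / t * K t x \<le> nrm X0 x0 + s * nrm X1 x1" .
  qed
  then show ?thesis using assms by (simp add: field_simps)
qed

lemma K_le_max:
  assumes "0 < s" "0 < t" "x \<in> S"
  shows "K t x \<le> max 1 (t / s) * K s x"
proof (cases "t \<le> s")
  case True
  then show ?thesis using K_mono[of t s x] assms by (auto simp: max_def field_simps)
next
  case False
  then show ?thesis using K_ratio[of s t x] assms by (auto simp: max_def field_simps)
qed

lemma K_triangle:
  assumes t: "0 \<le> t" and xy: "x \<in> S" "y \<in> S"
  shows "K t (x + y) \<le> K t x + K t y"
proof (rule field_le_epsilon)
  fix e :: real assume "0 < e"
  then have "K t x < K t x + e/2" "K t y < K t y + e/2" by auto
  then obtain x0 x1 y0 y1 where x: "x0 \<in> pts X0" "x1 \<in> pts X1" "x = x0 + x1" "nrm X0 x0 + t * nrm X1 x1 < K t x + e/2"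
    and y: "y0 \<in> pts X0" "y1 \<in> pts X1" "y = y0 + y1" "nrm X0 y0 + t * nrm X1 y1 < K t y + e/2"
    using K_functional_approx[OF xy(1)] K_functional_approx[OF xy(2)] by metis
  have "K t ((x0 + y0) + (x1 + y1)) \<le> nrm X0 (x0 + y0) + t * nrm X1 (x1 + y1)"
    using x y t n0 n1 by (intro K_le) (auto intro: normed_add)
  also have "\<dots> \<le> (nrm X0 x0 + nrm X0 y0) + t * (nrm X1 x1 + nrm X1 y1)"
    using x y t n0 n1 by (intro add_mono mult_left_mono nrm_triangle) auto
  finally show "K t (x + y) \<le> K t x + K t y + e"
    using x y by (simp add: algebra_simps)
qed

lemma S_subspace: "subspace S"
proof (rule subspaceI)
  show "0 \<in> S" using mem_S0 normed_zero[OF n0] by blast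
next
  fix x y assume "x \<in> S" "y \<in> S"
  then obtain x0 x1 y0 y1 where "x0 \<in> pts X0" "x1 \<in> pts X1" "x = x0 + x1"
    "y0 \<in> pts X0" "y1 \<in> pts X1" "y = y0 + y1" by (auto simp: sum_space_def)
  then show "x + y \<in> S"
    using mem_S[of "x0 + y0" "x1 + y1"] n0 n1 by (auto simp: normed_add algebra_simps)
next
  fix c x assume "x \<in> S"
  then obtain x0 x1 where "x0 \<in> pts X0" "x1 \<in> pts X1" "x = x0 + x1" by (auto simp: sum_space_def)
  then show "c *\<^sub>R x \<in> S"
    using mem_S[of "c *\<^sub>R x0" "c *\<^sub>R x1"] n0 n1 by (auto simp: normed_scale algebra_simps)
qed

lemma K_scale_le:
  assumes t: "0 \<le> t" and x: "x \<in> S"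
  shows "K t (c *\<^sub>R x) \<le> \<bar>c\<bar> * K t x"
proof (cases "c = 0")
  case True
  then show ?thesis using K_le0[of t 0] normed_zero[OF n0] nrm_zero[OF n0] t by simp
next
  case False
  have "K t (c *\<^sub>R x) / \<bar>c\<bar> \<le> K t x"
    using x
  proof (rule K_functional_greatest)
    fix x0 x1 assume x: "x0 \<in> pts X0" "x1 \<in> pts X1" "x = x0 + x1"
    have "K t (c *\<^sub>R x0 + c *\<^sub>R x1) \<le> nrm X0 (c *\<^sub>R x0) + t * nrm X1 (c *\<^sub>R x1)"
      using x t n0 n1 by (intro K_le) (auto intro: normed_scale)
    also have "\<dots> = \<bar>c\<bar> * (nrm X0 x0 + t * nrm X1 x1)"
      using x n0 n1 by (simp add: nrm_scaleR algebra_simps)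
    finally show "K t (c *\<^sub>R x) / \<bar>c\<bar> \<le> nrm X0 x0 + t * nrm X1 x1"
      using False x by (simp add: field_simps scaleR_add_right)
  qed
  then show ?thesis using False by (simp add: field_simps)
qed

lemma K_scale:
  assumes t: "0 \<le> t" and x: "x \<in> S"
  shows "K t (c *\<^sub>R x) = \<bar>c\<bar> * K t x"
proof (rule antisym)
  show "K t (c *\<^sub>R x) \<le> \<bar>c\<bar> * K t x" by (rule K_scale_le[OF t x])
  show "\<bar>c\<bar> * K t x \<le> K t (c *\<^sub>R x)"
  proof (cases "c = 0")
    case True
    then show ?thesis using K_nonneg[OF t] S_subspace x by (simp add: subspace_0)
  next
    case False
    then show ?thesis
      using K_scale_le[OF t subspace_scale[OF S_subspace x], of "inverse c" c] by (simp add: field_simps)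
  qed
qed

lemma K_zero_iff:
  assumes t: "0 < t" and x: "x \<in> S"
  shows "K t x = 0 \<longleftrightarrow> x = 0"
proof
  assume "K t x = 0"
  then have "K 1 x = 0" using K_le_max[of t 1 x] K_nonneg[of 1 x] t x by simp
  then show "x = 0" using separated x by simp
next
  assume "x = 0"
  then show "K t x = 0" using K_scale[of t 0 0] S_subspace t by (simp add: subspace_0)
qed

lemma normed_K_normed: "0 < t \<Longrightarrow> normed_space (K_normed t)"
  unfolding normed_space_def
  by (auto simp: S_subspace K_nonneg K_zero_iff K_scale K_triangle)

lemma normed_sum_space: "normed_space (sum_space X0 X1)"
  unfolding sum_space_eq by (rule normed_K_normed) simp

lemma nrm_sum_space: "nrm (sum_space X0 X1) = K 1"
  by (simp add: sum_space_def)

lemma K_pos: "0 < t \<Longrightarrow> x \<in> S \<Longrightarrow> x \<noteq> 0 \<Longrightarrow> 0 < K t x"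
  using K_nonneg[of t x] K_zero_iff[of t x] by simp

lemma bounded_linear_incl0: "bounded_linear_on X0 (sum_space X0 X1) (\<lambda>x. x)"
  unfolding bounded_linear_on_def linear_on_def nrm_sum_space
  by (auto intro!: mem_S0 exI[of _ 1] K_le0)

lemma bounded_linear_incl1: "bounded_linear_on X1 (sum_space X0 X1) (\<lambda>x. x)"
  unfolding bounded_linear_on_def linear_on_def nrm_sum_space
  using K_le1[of 1] by (auto intro!: mem_S1 exI[of _ 1])

lemma bounded_linear_K_normed:
  assumes "0 < s" "0 < t"
  shows "bounded_linear_on (K_normed s) (K_normed t) (\<lambda>x. x)"
  unfolding bounded_linear_on_def linear_on_def
  using K_le_max[OF assms] by auto

text \<open>Near-optimal decompositions of the terms of a rapidly convergent series yield two
  rapidly convergent series of components, whose limits add up to the limit sought.\<close>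

lemma banach_sum_space:
  assumes "banach_space X0" "banach_space X1"
  shows "banach_space (sum_space X0 X1)"
proof (rule banach_spaceI_series[OF normed_sum_space])
  fix x :: "nat \<Rightarrow> 'v" assume xS: "\<And>k. x k \<in> S" and x: "\<And>k. nrm (sum_space X0 X1) (x k) \<le> (1/2)^k"
  have "\<exists>y z. y \<in> pts X0 \<and> z \<in> pts X1 \<and> x k = y + z \<and> nrm X0 y + 1 * nrm X1 z < 2 * (1/2)^k" for k
  proof -
    \<comment> \<open>The infimum need not be attained; the factor 2 leaves room for a
      decomposition.\<close>
    have "K 1 (x k) < 2 * (1/2)^k" using x[of k] by (simp add: nrm_sum_space less_le_trans order_le_less_trans)
    then show ?thesis using K_functional_approx[OF xS[of k], of 1 "2 * (1/2)^k"] by metis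
  qed
  then obtain y z where yz: "\<And>k. y k \<in> pts X0" "\<And>k. z k \<in> pts X1" "\<And>k. x k = y k + z k"
      "\<And>k. nrm X0 (y k) + nrm X1 (z k) < 2 * (1/2)^k" by (metis mult_1)
  \<comment> \<open>Halving restores the bound \<open>(1/2)^k\<close> for the components; the
    factors 2 in \<open>?c\<close> undo it.\<close>
  let ?y = "\<lambda>k. (1/2) *\<^sub>R y k" and ?z = "\<lambda>k. (1/2) *\<^sub>R z k"
  have y': "?y k \<in> pts X0" "nrm X0 (?y k) \<le> (1/2)^k" for k
    using yz(1,4)[of k] nrm_nonneg[OF n1 yz(2)[of k]] n0 by (auto simp: normed_scale nrm_scaleR)
  obtain a where a: "a \<in> pts X0" "(\<lambda>n. nrm X0 ((\<Sum>k<n. ?y k) - a)) \<longlonglongrightarrow> 0"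
    by (rule banach_space_series[OF assms(1), of ?y, OF y'])
  have z': "?z k \<in> pts X1" "nrm X1 (?z k) \<le> (1/2)^k" for k
    using yz(2,4)[of k] nrm_nonneg[OF n0 yz(1)[of k]] n1 by (auto simp: normed_scale nrm_scaleR)
  obtain b where b: "b \<in> pts X1" "(\<lambda>n. nrm X1 ((\<Sum>k<n. ?z k) - b)) \<longlonglongrightarrow> 0"
    by (rule banach_space_series[OF assms(2), of ?z, OF z'])
  let ?c = "2 *\<^sub>R a + 2 *\<^sub>R b"
  have c: "?c \<in> S" using a(1) b(1) n0 n1 by (intro mem_S normed_scale)
  have le: "K 1 ((\<Sum>k<n. x k) - ?c) \<le> 2 * nrm X0 ((\<Sum>k<n. ?y k) - a) + 2 * nrm X1 ((\<Sum>k<n. ?z k) - b)" for n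
  proof -
    have ya: "(\<Sum>k<n. ?y k) - a \<in> pts X0" using a(1) yz(1) n0 by (intro normed_diff normed_sum normed_scale)
    have zb: "(\<Sum>k<n. ?z k) - b \<in> pts X1" using b(1) yz(2) n1 by (intro normed_diff normed_sum normed_scale)
    have "(\<Sum>k<n. x k) - ?c = 2 *\<^sub>R ((\<Sum>k<n. ?y k) - a) + 2 *\<^sub>R ((\<Sum>k<n. ?z k) - b)"
      by (simp add: yz(3) sum.distrib scaleR_right.sum[symmetric] algebra_simps)
    then show ?thesis
      using K_le[of 1, OF _ normed_scale[OF n0 ya, of 2] normed_scale[OF n1 zb, of 2]]
      by (simp add: nrm_scaleR[OF n0 ya] nrm_scaleR[OF n1 zb])
  qed
  have lim: "(\<lambda>n. 2 * nrm X0 ((\<Sum>k<n. ?y k) - a) + 2 * nrm X1 ((\<Sum>k<n. ?z k) - b)) \<longlonglongrightarrow> 0"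
    using tendsto_add[OF tendsto_mult[OF tendsto_const a(2), of 2] tendsto_mult[OF tendsto_const b(2), of 2]] by simp
  have nonneg: "0 \<le> K 1 ((\<Sum>k<n. x k) - ?c)" for n
    using c xS S_subspace by (intro K_nonneg) (auto intro!: subspace_diff subspace_sum)
  have "(\<lambda>n. K 1 ((\<Sum>k<n. x k) - ?c)) \<longlonglongrightarrow> 0"
    by (rule LIMSEQ_zero_le[OF nonneg le lim])
  then show "\<exists>c\<in>S. (\<lambda>n. nrm (sum_space X0 X1) ((\<Sum>k<n. x k) - c)) \<longlonglongrightarrow> 0"
    using c by (auto simp: nrm_sum_space)
qed

end

section \<open>Norm topologies and the common Hausdorff space of a couple\<close>

lemma topological_vector_space_norm_topology:
  assumes X: "normed_space X"
  shows "topological_vector_space (norm_topology X)" "Hausdorff_space (norm_topology X)"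
proof -
  interpret M: Metric_space "pts X" "ndist X" by (rule Metric_space_ndist[OF X])
  have mt: "M.mtopology = norm_topology X" by (simp add: norm_topology_def)
  show "Hausdorff_space (norm_topology X)"
    using M.Hausdorff_space_mtopology by (simp add: mt)
  have nbhd: "openin (norm_topology X) U \<longleftrightarrow>
      U \<subseteq> pts X \<and> (\<forall>x\<in>U. \<exists>r>0. \<forall>y\<in>pts X. nrm X (x - y) < r \<longrightarrow> y \<in> U)" for U
  proof -
    have "M.mball x r \<subseteq> U \<longleftrightarrow> (\<forall>y\<in>pts X. nrm X (x - y) < r \<longrightarrow> y \<in> U)" if "x \<in> U" "U \<subseteq> pts X" for x r
      using that by (auto simp: subset_iff M.in_mball ndist_def)
    then show ?thesis unfolding mt[symmetric] M.openin_mtopology by (metis (no_types, lifting))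
  qed
  have ball: "openin (norm_topology X) {y \<in> pts X. nrm X (x - y) < r}" if "x \<in> pts X" for x r
  proof -
    have "M.mball x r = {y \<in> pts X. nrm X (x - y) < r}" using that by (auto simp: M.in_mball ndist_def)
    then show ?thesis using M.openin_mball[of x r] by (simp add: mt)
  qed
  have top: "topspace (norm_topology X) = pts X" by (rule topspace_norm_topology[OF X])
  have add: "continuous_map (prod_topology (norm_topology X) (norm_topology X)) (norm_topology X) (\<lambda>(x, y). x + y)"
    unfolding continuous_map_def
  proof (intro conjI allI impI)
    show "(\<lambda>(x, y). x + y) \<in> topspace (prod_topology (norm_topology X) (norm_topology X)) \<rightarrow> topspace (norm_topology X)"
      using X by (auto simp: top normed_add)
    fix U assume U: "openin (norm_topology X) U"
    show "openin (prod_topology (norm_topology X) (norm_topology X))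
       {p \<in> topspace (prod_topology (norm_topology X) (norm_topology X)). (case p of (x, y) \<Rightarrow> x + y) \<in> U}"
    proof (subst openin_prod_topology_alt, safe)
      fix x y assume "(x, y) \<in> topspace (prod_topology (norm_topology X) (norm_topology X))" and xyU: "x + y \<in> U"
      then have xy: "x \<in> pts X" "y \<in> pts X" by (auto simp: top)
      obtain r where r: "r > 0" "\<And>z. z \<in> pts X \<Longrightarrow> nrm X (x + y - z) < r \<Longrightarrow> z \<in> U"
        using U xyU unfolding nbhd by blast
      have "a + b \<in> U" if "a \<in> pts X" "nrm X (x - a) < r/2" "b \<in> pts X" "nrm X (y - b) < r/2" for a b
      proof (rule r(2))
        have "nrm X ((x - a) + (y - b)) \<le> nrm X (x - a) + nrm X (y - b)"
          using that xy X by (intro nrm_triangle normed_diff)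
        then show "nrm X (x + y - (a + b)) < r" using that by (simp add: algebra_simps)
      qed (use that X in \<open>simp add: normed_add\<close>)
      then show "\<exists>U' V. openin (norm_topology X) U' \<and> openin (norm_topology X) V \<and> x \<in> U' \<and> y \<in> V \<and>
          U' \<times> V \<subseteq> {p \<in> topspace (prod_topology (norm_topology X) (norm_topology X)). (case p of (x, y) \<Rightarrow> x + y) \<in> U}"
        using ball[OF xy(1), of "r/2"] ball[OF xy(2), of "r/2"] xy r(1)
        by (intro exI[of _ "{a \<in> pts X. nrm X (x - a) < r/2}"] exI[of _ "{b \<in> pts X. nrm X (y - b) < r/2}"])
          (auto simp: top nrm_zero[OF X])
    qed
  qed
  have scale: "continuous_map (prod_topology euclideanreal (norm_topology X)) (norm_topology X) (\<lambda>(c, x). c *\<^sub>R x)"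
    unfolding continuous_map_def
  proof (intro conjI allI impI)
    show "(\<lambda>(c, x). c *\<^sub>R x) \<in> topspace (prod_topology euclideanreal (norm_topology X)) \<rightarrow> topspace (norm_topology X)"
      using X by (auto simp: top normed_scale)
    fix U assume U: "openin (norm_topology X) U"
    show "openin (prod_topology euclideanreal (norm_topology X))
       {p \<in> topspace (prod_topology euclideanreal (norm_topology X)). (case p of (c, x) \<Rightarrow> c *\<^sub>R x) \<in> U}"
    proof (subst openin_prod_topology_alt, safe)
      fix c :: real and x assume "(c, x) \<in> topspace (prod_topology euclideanreal (norm_topology X))" and cxU: "c *\<^sub>R x \<in> U"
      then have x: "x \<in> pts X" by (auto simp: top)
      obtain r where r: "r > 0" "\<And>z. z \<in> pts X \<Longrightarrow> nrm X (c *\<^sub>R x - z) < r \<Longrightarrow> z \<in> U"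
        using U cxU unfolding nbhd by blast
      \<comment> \<open>Near \<open>(c, x)\<close> the deviation of \<open>d *\<^sub>R a\<close> is
        at most \<open>e * nrm X x + (\<bar>c\<bar> + 1) * e\<close>, where \<open>e \<le> 1\<close>
        serves to bound \<open>\<bar>d\<bar>\<close>. The 2 in the denominator, instead of 1, makes
        the final estimate strict.\<close>
      define e where "e = min 1 (r / (2 + \<bar>c\<bar> + nrm X x))"
      have x0: "0 \<le> nrm X x" using x X by (simp add: nrm_nonneg)
      have e: "0 < e" "e \<le> 1" "e * (2 + \<bar>c\<bar> + nrm X x) \<le> r"
      proof -
        have p: "0 < 2 + \<bar>c\<bar> + nrm X x" using x0 by linarith
        show "0 < e" "e \<le> 1" using r(1) p by (simp_all add: e_def)
        have "e \<le> r / (2 + \<bar>c\<bar> + nrm X x)" by (simp add: e_def)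
        then show "e * (2 + \<bar>c\<bar> + nrm X x) \<le> r" using p by (simp add: pos_le_divide_eq)
      qed
      have "d *\<^sub>R a \<in> U" if "\<bar>c - d\<bar> < e" "a \<in> pts X" "nrm X (x - a) < e" for d a
      proof (rule r(2))
        have xa: "x - a \<in> pts X" using x that X by (simp add: normed_diff)
        have "c *\<^sub>R x - d *\<^sub>R a = (c - d) *\<^sub>R x + d *\<^sub>R (x - a)" by (simp add: algebra_simps)
        also have "nrm X \<dots> \<le> nrm X ((c - d) *\<^sub>R x) + nrm X (d *\<^sub>R (x - a))"
          using x xa X by (intro nrm_triangle normed_scale)
        also have "\<dots> = \<bar>c - d\<bar> * nrm X x + \<bar>d\<bar> * nrm X (x - a)"
          using x xa X by (simp add: nrm_scaleR)
        also have "\<dots> \<le> e * nrm X x + (\<bar>c\<bar> + 1) * e"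
          using that e x0 X xa by (intro add_mono mult_mono) (auto simp: nrm_nonneg)
        also have "\<dots> < e * (2 + \<bar>c\<bar> + nrm X x)" using e by (simp add: algebra_simps)
        finally show "nrm X (c *\<^sub>R x - d *\<^sub>R a) < r" using e by simp
      qed (use that X in \<open>simp add: normed_scale\<close>)
      then show "\<exists>U' V. openin euclideanreal U' \<and> openin (norm_topology X) V \<and> c \<in> U' \<and> x \<in> V \<and>
          U' \<times> V \<subseteq> {p \<in> topspace (prod_topology euclideanreal (norm_topology X)). (case p of (c, x) \<Rightarrow> c *\<^sub>R x) \<in> U}"
        using ball[OF x, of e] x e(1)
        by (intro exI[of _ "ball c e"] exI[of _ "{a \<in> pts X. nrm X (x - a) < e}"])
          (auto simp: top nrm_zero[OF X] dist_real_def)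
    qed
  qed
  show "topological_vector_space (norm_topology X)"
    unfolding topological_vector_space_def top using X add scale by (simp add: normed_space_def)
qed

lemma continuous_map_norm_topology_incl:
  assumes X: "normed_space X" and Y: "normed_space Y"
    and sub: "\<And>x. x \<in> pts X \<Longrightarrow> x \<in> pts Y \<and> nrm Y x \<le> nrm X x"
  shows "continuous_map (norm_topology X) (norm_topology Y) (\<lambda>x. x)"
proof -
  interpret MX: Metric_space "pts X" "ndist X" by (rule Metric_space_ndist[OF X])
  interpret MY: Metric_space "pts Y" "ndist Y" by (rule Metric_space_ndist[OF Y])
  have "openin MX.mtopology {x \<in> pts X. x \<in> U}" if "openin MY.mtopology U" for U
    unfolding MX.openin_mtopology
  proof (safe)
    fix x assume "x \<in> U" "x \<in> pts X"
    have "\<exists>r>0. MY.mball x r \<subseteq> U" using that \<open>x \<in> U\<close> unfolding MY.openin_mtopology by simp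
    then obtain r where "r > 0" "MY.mball x r \<subseteq> U" by auto
    moreover have "MX.mball x r \<subseteq> MY.mball x r"
    proof
      fix y assume y: "y \<in> MX.mball x r"
      then have "x \<in> pts X" "y \<in> pts X" "nrm X (x - y) < r" by (auto simp: MX.in_mball ndist_def)
      then show "y \<in> MY.mball x r"
        using sub[of x] sub[of y] sub[OF normed_diff[OF X, of x y]] by (auto simp: MY.in_mball ndist_def)
    qed
    ultimately show "\<exists>r>0. MX.mball x r \<subseteq> {x \<in> pts X. x \<in> U}" by (blast dest: MX.mball_subset_mspace[THEN subsetD])
  qed
  then show ?thesis
    unfolding continuous_map_def norm_topology_def using sub by auto
qed

text \<open>The sum with its own norm serves as the common Hausdorff vector space. For function
  spaces it is therefore enough that the K-functional separates points.\<close>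

lemma (in separated_couple) compatible_coupleI:
  assumes "banach_space X0" "banach_space X1"
  shows "compatible_couple X0 X1"
proof -
  have "continuous_map (norm_topology X0) (norm_topology (sum_space X0 X1)) (\<lambda>x. x)"
    by (rule continuous_map_norm_topology_incl[OF n0 normed_sum_space]) (simp add: nrm_sum_space mem_S0 K_le0)
  moreover have "continuous_map (norm_topology X1) (norm_topology (sum_space X0 X1)) (\<lambda>x. x)"
    using K_le1[of 1] by (intro continuous_map_norm_topology_incl[OF n1 normed_sum_space]) (simp add: nrm_sum_space mem_S1)
  ultimately show ?thesis
    unfolding compatible_couple_def
    using assms topological_vector_space_norm_topology[OF normed_sum_space] by blast
qed

text \<open>If the K-functional of \<open>x\<close> vanishes, then \<open>x = y n + z n\<close> with
  \<open>y n\<close> tending to 0 in \<open>X0\<close> and \<open>z n\<close> in \<open>X1\<close>.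
  Both tend to 0 in the ambient topology, hence so does the constant sequence \<open>x\<close>, and
  the Hausdorff property gives \<open>x = 0\<close>.\<close>

lemma compatible_coupleD:
  assumes "compatible_couple X0 X1"
  shows "banach_space X0" "banach_space X1" "separated_couple X0 X1"
proof -
  show X: "banach_space X0" "banach_space X1" using assms by (auto simp: compatible_couple_def)
  have n: "normed_space X0" "normed_space X1" using X by (auto intro: banach_space_normed)
  obtain \<tau> where tvs: "topological_vector_space \<tau>" and H: "Hausdorff_space \<tau>"
    and cont: "continuous_map (norm_topology X0) \<tau> (\<lambda>x. x)" "continuous_map (norm_topology X1) \<tau> (\<lambda>x. x)"
    using assms by (auto simp: compatible_couple_def)
  show "separated_couple X0 X1"
  proof
    fix x assume x: "x \<in> pts (sum_space X0 X1)" "K_functional X0 X1 1 x = 0"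
    have "\<exists>y z. y \<in> pts X0 \<and> z \<in> pts X1 \<and> x = y + z \<and> nrm X0 y + 1 * nrm X1 z < inverse (Suc n)" for n
      using K_functional_approx[OF x(1), of 1 "inverse (Suc n)"] x(2) by (metis inverse_positive_iff_positive of_nat_0_less_iff zero_less_Suc)
    then obtain y z where yz: "\<And>n. y n \<in> pts X0" "\<And>n. z n \<in> pts X1" "\<And>n. x = y n + z n"
      "\<And>n. nrm X0 (y n) + nrm X1 (z n) < inverse (Suc n)" by (metis mult_1)
    have nn: "0 \<le> nrm X0 (y n)" "0 \<le> nrm X1 (z n)" for n
      using yz n by (auto intro: nrm_nonneg)
    have "(\<lambda>n. nrm X0 (y n)) \<longlonglongrightarrow> 0"
    proof (rule LIMSEQ_zero_le[OF _ _ LIMSEQ_inverse_real_of_nat])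
      fix n show "0 \<le> nrm X0 (y n)" "nrm X0 (y n) \<le> inverse (real (Suc n))"
        using nn[of n] yz(4)[of n] by linarith+
    qed
    then have "limitin (norm_topology X0) y 0 sequentially"
      using nrm_tendsto_iff[OF n(1) yz(1) normed_zero[OF n(1)]] by simp
    then have y: "limitin \<tau> y 0 sequentially"
      using continuous_map_limit[OF cont(1)] by (simp add: o_def)
    have "(\<lambda>n. nrm X1 (z n)) \<longlonglongrightarrow> 0"
    proof (rule LIMSEQ_zero_le[OF _ _ LIMSEQ_inverse_real_of_nat])
      fix n show "0 \<le> nrm X1 (z n)" "nrm X1 (z n) \<le> inverse (real (Suc n))"
        using nn[of n] yz(4)[of n] by linarith+
    qed
    then have "limitin (norm_topology X1) z 0 sequentially"
      using nrm_tendsto_iff[OF n(2) yz(2) normed_zero[OF n(2)]] by simp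
    then have z: "limitin \<tau> z 0 sequentially"
      using continuous_map_limit[OF cont(2)] by (simp add: o_def)
    have "limitin (prod_topology \<tau> \<tau>) (\<lambda>n. (y n, z n)) (0, 0) sequentially"
      using y z by (simp add: limitin_pairwise o_def)
    then have "limitin \<tau> ((\<lambda>(x, y). x + y) \<circ> (\<lambda>n. (y n, z n))) (case (0, 0) of (x, y) \<Rightarrow> x + y) sequentially"
      using tvs by (intro continuous_map_limit) (auto simp: topological_vector_space_def)
    then have lim0: "limitin \<tau> (\<lambda>n. x) 0 sequentially"
      using yz(3) by (simp add: o_def)
    have "y 0 \<in> topspace \<tau>" "z 0 \<in> topspace \<tau>"
      using cont yz topspace_norm_topology[OF n(1)] topspace_norm_topology[OF n(2)] by (auto simp: continuous_map_def Pi_iff)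
    then have "x \<in> topspace \<tau>"
      using yz(3)[of 0] tvs subspace_add unfolding topological_vector_space_def by metis
    then have "limitin \<tau> (\<lambda>n. x) x sequentially" by simp
    then show "x = 0"
      using limitin_Hausdorff_unique[OF _ lim0 _ H] by simp
  qed (rule n)+
qed

section \<open>Bochner integration with values in a carrier\<close>

abbreviation simple_integrable where
  "simple_integrable \<equiv> Bochner_Integration.simple_bochner_integrable (lebesgue :: real measure)"

abbreviation simple_integral_of where
  "simple_integral_of \<equiv> Bochner_Integration.simple_bochner_integral (lebesgue :: real measure)"

lemma borel_measurable_lebesgue_AE_cong:
  fixes f g :: "real \<Rightarrow> 'b::topological_space"
  assumes g: "g \<in> borel_measurable lebesgue" and eq: "AE x in lebesgue. f x = g x"
  shows "f \<in> borel_measurable lebesgue"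
proof (rule measurableI)
  fix A :: "'b set" assume "A \<in> sets borel"
  then have A: "g -` A \<inter> space lebesgue \<in> sets lebesgue" by (rule measurable_sets[OF g])
  have "AE x in lebesgue. x \<in> g -` A \<inter> space lebesgue \<longleftrightarrow> x \<in> f -` A \<inter> space lebesgue"
    using eq by eventually_elim simp
  then show "f -` A \<inter> space lebesgue \<in> sets lebesgue"
    by (rule completion.in_sets_AE[OF _ A]) simp
qed simp

lemma ennreal_tendsto_0_le:
  fixes f g :: "nat \<Rightarrow> ennreal"
  assumes "\<And>n. f n \<le> g n" "g \<longlonglongrightarrow> 0"
  shows "f \<longlonglongrightarrow> 0"
  by (rule tendsto_sandwich[OF _ _ tendsto_const assms(2)]) (simp_all add: assms(1))

lemma strongly_measurable_in_mem: "strongly_measurable_in X f \<Longrightarrow> f t \<in> pts X"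
  by (auto simp: strongly_measurable_in_def)

lemma strongly_measurable_in_simple:
  assumes "normed_space X" "simple_function lebesgue s" "range s \<subseteq> pts X"
  shows "strongly_measurable_in X s"
  unfolding strongly_measurable_in_def using assms by (auto intro!: exI[of _ "\<lambda>_. s"] simp: nrm_zero)

text \<open>The norms of the simple approximants are measurable and converge to the norm of
  \<open>f\<close> off a null set; completeness of Lebesgue measure absorbs the null set.\<close>

lemma strongly_measurable_in_nrm:
  assumes X: "normed_space X" and f: "strongly_measurable_in X f"
  shows "(\<lambda>t. nrm X (f t)) \<in> borel_measurable lebesgue"
proof -
  obtain s where s: "\<And>i::nat. simple_function lebesgue (s i)" "\<And>i. range (s i) \<subseteq> pts X"
    and lim: "AE t in lebesgue. (\<lambda>i. nrm X (s i t - f t)) \<longlonglongrightarrow> 0"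
    using f unfolding strongly_measurable_in_def by blast
  have fX: "f t \<in> pts X" for t using f by (rule strongly_measurable_in_mem)
  have sX: "s i t \<in> pts X" for i t using s(2) by auto
  have m: "(\<lambda>t. nrm X (s i t)) \<in> borel_measurable lebesgue" for i
    using simple_function_compose1[OF s(1), of "nrm X"] by (rule borel_measurable_simple_function)
  have "(\<lambda>t. lim (\<lambda>i. nrm X (s i t))) \<in> borel_measurable lebesgue"
    using m by (rule borel_measurable_lim_metric)
  moreover have "AE t in lebesgue. nrm X (f t) = lim (\<lambda>i. nrm X (s i t))"
    using lim
  proof eventually_elim
    fix t assume t: "(\<lambda>i. nrm X (s i t - f t)) \<longlonglongrightarrow> 0"
    have "(\<lambda>i. nrm X (s i t) - nrm X (f t)) \<longlonglongrightarrow> 0"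
      by (rule tendsto_rabs_zero_cancel, rule LIMSEQ_zero_le[OF abs_ge_zero nrm_abs_diff[OF X sX fX] t])
    then show "nrm X (f t) = lim (\<lambda>i. nrm X (s i t))"
      by (simp add: LIM_zero_iff limI)
  qed
  ultimately show ?thesis by (rule borel_measurable_lebesgue_AE_cong)
qed

lemma strongly_measurable_in_add:
  assumes X: "normed_space X" and f: "strongly_measurable_in X f" and g: "strongly_measurable_in X g"
  shows "strongly_measurable_in X (\<lambda>t. f t + g t)"
proof -
  obtain s where s: "\<And>i::nat. simple_function lebesgue (s i)" "\<And>i. range (s i) \<subseteq> pts X"
    and slim: "AE t in lebesgue. (\<lambda>i. nrm X (s i t - f t)) \<longlonglongrightarrow> 0"
    using f unfolding strongly_measurable_in_def by blast
  obtain r where r: "\<And>i::nat. simple_function lebesgue (r i)" "\<And>i. range (r i) \<subseteq> pts X"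
    and rlim: "AE t in lebesgue. (\<lambda>i. nrm X (r i t - g t)) \<longlonglongrightarrow> 0"
    using g unfolding strongly_measurable_in_def by blast
  have mem: "f t \<in> pts X" "g t \<in> pts X" "s i t \<in> pts X" "r i t \<in> pts X" for t i
    using strongly_measurable_in_mem[OF f] strongly_measurable_in_mem[OF g] s(2) r(2) by blast+
  have "AE t in lebesgue. (\<lambda>i. nrm X (s i t + r i t - (f t + g t))) \<longlonglongrightarrow> 0"
    using slim rlim
  proof eventually_elim
    fix t assume lim: "(\<lambda>i. nrm X (s i t - f t)) \<longlonglongrightarrow> 0" "(\<lambda>i. nrm X (r i t - g t)) \<longlonglongrightarrow> 0"
    have eq: "s i t + r i t - (f t + g t) = (s i t - f t) + (r i t - g t)" for i by simp
    have "(\<lambda>i. nrm X (s i t - f t) + nrm X (r i t - g t)) \<longlonglongrightarrow> 0"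
      using tendsto_add[OF lim] by simp
    then show "(\<lambda>i. nrm X (s i t + r i t - (f t + g t))) \<longlonglongrightarrow> 0"
      unfolding eq
      by (rule LIMSEQ_zero_le[rotated 2])
        (auto intro!: nrm_nonneg nrm_triangle normed_add normed_diff X mem)
  qed
  moreover have "simple_function lebesgue (\<lambda>t. s i t + r i t)" for i
    using s(1) r(1) by (rule simple_function_compose2)
  ultimately show ?thesis
    unfolding strongly_measurable_in_def
    using mem X by (auto intro!: exI[of _ "\<lambda>i t. s i t + r i t"] normed_add)
qed

lemma strongly_measurable_in_linear:
  assumes X: "normed_space X" and Y: "normed_space Y"
    and L: "bounded_linear_on X Y L" and f: "strongly_measurable_in X f"
  shows "strongly_measurable_in Y (\<lambda>t. L (f t))"
proof -
  obtain s where s: "\<And>i::nat. simple_function lebesgue (s i)" "\<And>i. range (s i) \<subseteq> pts X"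
    and slim: "AE t in lebesgue. (\<lambda>i. nrm X (s i t - f t)) \<longlonglongrightarrow> 0"
    using f unfolding strongly_measurable_in_def by blast
  obtain M where M: "0 \<le> M" "\<And>x. x \<in> pts X \<Longrightarrow> nrm Y (L x) \<le> M * nrm X x"
    using bounded_linear_onE[OF L X] by blast
  have LY: "L x \<in> pts Y" if "x \<in> pts X" for x using L that by (auto simp: bounded_linear_on_def)
  have mem: "f t \<in> pts X" "s i t \<in> pts X" for t i
    using strongly_measurable_in_mem[OF f] s(2) by blast+
  have lin: "linear_on (pts X) L" using L by (simp add: bounded_linear_on_def)
  have "AE t in lebesgue. (\<lambda>i. nrm Y (L (s i t) - L (f t))) \<longlonglongrightarrow> 0"
    using slim
  proof eventually_elim
    fix t assume lim: "(\<lambda>i. nrm X (s i t - f t)) \<longlonglongrightarrow> 0"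
    have eq: "L (s i t) - L (f t) = L (s i t - f t)" for i
      using linear_on_diff[OF lin mem(2,1) normed_subspace[OF X]] by simp
    have "(\<lambda>i. M * nrm X (s i t - f t)) \<longlonglongrightarrow> 0"
      using tendsto_mult[OF tendsto_const lim] by simp
    then show "(\<lambda>i. nrm Y (L (s i t) - L (f t))) \<longlonglongrightarrow> 0"
      unfolding eq
      by (rule LIMSEQ_zero_le[rotated 2])
        (auto intro!: nrm_nonneg[OF Y] LY M normed_diff[OF X] mem)
  qed
  moreover have "simple_function lebesgue (\<lambda>t. L (s i t))" for i
    using s(1) by (rule simple_function_compose1)
  ultimately show ?thesis
    unfolding strongly_measurable_in_def
    using mem LY by (auto intro!: exI[of _ "\<lambda>i t. L (s i t)"])
qed

lemma strongly_measurable_in_restrict: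
  assumes X: "normed_space X" and f: "strongly_measurable_in X f" and A: "A \<in> sets lebesgue"
  shows "strongly_measurable_in X (\<lambda>t. if t \<in> A then f t else 0)"
proof -
  obtain s where s: "\<And>i::nat. simple_function lebesgue (s i)" "\<And>i. range (s i) \<subseteq> pts X"
    and slim: "AE t in lebesgue. (\<lambda>i. nrm X (s i t - f t)) \<longlonglongrightarrow> 0"
    using f unfolding strongly_measurable_in_def by blast
  have mem: "f t \<in> pts X" "s i t \<in> pts X" for t i
    using strongly_measurable_in_mem[OF f] s(2) by blast+
  have "AE t in lebesgue. (\<lambda>i. nrm X ((if t \<in> A then s i t else 0) - (if t \<in> A then f t else 0))) \<longlonglongrightarrow> 0"
    using slim by eventually_elim (auto simp: nrm_zero[OF X])
  moreover have "simple_function lebesgue (\<lambda>t. if t \<in> A then s i t else 0)" for i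
    using s(1) A by (intro simple_function_If_set) auto
  ultimately show ?thesis
    unfolding strongly_measurable_in_def
    using mem X by (auto intro!: exI[of _ "\<lambda>i t. if t \<in> A then s i t else 0"] simp: normed_zero)
qed

lemma bounded_linear_scaleR:
  assumes "normed_space X"
  shows "bounded_linear_on X X (\<lambda>x. c *\<^sub>R x)"
  unfolding bounded_linear_on_def linear_on_def
  using assms by (auto simp: algebra_simps normed_scale nrm_scaleR intro!: exI[of _ "\<bar>c\<bar>"])

lemma strongly_measurable_in_diff:
  assumes X: "normed_space X" and f: "strongly_measurable_in X f" and g: "strongly_measurable_in X g"
  shows "strongly_measurable_in X (\<lambda>t. f t - g t)"
  using strongly_measurable_in_add[OF X f strongly_measurable_in_linear[OF X X bounded_linear_scaleR[OF X, of "-1"] g]]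
  by simp

section \<open>Integrals of simple functions and their limits\<close>

lemma simple_bochner_integral_in:
  assumes X: "normed_space X" and s: "simple_integrable s" "range s \<subseteq> pts X"
  shows "simple_integral_of s \<in> pts X"
  unfolding simple_bochner_integral_def using s(2) X by (auto intro!: normed_sum normed_scale)

lemma simple_bochner_integral_linear_on:
  assumes X: "normed_space X" and L: "linear_on (pts X) L"
    and s: "simple_integrable s" "range s \<subseteq> pts X"
  shows "simple_integrable (\<lambda>t. L (s t))"
    and "simple_integral_of (\<lambda>t. L (s t)) = L (simple_integral_of s)"
proof -
  have L0: "L 0 = 0" by (rule linear_on_zero[OF L normed_zero[OF X]])
  show int: "simple_integrable (\<lambda>t. L (s t))"
    using simple_bochner_integrable_compose2[where p="\<lambda>x y. L x", OF _ s(1) s(1)] L0 by simp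
  have sf: "simple_function lebesgue s" using s(1) by (simp add: simple_bochner_integrable.simps)
  have "simple_integral_of (\<lambda>t. L (s t)) =
      (\<Sum>y\<in>s ` space lebesgue. measure lebesgue {x \<in> space lebesgue. s x = y} *\<^sub>R L y)"
    by (rule simple_bochner_integral_partition[OF int sf]) auto
  also have "\<dots> = (\<Sum>y\<in>s ` space lebesgue. L (measure lebesgue {x \<in> space lebesgue. s x = y} *\<^sub>R y))"
    using L s(2) by (intro sum.cong) (auto simp: linear_on_def)
  also have "\<dots> = L (simple_integral_of s)"
    unfolding simple_bochner_integral_def using s(2) X
    by (intro linear_on_sum[OF L normed_subspace[OF X], symmetric]) (auto intro: normed_scale)
  finally show "simple_integral_of (\<lambda>t. L (s t)) = L (simple_integral_of s)" .
qed

lemma simple_bochner_integral_nrm_le: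
  assumes X: "normed_space X" and s: "simple_integrable s" "range s \<subseteq> pts X"
  shows "ennreal (nrm X (simple_integral_of s)) \<le> (\<integral>\<^sup>+t. ennreal (nrm X (s t)) \<partial>lebesgue)"
proof -
  have int: "simple_integrable (\<lambda>t. nrm X (s t))"
    using simple_bochner_integrable_compose2[where p="\<lambda>x y. nrm X x", OF _ s(1) s(1)] nrm_zero[OF X] by simp
  have sf: "simple_function lebesgue s" using s(1) by (simp add: simple_bochner_integrable.simps)
  have "nrm X (simple_integral_of s) \<le>
     (\<Sum>y\<in>s ` space lebesgue. nrm X (measure lebesgue {x \<in> space lebesgue. s x = y} *\<^sub>R y))"
    unfolding simple_bochner_integral_def using s(2) X by (intro normed_sum(2)) (auto intro: normed_scale)
  also have "\<dots> = (\<Sum>y\<in>s ` space lebesgue. measure lebesgue {x \<in> space lebesgue. s x = y} *\<^sub>R nrm X y)"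
    using s(2) X by (intro sum.cong) (auto simp: nrm_scaleR)
  also have "\<dots> = simple_integral_of (\<lambda>t. nrm X (s t))"
    by (rule simple_bochner_integral_partition[OF int sf, symmetric]) auto
  finally have "ennreal (nrm X (simple_integral_of s)) \<le> ennreal (simple_integral_of (\<lambda>t. nrm X (s t)))"
    by (rule ennreal_leI)
  also have "\<dots> = (\<integral>\<^sup>+t. ennreal (nrm X (s t)) \<partial>lebesgue)"
    using s(2) X by (intro simple_bochner_integral_eq_nn_integral[OF int]) (auto intro: nrm_nonneg)
  finally show ?thesis .
qed

lemma has_bochner_integral_inD:
  assumes "has_bochner_integral_in X f a"
  shows "a \<in> pts X" "strongly_measurable_in X f"
  using assms by (auto simp: has_bochner_integral_in_def)

lemma has_bochner_integral_inE:
  assumes "has_bochner_integral_in X f a"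
  obtains s where "\<forall>i::nat. simple_integrable (s i) \<and> range (s i) \<subseteq> pts X"
    "(\<lambda>i. \<integral>\<^sup>+t. ennreal (nrm X (f t - s i t)) \<partial>lebesgue) \<longlonglongrightarrow> 0"
    "(\<lambda>i. nrm X (simple_integral_of (s i) - a)) \<longlonglongrightarrow> 0"
  using assms unfolding has_bochner_integral_in_def by blast

lemma strongly_measurable_in_diff_simple:
  assumes X: "normed_space X" and f: "strongly_measurable_in X f"
    and s: "simple_integrable s" "range s \<subseteq> pts X"
  shows "strongly_measurable_in X (\<lambda>t. f t - s t)"
  using s by (intro strongly_measurable_in_diff[OF X f] strongly_measurable_in_simple[OF X])
    (auto simp: simple_bochner_integrable.simps)

lemma has_bochner_integral_in_add:
  assumes X: "normed_space X" and f: "has_bochner_integral_in X f a" and g: "has_bochner_integral_in X g b"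
  shows "has_bochner_integral_in X (\<lambda>t. f t + g t) (a + b)"
proof -
  note fm = has_bochner_integral_inD[OF f] and gm = has_bochner_integral_inD[OF g]
  obtain s where s': "\<forall>i::nat. simple_integrable (s i) \<and> range (s i) \<subseteq> pts X"
    and slim: "(\<lambda>i. \<integral>\<^sup>+t. ennreal (nrm X (f t - s i t)) \<partial>lebesgue) \<longlonglongrightarrow> 0"
    "(\<lambda>i. nrm X (simple_integral_of (s i) - a)) \<longlonglongrightarrow> 0"
    by (rule has_bochner_integral_inE[OF f])
  then have s: "simple_integrable (s i)" "range (s i) \<subseteq> pts X" for i by blast+
  obtain r where r': "\<forall>i::nat. simple_integrable (r i) \<and> range (r i) \<subseteq> pts X"
    and rlim: "(\<lambda>i. \<integral>\<^sup>+t. ennreal (nrm X (g t - r i t)) \<partial>lebesgue) \<longlonglongrightarrow> 0"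
    "(\<lambda>i. nrm X (simple_integral_of (r i) - b)) \<longlonglongrightarrow> 0"
    by (rule has_bochner_integral_inE[OF g])
  then have r: "simple_integrable (r i)" "range (r i) \<subseteq> pts X" for i by blast+
  have mem: "f t \<in> pts X" "g t \<in> pts X" "s i t \<in> pts X" "r i t \<in> pts X" for t i
    using strongly_measurable_in_mem[OF fm(2)] strongly_measurable_in_mem[OF gm(2)] s(2) r(2) by blast+
  let ?I = "simple_integral_of"
  have Imem: "?I (s i) \<in> pts X" "?I (r i) \<in> pts X" for i
    by (rule simple_bochner_integral_in[OF X s], rule simple_bochner_integral_in[OF X r])
  have int: "simple_integrable (\<lambda>t. s i t + r i t)" for i
    using simple_bochner_integrable_compose2[where p="(+)", OF _ s(1) r(1)] by simp
  have m: "(\<lambda>t. ennreal (nrm X (f t - s i t))) \<in> borel_measurable lebesgue"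
    "(\<lambda>t. ennreal (nrm X (g t - r i t))) \<in> borel_measurable lebesgue" for i
    using strongly_measurable_in_nrm[OF X strongly_measurable_in_diff_simple[OF X fm(2) s]]
      strongly_measurable_in_nrm[OF X strongly_measurable_in_diff_simple[OF X gm(2) r]] by auto
  have "(\<integral>\<^sup>+t. ennreal (nrm X (f t + g t - (s i t + r i t))) \<partial>lebesgue) \<le>
     (\<integral>\<^sup>+t. ennreal (nrm X (f t - s i t)) \<partial>lebesgue) + (\<integral>\<^sup>+t. ennreal (nrm X (g t - r i t)) \<partial>lebesgue)" for i
  proof -
    have "ennreal (nrm X (f t + g t - (s i t + r i t))) \<le> ennreal (nrm X (f t - s i t)) + ennreal (nrm X (g t - r i t))" for t
    proof -
      have "nrm X ((f t - s i t) + (g t - r i t)) \<le> nrm X (f t - s i t) + nrm X (g t - r i t)"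
        by (intro nrm_triangle normed_diff X mem)
      then show ?thesis
        using mem by (auto simp: ennreal_plus[symmetric] nrm_nonneg[OF X] normed_diff[OF X] algebra_simps
            simp del: ennreal_plus intro!: ennreal_leI)
    qed
    then show ?thesis using m by (subst nn_integral_add[symmetric]) (auto intro!: nn_integral_mono)
  qed
  moreover have "(\<lambda>i. (\<integral>\<^sup>+t. ennreal (nrm X (f t - s i t)) \<partial>lebesgue) + (\<integral>\<^sup>+t. ennreal (nrm X (g t - r i t)) \<partial>lebesgue)) \<longlonglongrightarrow> 0"
    using tendsto_add[OF slim(1) rlim(1)] by simp
  ultimately have lim1: "(\<lambda>i. \<integral>\<^sup>+t. ennreal (nrm X (f t + g t - (s i t + r i t))) \<partial>lebesgue) \<longlonglongrightarrow> 0"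
    by (rule ennreal_tendsto_0_le)
  have le: "nrm X (?I (\<lambda>t. s i t + r i t) - (a + b)) \<le> nrm X (?I (s i) - a) + nrm X (?I (r i) - b)" for i
  proof -
    have "nrm X ((?I (s i) - a) + (?I (r i) - b)) \<le> nrm X (?I (s i) - a) + nrm X (?I (r i) - b)"
      by (intro nrm_triangle normed_diff X Imem fm gm)
    then show ?thesis using simple_bochner_integral_add[OF s(1) r(1)] by (simp add: algebra_simps)
  qed
  have nn: "0 \<le> nrm X (?I (\<lambda>t. s i t + r i t) - (a + b))" for i
    using mem fm gm by (intro nrm_nonneg[OF X] normed_diff[OF X] normed_add[OF X] simple_bochner_integral_in[OF X int])
      (auto intro: normed_add[OF X])
  have lim: "(\<lambda>i. nrm X (?I (s i) - a) + nrm X (?I (r i) - b)) \<longlonglongrightarrow> 0"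
    using tendsto_add[OF slim(2) rlim(2)] by simp
  have lim2: "(\<lambda>i. nrm X (?I (\<lambda>t. s i t + r i t) - (a + b))) \<longlonglongrightarrow> 0"
    by (rule LIMSEQ_zero_le[OF nn le lim])
  show ?thesis
    unfolding has_bochner_integral_in_def
    using strongly_measurable_in_add[OF X fm(2) gm(2)] normed_add[OF X fm(1) gm(1)] int lim1 lim2 normed_add[OF X mem(3,4)]
    by (auto intro!: exI[of _ "\<lambda>i t. s i t + r i t"])
qed

text \<open>The functions \<open>L (s i t)\<close> are simple and their integrals are the images of
  those of \<open>s i\<close>; boundedness of \<open>L\<close> carries both limits over. With the
  identity for \<open>L\<close> this moves an integral to a larger carrier or to an equivalent
  norm.\<close>

lemma has_bochner_integral_in_linear:
  assumes X: "normed_space X" and Y: "normed_space Y" and L: "bounded_linear_on X Y L"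
    and f: "has_bochner_integral_in X f a"
  shows "has_bochner_integral_in Y (\<lambda>t. L (f t)) (L a)"
proof -
  note fm = has_bochner_integral_inD[OF f]
  obtain s where s': "\<forall>i::nat. simple_integrable (s i) \<and> range (s i) \<subseteq> pts X"
    and slim: "(\<lambda>i. \<integral>\<^sup>+t. ennreal (nrm X (f t - s i t)) \<partial>lebesgue) \<longlonglongrightarrow> 0"
    "(\<lambda>i. nrm X (simple_integral_of (s i) - a)) \<longlonglongrightarrow> 0"
    by (rule has_bochner_integral_inE[OF f])
  then have s: "simple_integrable (s i)" "range (s i) \<subseteq> pts X" for i by blast+
  obtain M where M: "0 \<le> M" "\<And>x. x \<in> pts X \<Longrightarrow> nrm Y (L x) \<le> M * nrm X x"
    using bounded_linear_onE[OF L X] by blast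
  have LY: "L x \<in> pts Y" if "x \<in> pts X" for x using L that by (auto simp: bounded_linear_on_def)
  have mem: "f t \<in> pts X" "s i t \<in> pts X" for t i
    using strongly_measurable_in_mem[OF fm(2)] s(2) by blast+
  have lin: "linear_on (pts X) L" using L by (simp add: bounded_linear_on_def)
  note Ldiff = linear_on_diff[OF lin _ _ normed_subspace[OF X], symmetric]
  let ?I = "simple_integral_of"
  have Imem: "?I (s i) \<in> pts X" for i by (rule simple_bochner_integral_in[OF X s])
  note Ls = simple_bochner_integral_linear_on[OF X lin s]
  have m: "(\<lambda>t. ennreal (nrm X (f t - s i t))) \<in> borel_measurable lebesgue" for i
    using strongly_measurable_in_nrm[OF X strongly_measurable_in_diff_simple[OF X fm(2) s]] by auto
  have "(\<integral>\<^sup>+t. ennreal (nrm Y (L (f t) - L (s i t))) \<partial>lebesgue) \<le>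
      ennreal M * (\<integral>\<^sup>+t. ennreal (nrm X (f t - s i t)) \<partial>lebesgue)" for i
  proof -
    have "ennreal (nrm Y (L (f t) - L (s i t))) \<le> ennreal M * ennreal (nrm X (f t - s i t))" for t
      using M mem X by (auto simp: Ldiff ennreal_mult'[symmetric] normed_diff intro!: ennreal_leI)
    then show ?thesis using m by (subst nn_integral_cmult[symmetric]) (auto intro!: nn_integral_mono)
  qed
  moreover have "(\<lambda>i. ennreal M * (\<integral>\<^sup>+t. ennreal (nrm X (f t - s i t)) \<partial>lebesgue)) \<longlonglongrightarrow> 0"
    using ennreal_tendsto_cmult[OF _ slim(1), of "ennreal M"] by simp
  ultimately have lim1: "(\<lambda>i. \<integral>\<^sup>+t. ennreal (nrm Y (L (f t) - L (s i t))) \<partial>lebesgue) \<longlonglongrightarrow> 0"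
    by (rule ennreal_tendsto_0_le)
  have le: "nrm Y (?I (\<lambda>t. L (s i t)) - L a) \<le> M * nrm X (?I (s i) - a)" for i
    unfolding Ls(2) by (simp add: Ldiff Imem fm M normed_diff X)
  have nn: "0 \<le> nrm Y (?I (\<lambda>t. L (s i t)) - L a)" for i
    unfolding Ls(2) by (intro nrm_nonneg[OF Y] normed_diff[OF Y] LY Imem fm)
  have lim: "(\<lambda>i. M * nrm X (?I (s i) - a)) \<longlonglongrightarrow> 0"
    using tendsto_mult[OF tendsto_const slim(2)] by simp
  have lim2: "(\<lambda>i. nrm Y (?I (\<lambda>t. L (s i t)) - L a)) \<longlonglongrightarrow> 0"
    by (rule LIMSEQ_zero_le[OF nn le lim])
  show ?thesis
    unfolding has_bochner_integral_in_def
    using strongly_measurable_in_linear[OF X Y L fm(2)] LY[OF fm(1)] Ls(1) lim1 lim2 LY[OF mem(2)]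
    by (auto intro!: exI[of _ "\<lambda>i t. L (s i t)"])
qed

lemma has_bochner_integral_in_diff:
  assumes X: "normed_space X" and f: "has_bochner_integral_in X f a" and g: "has_bochner_integral_in X g b"
  shows "has_bochner_integral_in X (\<lambda>t. f t - g t) (a - b)"
  using has_bochner_integral_in_add[OF X f has_bochner_integral_in_linear[OF X X bounded_linear_scaleR[OF X, of "-1"] g]]
  by simp

lemma has_bochner_integral_in_nrm_le:
  assumes X: "normed_space X" and f: "has_bochner_integral_in X f a"
  shows "ennreal (nrm X a) \<le> (\<integral>\<^sup>+t. ennreal (nrm X (f t)) \<partial>lebesgue)"
proof -
  note fm = has_bochner_integral_inD[OF f]
  obtain s where s': "\<forall>i::nat. simple_integrable (s i) \<and> range (s i) \<subseteq> pts X"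
    and slim: "(\<lambda>i. \<integral>\<^sup>+t. ennreal (nrm X (f t - s i t)) \<partial>lebesgue) \<longlonglongrightarrow> 0"
    "(\<lambda>i. nrm X (simple_integral_of (s i) - a)) \<longlonglongrightarrow> 0"
    by (rule has_bochner_integral_inE[OF f])
  then have s: "simple_integrable (s i)" "range (s i) \<subseteq> pts X" for i by blast+
  have mem: "f t \<in> pts X" "s i t \<in> pts X" for t i
    using strongly_measurable_in_mem[OF fm(2)] s(2) by blast+
  let ?I = "simple_integral_of"
  have Imem: "?I (s i) \<in> pts X" for i by (rule simple_bochner_integral_in[OF X s])
  have m: "(\<lambda>t. ennreal (nrm X (f t - s i t))) \<in> borel_measurable lebesgue"
    "(\<lambda>t. ennreal (nrm X (f t))) \<in> borel_measurable lebesgue" for i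
    using strongly_measurable_in_nrm[OF X strongly_measurable_in_diff_simple[OF X fm(2) s]]
      strongly_measurable_in_nrm[OF X fm(2)] by auto
  let ?e = "\<lambda>i. (\<integral>\<^sup>+t. ennreal (nrm X (f t - s i t)) \<partial>lebesgue) + ennreal (nrm X (?I (s i) - a))"
  have "ennreal (nrm X a) \<le> (\<integral>\<^sup>+t. ennreal (nrm X (f t)) \<partial>lebesgue) + ?e i" for i
  proof -
    have "nrm X a \<le> nrm X (?I (s i)) + nrm X (?I (s i) - a)"
      using nrm_triangle_sub[OF X fm(1) Imem] nrm_minus_commute[OF X fm(1) Imem] by simp
    then have "ennreal (nrm X a) \<le> ennreal (nrm X (?I (s i))) + ennreal (nrm X (?I (s i) - a))"
      using X Imem fm by (simp add: ennreal_plus[symmetric] nrm_nonneg normed_diff ennreal_leI del: ennreal_plus)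
    also have "ennreal (nrm X (?I (s i))) \<le> (\<integral>\<^sup>+t. ennreal (nrm X (s i t)) \<partial>lebesgue)"
      by (rule simple_bochner_integral_nrm_le[OF X s])
    also have "\<dots> \<le> (\<integral>\<^sup>+t. ennreal (nrm X (f t)) + ennreal (nrm X (f t - s i t)) \<partial>lebesgue)"
    proof (rule nn_integral_mono)
      fix t
      have "nrm X (s i t) \<le> nrm X (f t) + nrm X (f t - s i t)"
        using nrm_triangle_sub[OF X mem(2,1)] nrm_minus_commute[OF X mem(2,1)] by simp
      then show "ennreal (nrm X (s i t)) \<le> ennreal (nrm X (f t)) + ennreal (nrm X (f t - s i t))"
        using X mem by (simp add: ennreal_plus[symmetric] nrm_nonneg normed_diff ennreal_leI del: ennreal_plus)
    qed
    also have "\<dots> = (\<integral>\<^sup>+t. ennreal (nrm X (f t)) \<partial>lebesgue) + (\<integral>\<^sup>+t. ennreal (nrm X (f t - s i t)) \<partial>lebesgue)"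
      using m by (intro nn_integral_add) auto
    finally show ?thesis by (simp add: add.assoc add_mono)
  qed
  moreover have "?e \<longlonglongrightarrow> 0"
    using tendsto_add[OF slim(1) tendsto_ennrealI[OF slim(2)]] by simp
  then have "(\<lambda>i. (\<integral>\<^sup>+t. ennreal (nrm X (f t)) \<partial>lebesgue) + ?e i) \<longlonglongrightarrow> (\<integral>\<^sup>+t. ennreal (nrm X (f t)) \<partial>lebesgue)"
    using tendsto_add[OF tendsto_const] by fastforce
  ultimately show ?thesis by (intro LIMSEQ_le_const) auto
qed

text \<open>\<open>a - b\<close> is an integral of the zero function, so the norm inequality makes
  it vanish.\<close>

lemma has_bochner_integral_in_unique:
  assumes X: "normed_space X" and f: "has_bochner_integral_in X f a" "has_bochner_integral_in X f b"
  shows "a = b"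
proof -
  have "ennreal (nrm X (a - b)) \<le> 0"
    using has_bochner_integral_in_nrm_le[OF X has_bochner_integral_in_diff[OF X f]] by (simp add: nrm_zero[OF X])
  moreover have "a - b \<in> pts X" using f by (auto intro: normed_diff[OF X] dest: has_bochner_integral_inD)
  ultimately show ?thesis using nrm_nonneg[OF X, of "a - b"] nrm_eq_0[OF X, of "a - b"] by simp
qed

text \<open>Bochner's criterion. Strong measurability provides approximation almost everywhere only.
  Truncating the simple functions by a multiple of the norm of \<open>f\<close> makes the
  approximation dominated, hence convergent in the mean, and the integrals of the truncated
  functions then form a Cauchy sequence.\<close>

lemma has_bochner_integral_in_exists:
  assumes B: "banach_space X" and f: "strongly_measurable_in X f"
    and fin: "(\<integral>\<^sup>+t. ennreal (nrm X (f t)) \<partial>lebesgue) < \<infinity>"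
  shows "\<exists>a. has_bochner_integral_in X f a"
proof -
  have X: "normed_space X" using B by (rule banach_space_normed)
  obtain s where s: "\<And>i::nat. simple_function lebesgue (s i)" "\<And>i. range (s i) \<subseteq> pts X"
    and slim: "AE t in lebesgue. (\<lambda>i. nrm X (s i t - f t)) \<longlonglongrightarrow> 0"
    using f unfolding strongly_measurable_in_def by blast
  have mem: "f t \<in> pts X" "s i t \<in> pts X" for t i
    using strongly_measurable_in_mem[OF f] s(2) by blast+
  define N where "N t = nrm X (f t)" for t
  have N: "0 \<le> N t" for t unfolding N_def by (rule nrm_nonneg[OF X mem(1)])
  have Nm [measurable]: "N \<in> borel_measurable lebesgue"
    unfolding N_def by (rule strongly_measurable_in_nrm[OF X f])
  \<comment> \<open>The factor 2 preserves the limit. Where \<open>f t\<close> is not 0, the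
    distance of \<open>s i t\<close> to \<open>f t\<close> is eventually below \<open>N t\<close>
    (almost everywhere), so the truncation is eventually inactive; where \<open>f t\<close> is 0, it
    forces \<open>r i t = 0\<close>.\<close>
  define r where "r i t = (if nrm X (s i t) \<le> 2 * N t then s i t else 0)" for i t
  have rX: "r i t \<in> pts X" for i t unfolding r_def using mem X by (auto simp: normed_zero)
  then have rr: "range (r i) \<subseteq> pts X" for i by blast
  have rN: "nrm X (r i t) \<le> 2 * N t" for i t unfolding r_def using N by (auto simp: nrm_zero[OF X])
  have rsf: "simple_function lebesgue (r i)" for i
  proof -
    have [measurable]: "(\<lambda>t. nrm X (s i t)) \<in> borel_measurable lebesgue"
      using simple_function_compose1[OF s(1), of "nrm X"] by (rule borel_measurable_simple_function)
    have "{t \<in> space lebesgue. nrm X (s i t) \<le> 2 * N t} \<in> sets lebesgue" by measurable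
    then show ?thesis unfolding r_def by (intro simple_function_If s) auto
  qed
  have fin2: "(\<integral>\<^sup>+t. ennreal (c * N t) \<partial>lebesgue) < \<infinity>" if "0 \<le> c" for c
  proof -
    have "(\<integral>\<^sup>+t. ennreal (c * N t) \<partial>lebesgue) = ennreal c * (\<integral>\<^sup>+t. ennreal (N t) \<partial>lebesgue)"
      using that N by (simp add: ennreal_mult nn_integral_cmult)
    then show ?thesis using fin by (simp add: N_def ennreal_mult_less_top)
  qed
  have rint: "simple_integrable (r i)" for i
  proof -
    have "simple_integrable (\<lambda>t. nrm X (r i t))"
    proof (rule simple_bochner_integrableI_bounded)
      show "simple_function lebesgue (\<lambda>t. nrm X (r i t))" using rsf by (rule simple_function_compose1)
      have "(\<integral>\<^sup>+t. ennreal (norm (nrm X (r i t))) \<partial>lebesgue) \<le> (\<integral>\<^sup>+t. ennreal (2 * N t) \<partial>lebesgue)"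
        using rN nrm_nonneg[OF X rX] by (intro nn_integral_mono ennreal_leI) auto
      then show "(\<integral>\<^sup>+t. ennreal (norm (nrm X (r i t))) \<partial>lebesgue) < \<infinity>" using fin2[of 2] by (simp add: order_le_less_trans)
    qed
    then show ?thesis using rsf nrm_eq_0[OF X rX] by (simp add: simple_bochner_integrable.simps)
  qed
  have m: "(\<lambda>t. ennreal (nrm X (f t - r i t))) \<in> borel_measurable lebesgue" for i
    using strongly_measurable_in_nrm[OF X strongly_measurable_in_diff_simple[OF X f rint rr]] by auto
  let ?e = "\<lambda>i. \<integral>\<^sup>+t. ennreal (nrm X (f t - r i t)) \<partial>lebesgue"
  have e: "?e \<longlonglongrightarrow> (\<integral>\<^sup>+t. 0 \<partial>(lebesgue :: real measure))"
  proof (rule nn_integral_dominated_convergence[where w="\<lambda>t. ennreal (3 * N t)"])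
    show "AE t in lebesgue. ennreal (nrm X (f t - r i t)) \<le> ennreal (3 * N t)" for i
    proof (rule AE_I2, rule ennreal_leI)
      fix t show "nrm X (f t - r i t) \<le> 3 * N t"
        using nrm_diff_le[OF X mem(1) rX, of t i t] rN[of i t] by (simp add: N_def)
    qed
    show "AE t in lebesgue. (\<lambda>i. ennreal (nrm X (f t - r i t))) \<longlonglongrightarrow> 0"
      using slim
    proof eventually_elim
      fix t assume lim: "(\<lambda>i. nrm X (s i t - f t)) \<longlonglongrightarrow> 0"
      have "(\<lambda>i. nrm X (f t - r i t)) \<longlonglongrightarrow> 0"
      proof (cases "f t = 0")
        case True
        then have "r i t = 0" for i
          using rN[of i t] nrm_eq_0[OF X rX, of i t] nrm_nonneg[OF X rX, of i t] by (simp add: N_def nrm_zero[OF X])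
        then show ?thesis using True by (simp add: nrm_zero[OF X])
      next
        case False
        then have "0 < N t" using nrm_eq_0[OF X mem(1), of t] N[of t] by (simp add: N_def less_le)
        then have "\<forall>\<^sub>F i in sequentially. nrm X (s i t - f t) < N t" using lim by (intro order_tendstoD)
        then have "\<forall>\<^sub>F i in sequentially. nrm X (s i t - f t) = nrm X (f t - r i t)"
        proof eventually_elim
          fix i assume "nrm X (s i t - f t) < N t"
          then have "nrm X (s i t) \<le> 2 * N t"
            using nrm_triangle_sub[OF X mem(2,1), of i t t] by (simp add: N_def)
          then show "nrm X (s i t - f t) = nrm X (f t - r i t)"
            using nrm_minus_commute[OF X mem(2,1)] by (simp add: r_def)
        qed
        then show ?thesis using lim by (rule Lim_transform_eventually[rotated])
      qed
      then show "(\<lambda>i. ennreal (nrm X (f t - r i t))) \<longlonglongrightarrow> 0" using tendsto_ennrealI by fastforce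
    qed
  qed (use m fin2 in auto)
  then have e0: "?e \<longlonglongrightarrow> 0" by simp
  let ?I = "\<lambda>i. simple_integral_of (r i)"
  have Imem: "?I i \<in> pts X" for i by (rule simple_bochner_integral_in[OF X rint rr])
  have Idiff: "ennreal (nrm X (?I i - ?I j)) \<le> ?e i + ?e j" for i j
  proof -
    have int: "simple_integrable (\<lambda>t. r i t - r j t)"
      using simple_bochner_integrable_compose2[where p="(-)", OF _ rint rint] by simp
    have "ennreal (nrm X (?I i - ?I j)) \<le> (\<integral>\<^sup>+t. ennreal (nrm X (r i t - r j t)) \<partial>lebesgue)"
      using simple_bochner_integral_nrm_le[OF X int] normed_diff[OF X rX rX] simple_bochner_integral_diff[OF rint rint]
      by auto
    also have "\<dots> \<le> (\<integral>\<^sup>+t. ennreal (nrm X (f t - r i t)) + ennreal (nrm X (f t - r j t)) \<partial>lebesgue)"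
    proof (rule nn_integral_mono)
      fix t
      have "nrm X (r i t - r j t) \<le> nrm X (f t - r i t) + nrm X (f t - r j t)"
        using nrm_diff_triangle[OF X rX mem(1) rX] nrm_minus_commute[OF X rX mem(1)] by metis
      then show "ennreal (nrm X (r i t - r j t)) \<le> ennreal (nrm X (f t - r i t)) + ennreal (nrm X (f t - r j t))"
        using X mem rX by (simp add: ennreal_plus[symmetric] nrm_nonneg normed_diff ennreal_leI del: ennreal_plus)
    qed
    also have "\<dots> = ?e i + ?e j" using m by (intro nn_integral_add) auto
    finally show ?thesis .
  qed
  have Cauchy: "\<exists>n. \<forall>i\<ge>n. \<forall>j\<ge>n. nrm X (?I i - ?I j) < d" if "0 < d" for d
  proof -
    have "\<forall>\<^sub>F i in sequentially. ?e i < ennreal (d/2)" using that by (intro order_tendstoD[OF e0]) auto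
    then obtain n where n: "\<And>i. i \<ge> n \<Longrightarrow> ?e i < ennreal (d/2)" by (auto simp: eventually_sequentially)
    have "nrm X (?I i - ?I j) < d" if "i \<ge> n" "j \<ge> n" for i j
    proof -
      have "ennreal (nrm X (?I i - ?I j)) < ennreal (d/2) + ennreal (d/2)"
        using Idiff n[OF that(1)] n[OF that(2)] by (meson add_strict_mono order_le_less_trans)
      then show ?thesis using \<open>0 < d\<close> by (simp add: ennreal_plus[symmetric] ennreal_less_iff nrm_nonneg[OF X] normed_diff[OF X] Imem del: ennreal_plus)
    qed
    then show ?thesis by blast
  qed
  obtain a where a: "a \<in> pts X" "(\<lambda>i. nrm X (?I i - a)) \<longlonglongrightarrow> 0"
    by (rule banach_spaceD[OF B Imem Cauchy])
  then show ?thesis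
    unfolding has_bochner_integral_in_def using f rint rr e0 a by blast
qed

section \<open>Continuity of translations in the mean\<close>

lemma integrable_translate:
  fixes f :: "real \<Rightarrow> real"
  assumes "integrable lborel f"
  shows "integrable lborel (\<lambda>x. f (x + h))"
  using lborel_integrable_real_affine[OF assms, of 1 h] by (simp add: add.commute)

lemma integral_translate:
  fixes f :: "real \<Rightarrow> real"
  shows "(\<integral>x. f (x + h) \<partial>lborel) = (\<integral>x. f x \<partial>lborel)"
  using lborel_integral_real_affine[of 1 f h] by (simp add: add.commute)

definition L1_shift :: "(real \<Rightarrow> real) \<Rightarrow> real \<Rightarrow> real" where
  "L1_shift f h = (\<integral>x. \<bar>f (x + h) - f x\<bar> \<partial>lborel)"

lemma L1_shift_nonneg: "0 \<le> L1_shift f h"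
  by (simp add: L1_shift_def)

lemma L1_shift_le:
  assumes f: "integrable lborel f"
  shows "L1_shift f h \<le> 2 * (\<integral>x. \<bar>f x\<bar> \<partial>lborel)"
proof -
  note i = integrable_abs[OF f] integrable_abs[OF integrable_translate[OF f]]
  have "L1_shift f h \<le> (\<integral>x. \<bar>f (x + h)\<bar> + \<bar>f x\<bar> \<partial>lborel)"
    unfolding L1_shift_def
    by (intro integral_mono integrable_abs Bochner_Integration.integrable_diff Bochner_Integration.integrable_add
        i f integrable_translate[OF f]) auto
  also have "\<dots> = (\<integral>x. \<bar>f (x + h)\<bar> \<partial>lborel) + (\<integral>x. \<bar>f x\<bar> \<partial>lborel)"
    by (intro Bochner_Integration.integral_add i)
  also have "(\<integral>x. \<bar>f (x + h)\<bar> \<partial>lborel) = (\<integral>x. \<bar>f x\<bar> \<partial>lborel)"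
    by (rule integral_translate[of "\<lambda>x. \<bar>f x\<bar>"])
  finally show ?thesis by simp
qed

lemma L1_shift_add:
  assumes f: "integrable lborel f" and g: "integrable lborel g"
  shows "L1_shift (\<lambda>x. f x + g x) h \<le> L1_shift f h + L1_shift g h"
proof -
  note i = integrable_abs[OF Bochner_Integration.integrable_diff[OF integrable_translate[OF f, of h] f]]
    integrable_abs[OF Bochner_Integration.integrable_diff[OF integrable_translate[OF g, of h] g]]
  have "L1_shift (\<lambda>x. f x + g x) h \<le> (\<integral>x. \<bar>f (x + h) - f x\<bar> + \<bar>g (x + h) - g x\<bar> \<partial>lborel)"
    unfolding L1_shift_def
    by (intro integral_mono integrable_abs Bochner_Integration.integrable_diff Bochner_Integration.integrable_add
        i f g integrable_translate[OF f] integrable_translate[OF g]) auto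
  also have "\<dots> = L1_shift f h + L1_shift g h"
    unfolding L1_shift_def by (intro Bochner_Integration.integral_add i)
  finally show ?thesis .
qed

text \<open>\<open>L1_shift\<close> is subadditive and at most twice the L1-norm, uniformly in the
  shift, so convergence survives approximation in the mean. The quarters of \<open>r\<close> account
  for this factor: \<open>r / 4 + 2 * (r / 4) < r\<close>.\<close>

lemma L1_shift_tendsto_closure:
  assumes f: "integrable lborel f"
    and approx: "\<And>e. 0 < e \<Longrightarrow> \<exists>g. integrable lborel g \<and> (\<lambda>n. L1_shift g (h n)) \<longlonglongrightarrow> 0 \<and> (\<integral>x. \<bar>f x - g x\<bar> \<partial>lborel) \<le> e"
  shows "(\<lambda>n. L1_shift f (h n)) \<longlonglongrightarrow> 0"
proof (rule LIMSEQ_I)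
  fix r :: real assume "0 < r"
  then have "0 < r / 4" by simp
  then obtain g where g: "integrable lborel g" and lim: "(\<lambda>n. L1_shift g (h n)) \<longlonglongrightarrow> 0" and le: "(\<integral>x. \<bar>f x - g x\<bar> \<partial>lborel) \<le> r / 4"
    using approx by blast
  have "\<forall>\<^sub>F n in sequentially. L1_shift g (h n) < r / 4"
    using lim \<open>0 < r / 4\<close> by (rule order_tendstoD)
  then obtain N where N: "\<And>n. n \<ge> N \<Longrightarrow> L1_shift g (h n) < r / 4" by (auto simp: eventually_sequentially)
  have "L1_shift f (h n) < r" if "n \<ge> N" for n
  proof -
    have fg: "integrable lborel (\<lambda>x. f x - g x)" using f g by simp
    have "L1_shift f (h n) \<le> L1_shift g (h n) + L1_shift (\<lambda>x. f x - g x) (h n)"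
      using L1_shift_add[OF g fg, of "h n"] by simp
    then show ?thesis using L1_shift_le[OF fg, of "h n"] le N[OF that] \<open>0 < r\<close> by linarith
  qed
  then show "\<exists>N. \<forall>n\<ge>N. norm (L1_shift f (h n) - 0) < r" by (auto simp: L1_shift_nonneg)
qed

text \<open>For open \<open>U\<close> the positive part of \<open>1\<^sub>U(x) - 1\<^sub>U(x + h)\<close> tends to \<open>0\<close> pointwise and is dominated
  by \<open>1\<^sub>U\<close>; the negative part has the same integral.\<close>

lemma L1_shift_indicator_open:
  assumes U: "open U" "emeasure lborel U < \<infinity>" and h: "h \<longlonglongrightarrow> 0"
  shows "(\<lambda>n. L1_shift (indicator U) (h n)) \<longlonglongrightarrow> 0"
proof -
  let ?u = "indicator U :: real \<Rightarrow> real"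
  let ?p = "\<lambda>n x. ?u x * (1 - ?u (x + h n))"
  have [measurable]: "U \<in> sets borel" using U by simp
  have u: "integrable lborel ?u" using U by (intro integrable_real_indicator) auto
  have lim: "(\<lambda>n. \<integral>x. ?p n x \<partial>lborel) \<longlonglongrightarrow> (\<integral>x. 0 \<partial>(lborel :: real measure))"
  proof (rule integral_dominated_convergence[where w="?u"])
    show "AE x in lborel. (\<lambda>n. ?p n x) \<longlonglongrightarrow> 0"
    proof (rule AE_I2)
      fix x
      show "(\<lambda>n. ?p n x) \<longlonglongrightarrow> 0"
      proof (cases "x \<in> U")
        case True
        have "(\<lambda>n. x + h n) \<longlonglongrightarrow> x" using tendsto_add[OF tendsto_const h, of x] by simp
        then have "\<forall>\<^sub>F n in sequentially. x + h n \<in> U" using U(1) True by (rule topological_tendstoD)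
        then have "\<forall>\<^sub>F n in sequentially. ?p n x = 0" by eventually_elim simp
        then show ?thesis by (rule tendsto_eventually)
      qed simp
    qed
  qed (use u in \<open>auto simp: indicator_def\<close>)
  have "L1_shift ?u (h n) = 2 * (\<integral>x. ?p n x \<partial>lborel)" for n
  proof -
    have m: "(\<lambda>x. ?u (x + h n)) \<in> borel_measurable borel" by measurable
    have i: "integrable lborel (?p n)"
      using u by (rule Bochner_Integration.integrable_bound) (auto simp: indicator_def)
    note i2 = integrable_translate[OF u, of "h n"]
    \<comment> \<open>A real number \<open>d\<close> satisfies
      \<open>\<bar>d\<bar> = d + 2 * p\<close> with \<open>p\<close> the positive part of
      \<open>- d\<close>; for the difference of the indicators this part is
      \<open>?p n x\<close>.\<close>
    have "L1_shift ?u (h n) = (\<integral>x. ?u (x + h n) - ?u x + 2 * ?p n x \<partial>lborel)"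
      unfolding L1_shift_def by (rule Bochner_Integration.integral_cong) (auto simp: indicator_def)
    also have "\<dots> = (\<integral>x. ?u (x + h n) \<partial>lborel) - (\<integral>x. ?u x \<partial>lborel) + 2 * (\<integral>x. ?p n x \<partial>lborel)"
      using i i2 u by (subst Bochner_Integration.integral_add) (auto simp: Bochner_Integration.integral_diff)
    finally show ?thesis using integral_translate[of ?u "h n"] by simp
  qed
  then show ?thesis using tendsto_mult[OF tendsto_const lim, of 2] by simp
qed

text \<open>A Borel set of finite measure is approximated from outside by open sets of finite
  measure; simple functions follow by linearity and integrable functions by approximation in the
  mean.\<close>

lemma L1_shift_tendsto_0:
  assumes f: "integrable lborel f" and h: "h \<longlonglongrightarrow> 0"
  shows "(\<lambda>n. L1_shift f (h n)) \<longlonglongrightarrow> 0"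
  using f
proof (induction rule: integrable_induct)
  case (base A c)
  have [measurable]: "A \<in> sets borel" using base by simp
  have iA: "integrable lborel (indicator A :: real \<Rightarrow> real)" using base by (intro integrable_real_indicator) auto
  have lim: "(\<lambda>n. L1_shift (indicator A) (h n)) \<longlonglongrightarrow> 0"
  proof (rule L1_shift_tendsto_closure[OF iA])
    fix e :: real assume "0 < e"
    have "A \<in> sets lebesgue" by simp
    then obtain U where U: "open U" "A \<subseteq> U" "U - A \<in> lmeasurable" "emeasure lebesgue (U - A) < ennreal e"
      by (rule sets_lebesgue_outer_open[OF _ \<open>0 < e\<close>])
    have [measurable]: "U \<in> sets borel" using U by simp
    have UA: "emeasure lborel (U - A) < ennreal e" using U by simp
    have "emeasure lborel U = emeasure lborel A + emeasure lborel (U - A)"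
      using U(2) by (subst plus_emeasure) (auto intro!: arg_cong[where f="emeasure lborel"])
    then have Ufin: "emeasure lborel U < \<infinity>" using base UA by (auto simp: less_top[symmetric])
    have iU: "integrable lborel (indicator U :: real \<Rightarrow> real)" using Ufin by (intro integrable_real_indicator) auto
    have "(\<integral>x. \<bar>indicator A x - indicator U x :: real\<bar> \<partial>lborel) = (\<integral>x. indicator (U - A) x \<partial>lborel)"
      using U(2) by (intro Bochner_Integration.integral_cong) (auto simp: indicator_def)
    also have "\<dots> = measure lborel (U - A)" by simp
    also have "\<dots> \<le> e" using UA \<open>0 < e\<close> by (simp add: measure_def enn2real_leI less_imp_le)
    finally show "\<exists>g. integrable lborel g \<and> (\<lambda>n. L1_shift g (h n)) \<longlonglongrightarrow> 0 \<and> (\<integral>x. \<bar>indicator A x - g x\<bar> \<partial>lborel) \<le> e"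
      using iU L1_shift_indicator_open[OF U(1) Ufin h] by blast
  qed
  have "L1_shift (\<lambda>x. indicator A x *\<^sub>R c) t = \<bar>c\<bar> * L1_shift (indicator A) t" for t
  proof -
    have "\<bar>indicator A (x + t) *\<^sub>R c - indicator A x *\<^sub>R c\<bar> = \<bar>c\<bar> * \<bar>indicator A (x + t) - indicator A x\<bar>" for x
      by (simp add: abs_mult[symmetric] algebra_simps)
    then show ?thesis by (simp add: L1_shift_def)
  qed
  then show ?case using tendsto_mult[OF tendsto_const lim, of "\<bar>c\<bar>"] by simp
next
  case (add f g)
  show ?case
    by (rule LIMSEQ_zero_le[OF L1_shift_nonneg L1_shift_add[OF add.hyps]])
      (use tendsto_add[OF add.IH] in simp)
next
  case (lim f s)
  show ?case
  proof (rule L1_shift_tendsto_closure[OF lim.hyps(4)])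
    fix e :: real assume "0 < e"
    have "(\<lambda>i. \<integral>x. \<bar>f x - s i x\<bar> \<partial>lborel) \<longlonglongrightarrow> (\<integral>x. 0 \<partial>(lborel :: real measure))"
    proof (rule integral_dominated_convergence[where w="\<lambda>x. 3 * norm (f x)"])
      show "AE x in lborel. (\<lambda>i. \<bar>f x - s i x\<bar>) \<longlonglongrightarrow> 0"
      proof (rule AE_I2)
        fix x :: real assume "x \<in> space lborel"
        then have "(\<lambda>i. s i x) \<longlonglongrightarrow> f x" by (rule lim.hyps(2))
        then show "(\<lambda>i. \<bar>f x - s i x\<bar>) \<longlonglongrightarrow> 0"
          using tendsto_rabs[OF tendsto_diff[OF tendsto_const, of "\<lambda>i. s i x" "f x" sequentially "f x"]] by simp
      qed
      show "AE x in lborel. norm \<bar>f x - s i x\<bar> \<le> 3 * norm (f x)" for i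
      proof (rule AE_I2)
        fix x :: real assume "x \<in> space lborel"
        then have "norm (s i x) \<le> 2 * norm (f x)" by (rule lim.hyps(3))
        then show "norm \<bar>f x - s i x\<bar> \<le> 3 * norm (f x)" by simp
      qed
    qed (use lim.hyps in auto)
    then have "\<forall>\<^sub>F i in sequentially. (\<integral>x. \<bar>f x - s i x\<bar> \<partial>lborel) < e" using \<open>0 < e\<close> by (intro order_tendstoD) auto
    then obtain i where "(\<integral>x. \<bar>f x - s i x\<bar> \<partial>lborel) < e" by (auto simp: eventually_sequentially)
    then show "\<exists>g. integrable lborel g \<and> (\<lambda>n. L1_shift g (h n)) \<longlonglongrightarrow> 0 \<and> (\<integral>x. \<bar>f x - g x\<bar> \<partial>lborel) \<le> e"
      using lim.hyps(1) lim.IH by (intro exI[of _ "s i"]) auto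
  qed
qed

section \<open>Banach function norms\<close>

text \<open>A function norm controls integrals only over sets of finite measure, so statements about
  almost all points are obtained on bounded intervals and pieced together.\<close>

lemma AE_lebesgue_intervals:
  fixes P :: "real \<Rightarrow> bool"
  assumes "\<And>n::nat. AE x in lebesgue. x \<in> {- real n..real n} \<longrightarrow> P x"
  shows "AE x in lebesgue. P x"
proof -
  have "AE x in lebesgue. \<forall>n::nat. x \<in> {- real n..real n} \<longrightarrow> P x"
    unfolding AE_all_countable using assms by blast
  then show ?thesis
  proof eventually_elim
    fix x assume *: "\<forall>n::nat. x \<in> {- real n..real n} \<longrightarrow> P x"
    obtain n :: nat where "\<bar>x\<bar> \<le> real n" using real_arch_simple by blast
    then show "P x" using *[rule_format, of n] by (auto simp: abs_le_iff)
  qed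
qed

locale function_norm =
  fixes \<rho> :: "(real \<Rightarrow> ennreal) \<Rightarrow> ennreal"
  assumes bfn: "banach_function_norm \<rho>"
begin

lemma rho_eq_0: "f \<in> borel_measurable lebesgue \<Longrightarrow> \<rho> f = 0 \<longleftrightarrow> (AE x in lebesgue. f x = 0)"
  using bfn unfolding banach_function_norm_def by blast

lemma rho_cmult: "f \<in> borel_measurable lebesgue \<Longrightarrow> 0 \<le> c \<Longrightarrow> \<rho> (\<lambda>x. ennreal c * f x) = ennreal c * \<rho> f"
  using bfn unfolding banach_function_norm_def by blast

lemma rho_add:
  "f \<in> borel_measurable lebesgue \<Longrightarrow> g \<in> borel_measurable lebesgue \<Longrightarrow> \<rho> (\<lambda>x. f x + g x) \<le> \<rho> f + \<rho> g"
  using bfn unfolding banach_function_norm_def by blast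

lemma rho_mono:
  "f \<in> borel_measurable lebesgue \<Longrightarrow> g \<in> borel_measurable lebesgue \<Longrightarrow> AE x in lebesgue. g x \<le> f x \<Longrightarrow> \<rho> g \<le> \<rho> f"
  using bfn unfolding banach_function_norm_def by blast

lemma rho_incseq:
  assumes "f \<in> borel_measurable lebesgue" "\<And>n::nat. s n \<in> borel_measurable lebesgue"
    "AE x in lebesgue. incseq (\<lambda>n. s n x) \<and> (\<lambda>n. s n x) \<longlonglongrightarrow> f x"
  shows "incseq (\<lambda>n. \<rho> (s n))" "(\<lambda>n. \<rho> (s n)) \<longlonglongrightarrow> \<rho> f"
  using bfn assms unfolding banach_function_norm_def by blast+

lemma rho_indicator: "D \<in> sets lebesgue \<Longrightarrow> emeasure lebesgue D < \<infinity> \<Longrightarrow> \<rho> (indicator D) < \<infinity>"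
  using bfn unfolding banach_function_norm_def by blast

lemma rho_local:
  assumes "D \<in> sets lebesgue" "emeasure lebesgue D < \<infinity>"
  obtains c where "\<forall>f\<in>borel_measurable lebesgue. (\<integral>\<^sup>+x\<in>D. f x \<partial>lebesgue) \<le> ennreal c * \<rho> f"
proof -
  have "\<forall>D\<in>sets lebesgue. emeasure lebesgue D < \<infinity> \<longrightarrow> \<rho> (indicator D) < \<infinity> \<and>
    (\<exists>c::real. \<forall>f\<in>borel_measurable lebesgue. (\<integral>\<^sup>+x\<in>D. f x \<partial>lebesgue) \<le> ennreal c * \<rho> f)"
    using bfn unfolding banach_function_norm_def by (elim conjE)
  then have "\<exists>c::real. \<forall>f\<in>borel_measurable lebesgue. (\<integral>\<^sup>+x\<in>D. f x \<partial>lebesgue) \<le> ennreal c * \<rho> f"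
    by (drule_tac bspec[OF _ assms(1)]) (drule mp[OF _ assms(2)], elim conjE)
  then show ?thesis using that by (elim exE)
qed

lemma rho_cong:
  assumes "f \<in> borel_measurable lebesgue" "g \<in> borel_measurable lebesgue" "AE x in lebesgue. f x = g x"
  shows "\<rho> f = \<rho> g"
proof (rule antisym)
  have "AE x in lebesgue. f x \<le> g x" "AE x in lebesgue. g x \<le> f x" using assms(3) by auto
  then show "\<rho> f \<le> \<rho> g" "\<rho> g \<le> \<rho> f" using assms rho_mono by blast+
qed

lemma rho_0: "\<rho> (\<lambda>_. 0) = 0"
  by (simp add: rho_eq_0)

lemma rho_sum:
  assumes "\<And>i. i \<in> I \<Longrightarrow> u i \<in> borel_measurable lebesgue"
  shows "\<rho> (\<lambda>x. \<Sum>i\<in>I. u i x) \<le> (\<Sum>i\<in>I. \<rho> (u i))"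
  using assms
proof (induction I rule: infinite_finite_induct)
  case (insert i I)
  then have "\<rho> (\<lambda>x. u i x + (\<Sum>i\<in>I. u i x)) \<le> \<rho> (u i) + \<rho> (\<lambda>x. \<Sum>i\<in>I. u i x)"
    by (intro rho_add borel_measurable_sum) auto
  also have "\<dots> \<le> \<rho> (u i) + (\<Sum>i\<in>I. \<rho> (u i))" using insert by (intro add_left_mono) auto
  finally show ?case using insert by simp
qed (simp_all add: rho_0)

text \<open>Fatou's lemma for \<open>\<rho>\<close>: the infima over the tails increase to the lower
  limit, so the axiom on increasing sequences applies to them.\<close>

lemma rho_liminf:
  assumes u: "\<And>n::nat. u n \<in> borel_measurable lebesgue"
  shows "\<rho> (\<lambda>x. liminf (\<lambda>n. u n x)) \<le> liminf (\<lambda>n. \<rho> (u n))"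
proof -
  let ?s = "\<lambda>n x. INF k\<in>{n..}. u k x"
  have s: "?s n \<in> borel_measurable lebesgue" for n using u by measurable
  have "incseq (\<lambda>n. ?s n x)" for x by (intro incseq_SucI INF_superset_mono) auto
  moreover from this have "(\<lambda>n. ?s n x) \<longlonglongrightarrow> liminf (\<lambda>n. u n x)" for x
    unfolding liminf_SUP_INF by (rule LIMSEQ_SUP)
  moreover have "(\<lambda>x. liminf (\<lambda>n. u n x)) \<in> borel_measurable lebesgue" using u by measurable
  ultimately have lim: "(\<lambda>n. \<rho> (?s n)) \<longlonglongrightarrow> \<rho> (\<lambda>x. liminf (\<lambda>n. u n x))"
    using s by (intro rho_incseq(2)) auto
  have "\<rho> (?s n) \<le> (INF k\<in>{n..}. \<rho> (u k))" for n
    using s u by (intro INF_greatest rho_mono) (auto intro!: INF_lower)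
  moreover have "(INF k\<in>{n..}. \<rho> (u k)) \<le> liminf (\<lambda>n. \<rho> (u n))" for n
    unfolding liminf_SUP_INF by (rule SUP_upper) simp
  ultimately show ?thesis by (intro LIMSEQ_le_const2[OF lim]) (meson order_trans)
qed

text \<open>The axiom on increasing sequences, applied to the partial sums, extends the triangle
  inequality to countable sums. Completeness of the function space rests on it.\<close>

lemma rho_suminf:
  assumes u: "\<And>n::nat. u n \<in> borel_measurable lebesgue"
  shows "\<rho> (\<lambda>x. \<Sum>n. u n x) \<le> (\<Sum>n. \<rho> (u n))"
proof -
  have "(\<lambda>n. \<rho> (\<lambda>x. \<Sum>i<n. u i x)) \<longlonglongrightarrow> \<rho> (\<lambda>x. \<Sum>n. u n x)"
    using u by (intro rho_incseq(2)) (auto intro!: incseq_SucI summable_LIMSEQ)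
  moreover have "\<rho> (\<lambda>x. \<Sum>i<n. u i x) \<le> (\<Sum>n. \<rho> (u n))" for n
    using rho_sum[of "{..<n}" u] u by (meson order_trans sum_le_suminf summableI finite_lessThan zero_le)
  ultimately show ?thesis by (intro LIMSEQ_le_const2) auto
qed

lemma rho_finite_AE:
  assumes f: "f \<in> borel_measurable lebesgue" and fin: "\<rho> f < \<infinity>"
  shows "AE x in lebesgue. f x < \<infinity>"
proof -
  have "AE x in lebesgue. x \<in> {- real n..real n} \<longrightarrow> f x < \<infinity>" for n :: nat
  proof -
    obtain c where "(\<integral>\<^sup>+x\<in>{- real n..real n}. f x \<partial>lebesgue) \<le> ennreal c * \<rho> f"
      using rho_local[of "{- real n..real n}"] f by auto
    also have "\<dots> < \<infinity>" using fin by (simp add: ennreal_mult_less_top)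
    finally have "AE x in lebesgue. f x * indicator {- real n..real n} x \<noteq> \<infinity>"
    proof (intro nn_integral_PInf_AE)
      show "(\<lambda>x. f x * indicator {- real n..real n} x) \<in> borel_measurable lebesgue"
        by (intro borel_measurable_times_ennreal f borel_measurable_indicator) simp
    qed auto
    then show ?thesis by eventually_elim (auto simp: less_top)
  qed
  then show ?thesis by (rule AE_lebesgue_intervals)
qed

end

section \<open>Rearrangement invariant norms and Minkowski's inequality for convolutions\<close>

locale ri_norm =
  fixes \<rho> :: "(real \<Rightarrow> ennreal) \<Rightarrow> ennreal"
  assumes ri: "rearrangement_invariant_norm \<rho>"
begin

sublocale function_norm
  using ri by unfold_locales (simp add: rearrangement_invariant_norm_def)

text \<open>For \<open>\<bar>c\<bar> = 1\<close> the substitution preserves Lebesgue measure, so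
  \<open>f\<close> and its transform are equimeasurable. The value \<open>c = 1\<close> gives
  translations; \<open>c = -1\<close> gives the reflection \<open>s \<mapsto> t - s\<close> inside a
  convolution.\<close>

lemma rho_affine:
  fixes f :: "real \<Rightarrow> ennreal"
  assumes f: "f \<in> borel_measurable lebesgue" and c: "\<bar>c\<bar> = 1"
  shows "(\<lambda>x. f (t + c * x)) \<in> borel_measurable lebesgue" "\<rho> (\<lambda>x. f (t + c * x)) = \<rho> f"
proof -
  have c0: "c \<noteq> 0" using c by auto
  have T [measurable]: "(\<lambda>x. t + c * x) \<in> lebesgue \<rightarrow>\<^sub>M lebesgue"
    using lebesgue_affine_measurable[where c= "\<lambda>x::real. c"] c0 by simp
  show m: "(\<lambda>x. f (t + c * x)) \<in> borel_measurable lebesgue"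
    using measurable_compose[OF T f] .
  have lb: "lebesgue = distr lebesgue lebesgue (\<lambda>x. t + c * x)"
    using lebesgue_real_affine[OF c0, of t] c by (simp add: density_1)
  have "emeasure lebesgue {x. ennreal y < f (t + c * x)} = emeasure lebesgue {x. ennreal y < f x}" for y
  proof -
    have S: "{x. ennreal y < f x} \<in> sets lebesgue"
      using measurable_sets[OF f, of "{ennreal y<..}"] by (simp add: vimage_def)
    have "emeasure lebesgue {x. ennreal y < f x} = emeasure (distr lebesgue lebesgue (\<lambda>x. t + c * x)) {x. ennreal y < f x}"
      using lb by simp
    also have "\<dots> = emeasure lebesgue {x. ennreal y < f (t + c * x)}"
      using emeasure_distr[OF T S] by (simp add: vimage_def)
    finally show ?thesis ..
  qed
  then have "equimeasurable (\<lambda>x. f (t + c * x)) f" by (simp add: equimeasurable_def)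
  then show "\<rho> (\<lambda>x. f (t + c * x)) = \<rho> f" using ri m f unfolding rearrangement_invariant_norm_def by blast
qed

lemma rho_translate:
  fixes f :: "real \<Rightarrow> ennreal"
  assumes "f \<in> borel_measurable lebesgue"
  shows "(\<lambda>x. f (x - c)) \<in> borel_measurable lebesgue" "\<rho> (\<lambda>x. f (x - c)) = \<rho> f"
  using rho_affine[OF assms, of 1 "- c"] by (simp_all add: add.commute[of "- c"])

text \<open>The Riemann sums \<open>R\<close> below are combinations of translates of \<open>f\<close> whose coefficients add up to
  the integral of \<open>g\<close>. They converge to the convolution in the mean, hence almost everywhere along
  a subsequence, and the Fatou property passes the bound to the limit.\<close>

lemma rho_convolution_compact_support:
  fixes f g :: "real \<Rightarrow> real" and m :: nat
  assumes f: "integrable lborel f" "\<And>x. 0 \<le> f x" "\<And>x. f x \<le> B"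
    and g: "integrable lborel g" "\<And>x. 0 \<le> g x" "\<And>x. real m < \<bar>x\<bar> \<Longrightarrow> g x = 0"
  shows "\<rho> (\<lambda>x. \<integral>\<^sup>+s. ennreal (f (x - s) * g s) \<partial>lborel) \<le> \<rho> (\<lambda>x. ennreal (f x)) * (\<integral>\<^sup>+s. ennreal (g s) \<partial>lborel)"
proof -
  have [measurable]: "f \<in> borel_measurable borel" "g \<in> borel_measurable borel"
    using borel_measurable_integrable[OF f(1)] borel_measurable_integrable[OF g(1)] by simp_all
  have B: "0 \<le> B" using f(2,3) order_trans by blast
  have gfin: "(\<integral>\<^sup>+s. ennreal (g s) \<partial>lborel) < \<infinity>"
    using g by (simp add: nn_integral_eq_integral)
  \<comment> \<open>The left end point of the cell of length \<open>1 / Suc n\<close> that contains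
    \<open>s\<close>. Replacing \<open>s\<close> by it in the argument of \<open>f\<close> turns the
    convolution into a Riemann sum.\<close>
  define q where "q n s = of_int \<lfloor>real (Suc n) * s\<rfloor> / real (Suc n)" for n and s :: real
  have qm [measurable]: "q n \<in> borel_measurable borel" for n unfolding q_def by measurable
  have q_lim: "(\<lambda>n. s - q n s) \<longlonglongrightarrow> 0" for s
  proof (rule LIMSEQ_zero_le[OF _ _ LIMSEQ_inverse_real_of_nat])
    fix n
    have "of_int \<lfloor>real (Suc n) * s\<rfloor> \<le> real (Suc n) * s" "real (Suc n) * s \<le> of_int \<lfloor>real (Suc n) * s\<rfloor> + 1"
      by linarith+
    then have "q n s \<le> s" "s \<le> (of_int \<lfloor>real (Suc n) * s\<rfloor> + 1) / real (Suc n)"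
      unfolding q_def
      by (simp_all add: pos_divide_le_eq pos_le_divide_eq mult.commute[of s] del: of_nat_Suc)
    then show "0 \<le> s - q n s" "s - q n s \<le> inverse (real (Suc n))"
      by (simp_all add: q_def add_divide_distrib inverse_eq_divide del: of_nat_Suc)
  qed
  define conv where "conv x = (\<integral>\<^sup>+s. ennreal (f (x - s) * g s) \<partial>lborel)" for x
  define R where "R n x = (\<integral>\<^sup>+s. ennreal (f (x - q n s) * g s) \<partial>lborel)" for n x
  \<comment> \<open>A pointwise bound for the error of the Riemann sum. Its integral over
    \<open>x\<close> is an average, with weight \<open>g\<close>, of mean translation errors of
    \<open>f\<close>.\<close>
  define D where "D n x = (\<integral>\<^sup>+s. ennreal (\<bar>f (x - q n s) - f (x - s)\<bar> * g s) \<partial>lborel)" for n x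
  have convm [measurable]: "conv \<in> borel_measurable borel" unfolding conv_def by measurable
  have Rm [measurable]: "R n \<in> borel_measurable borel" for n unfolding R_def by measurable
  have Dm [measurable]: "D n \<in> borel_measurable borel" for n unfolding D_def by measurable
  have bound_fin: "(\<integral>\<^sup>+s. ennreal (u s * g s) \<partial>lborel) < \<infinity>" if "\<And>s. u s \<le> B" for u :: "real \<Rightarrow> real"
  proof -
    have "(\<integral>\<^sup>+s. ennreal (u s * g s) \<partial>lborel) \<le> (\<integral>\<^sup>+s. ennreal B * ennreal (g s) \<partial>lborel)"
      using that g(2) B by (intro nn_integral_mono) (auto simp: ennreal_mult[symmetric] intro!: ennreal_leI mult_right_mono)
    also have "\<dots> = ennreal B * (\<integral>\<^sup>+s. ennreal (g s) \<partial>lborel)" by (rule nn_integral_cmult) simp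
    also have "\<dots> < \<infinity>" using gfin by (simp add: ennreal_mult_less_top)
    finally show ?thesis .
  qed
  have conv_fin: "conv x < \<infinity>" for x unfolding conv_def by (rule bound_fin[OF f(3)])
  have D_fin: "D n x < \<infinity>" for n x
    unfolding D_def
  proof (rule bound_fin)
    fix s show "\<bar>f (x - q n s) - f (x - s)\<bar> \<le> B"
      using f(2,3)[of "x - q n s"] f(2,3)[of "x - s"] by (simp add: abs_le_iff)
  qed
  have conv_le: "conv x \<le> R n x + D n x" for n x
  proof -
    have "conv x \<le> (\<integral>\<^sup>+s. ennreal (f (x - q n s) * g s) + ennreal (\<bar>f (x - q n s) - f (x - s)\<bar> * g s) \<partial>lborel)"
      unfolding conv_def
    proof (rule nn_integral_mono)
      fix s
      have "f (x - s) * g s \<le> (f (x - q n s) + \<bar>f (x - q n s) - f (x - s)\<bar>) * g s"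
        using g(2) by (intro mult_right_mono) auto
      then show "ennreal (f (x - s) * g s) \<le> ennreal (f (x - q n s) * g s) + ennreal (\<bar>f (x - q n s) - f (x - s)\<bar> * g s)"
        using f(2) g(2) by (simp add: ennreal_plus[symmetric] ennreal_leI algebra_simps del: ennreal_plus)
    qed
    also have "\<dots> = R n x + D n x" unfolding R_def D_def by (rule nn_integral_add) measurable
    finally show ?thesis .
  qed
  have D_int: "(\<integral>\<^sup>+x. D n x \<partial>lborel) = (\<integral>\<^sup>+s. ennreal (L1_shift f (s - q n s) * g s) \<partial>lborel)" for n
  proof -
    have "(\<integral>\<^sup>+x. D n x \<partial>lborel) = (\<integral>\<^sup>+s. (\<integral>\<^sup>+x. ennreal (\<bar>f (x - q n s) - f (x - s)\<bar> * g s) \<partial>lborel) \<partial>lborel)"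
      unfolding D_def by (rule lborel_pair.Fubini') measurable
    also have "\<dots> = (\<integral>\<^sup>+s. ennreal (L1_shift f (s - q n s) * g s) \<partial>lborel)"
    proof (rule nn_integral_cong)
      fix s
      have "(\<integral>\<^sup>+x. ennreal (\<bar>f (x - q n s) - f (x - s)\<bar> * g s) \<partial>lborel)
          = (\<integral>\<^sup>+x. ennreal (\<bar>f (x - q n s) - f (x - s)\<bar>) * ennreal (g s) \<partial>lborel)"
        using g(2) by (simp add: ennreal_mult)
      also have "\<dots> = (\<integral>\<^sup>+x. ennreal \<bar>f (x - q n s) - f (x - s)\<bar> \<partial>lborel) * ennreal (g s)"
        by (rule nn_integral_multc) measurable
      \<comment> \<open>Moving \<open>x\<close> by \<open>s\<close> leaves a translation by
        \<open>s - q n s\<close>, which lies between 0 and the mesh width.\<close>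
      also have "(\<integral>\<^sup>+x. ennreal \<bar>f (x - q n s) - f (x - s)\<bar> \<partial>lborel) = (\<integral>\<^sup>+x. ennreal \<bar>f (x + (s - q n s)) - f x\<bar> \<partial>lborel)"
        by (subst nn_integral_real_affine[where c=1 and t=s]) (auto simp: algebra_simps)
      also have "\<dots> = ennreal (L1_shift f (s - q n s))"
        unfolding L1_shift_def
        by (intro nn_integral_eq_integral integrable_abs Bochner_Integration.integrable_diff integrable_translate f) auto
      finally show "(\<integral>\<^sup>+x. ennreal (\<bar>f (x - q n s) - f (x - s)\<bar> * g s) \<partial>lborel) = ennreal (L1_shift f (s - q n s) * g s)"
        using L1_shift_nonneg g(2) by (simp add: ennreal_mult)
    qed
    finally show ?thesis .
  qed
  have Lm [measurable]: "L1_shift f \<in> borel_measurable borel" unfolding L1_shift_def by measurable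
  have D_lim: "(\<lambda>n. \<integral>\<^sup>+x. D n x \<partial>lborel) \<longlonglongrightarrow> 0"
  proof -
    let ?C = "2 * (\<integral>x. \<bar>f x\<bar> \<partial>lborel)"
    have "(\<lambda>n. \<integral>\<^sup>+s. ennreal (L1_shift f (s - q n s) * g s) \<partial>lborel) \<longlonglongrightarrow> (\<integral>\<^sup>+s. 0 \<partial>(lborel :: real measure))"
    proof (rule nn_integral_dominated_convergence[where w="\<lambda>s. ennreal (?C * g s)"])
      show "AE s in lborel. ennreal (L1_shift f (s - q n s) * g s) \<le> ennreal (?C * g s)" for n
        using L1_shift_le[OF f(1)] g(2) by (intro AE_I2 ennreal_leI mult_right_mono)
      have "(\<integral>\<^sup>+s. ennreal (?C * g s) \<partial>lborel) = ennreal ?C * (\<integral>\<^sup>+s. ennreal (g s) \<partial>lborel)"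
        using g(2) by (simp add: ennreal_mult nn_integral_cmult)
      also have "\<dots> < \<infinity>" using gfin by (simp add: ennreal_mult_less_top)
      finally show "(\<integral>\<^sup>+s. ennreal (?C * g s) \<partial>lborel) < \<infinity>" .
      show "AE s in lborel. (\<lambda>n. ennreal (L1_shift f (s - q n s) * g s)) \<longlonglongrightarrow> 0"
      proof (rule AE_I2)
        fix s
        have "(\<lambda>n. L1_shift f (s - q n s) * g s) \<longlonglongrightarrow> 0 * g s"
          by (intro tendsto_mult tendsto_const L1_shift_tendsto_0[OF f(1) q_lim])
        then show "(\<lambda>n. ennreal (L1_shift f (s - q n s) * g s)) \<longlonglongrightarrow> 0"
          using tendsto_ennrealI by fastforce
      qed
    qed measurable
    then show ?thesis by (simp add: D_int)
  qed
  have D_int_fin: "(\<integral>\<^sup>+x. D n x \<partial>lborel) < \<infinity>" for n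
  proof -
    let ?C = "2 * (\<integral>x. \<bar>f x\<bar> \<partial>lborel)"
    have "(\<integral>\<^sup>+x. D n x \<partial>lborel) \<le> (\<integral>\<^sup>+s. ennreal ?C * ennreal (g s) \<partial>lborel)"
      unfolding D_int using L1_shift_le[OF f(1)] L1_shift_nonneg g(2)
      by (intro nn_integral_mono) (auto simp: ennreal_mult[symmetric] intro!: ennreal_leI mult_right_mono)
    also have "\<dots> = ennreal ?C * (\<integral>\<^sup>+s. ennreal (g s) \<partial>lborel)" by (rule nn_integral_cmult) simp
    also have "\<dots> < \<infinity>" using gfin by (simp add: ennreal_mult_less_top)
    finally show ?thesis .
  qed
  \<comment> \<open>A real-valued copy of \<open>D n\<close>, for which convergence in the mean
    yields a subsequence that converges almost everywhere; \<open>D n\<close> is finite everywhere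
    because \<open>f\<close> is bounded.\<close>
  define u where "u n x = enn2real (D n x)" for n x
  have uD: "ennreal (u n x) = D n x" for n x using D_fin[of n x] by (simp add: u_def)
  have u0: "0 \<le> u n x" for n x by (simp add: u_def)
  have um [measurable]: "u n \<in> borel_measurable borel" for n unfolding u_def by measurable
  have u_int: "integrable lborel (u n)" for n
    using D_int_fin[of n] u0 by (intro integrableI_bounded) (auto simp: uD)
  have "(\<lambda>n. \<integral>x. norm (u n x) \<partial>lborel) \<longlonglongrightarrow> 0"
  proof -
    have "(\<integral>x. norm (u n x) \<partial>lborel) = enn2real (\<integral>\<^sup>+x. D n x \<partial>lborel)" for n
      using u0 by (subst integral_eq_nn_integral) (auto simp: uD)
    then show ?thesis using tendsto_enn2real[of _ 0] D_lim by simp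
  qed
  then obtain r where r: "strict_mono r" "AE x in lborel. (\<lambda>n. u (r n) x) \<longlonglongrightarrow> 0"
    using tendsto_L1_AE_subseq[of lborel u] u_int by blast
  have "AE x in lborel. conv x \<le> liminf (\<lambda>n. R (r n) x)"
    using r(2)
  proof eventually_elim
    fix x assume "(\<lambda>n. u (r n) x) \<longlonglongrightarrow> 0"
    then have "(\<lambda>n. D (r n) x) \<longlonglongrightarrow> 0" using tendsto_ennrealI[of "\<lambda>n. u (r n) x" 0 sequentially] by (simp add: uD)
    \<comment> \<open>Subtraction in \<open>ennreal\<close> is continuous here because
      \<open>conv x\<close> is finite.\<close>
    then have "(\<lambda>n. conv x - D (r n) x) \<longlonglongrightarrow> conv x - 0"
      using conv_fin[of x] by (intro tendsto_diff_ennreal_general tendsto_const) auto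
    then have "conv x = liminf (\<lambda>n. conv x - D (r n) x)"
      by (simp add: lim_imp_Liminf)
    also have "\<dots> \<le> liminf (\<lambda>n. R (r n) x)"
    proof (intro Liminf_mono always_eventually allI)
      fix n show "conv x - D (r n) x \<le> R (r n) x"
        using conv_le[of x "r n"] D_fin[of "r n" x] conv_fin[of x]
        by (subst ennreal_minus_le_iff) (auto simp: add.commute)
    qed
    finally show "conv x \<le> liminf (\<lambda>n. R (r n) x)" .
  qed
  then have AE: "AE x in lebesgue. conv x \<le> liminf (\<lambda>n. R (r n) x)" by (rule AE_completion)
  have R_bound: "\<rho> (R n) \<le> \<rho> (\<lambda>x. ennreal (f x)) * (\<integral>\<^sup>+s. ennreal (g s) \<partial>lborel)" for n
  proof -
    \<comment> \<open>Since \<open>g\<close> vanishes for \<open>\<bar>s\<bar> > m\<close>, only the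
      cells with index between \<open>- m * Suc n\<close> and \<open>m * Suc n\<close> carry mass.
      So the Riemann sum is finite, with the mass \<open>c j\<close> of \<open>g\<close> on cell
      \<open>j\<close> as coefficient.\<close>
    define J where "J = {- int (m * Suc n)..int (m * Suc n)}"
    define c where "c j = (\<integral>\<^sup>+s. ennreal (g s) * indicator {s. \<lfloor>real (Suc n) * s\<rfloor> = j} s \<partial>lborel)" for j
    have floor_J: "\<lfloor>real (Suc n) * s\<rfloor> \<in> J" if "g s \<noteq> 0" for s
    proof -
      have s: "\<bar>s\<bar> \<le> real m" using g(3)[of s] that by force
      have "real (Suc n) * s \<le> real (Suc n) * real m" "real (Suc n) * (- real m) \<le> real (Suc n) * s"
        using s by (intro mult_left_mono; simp add: abs_le_iff)+
      then have "real (Suc n) * s \<le> of_int (int (m * Suc n))" "of_int (- int (m * Suc n)) \<le> real (Suc n) * s"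
        by (simp_all add: algebra_simps)
      then show ?thesis unfolding J_def by (simp add: le_floor_iff floor_le_iff del: of_nat_Suc of_nat_mult)
    qed
    \<comment> \<open>When \<open>g s\<close> is not 0, exactly one index in \<open>J\<close>
      matches. The values \<open>F\<close> are arbitrary so that the identity yields both the total
      mass of the \<open>c j\<close> and the formula for \<open>R n\<close>.\<close>
    have delta: "ennreal (F \<lfloor>real (Suc n) * s\<rfloor>) * ennreal (g s) =
        (\<Sum>j\<in>J. ennreal (F j) * (ennreal (g s) * indicator {s. \<lfloor>real (Suc n) * s\<rfloor> = j} s))" for F s
    proof (cases "g s = 0")
      case False
      have "(\<Sum>j\<in>J. ennreal (F j) * (ennreal (g s) * indicator {s. \<lfloor>real (Suc n) * s\<rfloor> = j} s)) =
         (\<Sum>j\<in>J. if j = \<lfloor>real (Suc n) * s\<rfloor> then ennreal (F j) * ennreal (g s) else 0)"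
        by (intro sum.cong) (auto simp: indicator_def)
      also have "\<dots> = ennreal (F \<lfloor>real (Suc n) * s\<rfloor>) * ennreal (g s)"
        using floor_J[OF False] by (simp add: J_def del: of_nat_Suc)
      finally show ?thesis ..
    qed simp
    have cm [measurable]: "(\<lambda>s. ennreal (g s) * indicator {s. \<lfloor>real (Suc n) * s\<rfloor> = j} s) \<in> borel_measurable borel" for j
      by measurable
    have c_sum: "(\<Sum>j\<in>J. c j) = (\<integral>\<^sup>+s. ennreal (g s) \<partial>lborel)"
      unfolding c_def using delta[of "\<lambda>_. 1"] by (subst nn_integral_sum[symmetric]) auto
    have c_fin: "c j < \<infinity>" for j
    proof -
      have "c j \<le> (\<integral>\<^sup>+s. ennreal (g s) \<partial>lborel)"
        unfolding c_def by (intro nn_integral_mono) (auto simp: indicator_def)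
      then show ?thesis using gfin by (rule order_le_less_trans)
    qed
    have R_eq: "R n x = (\<Sum>j\<in>J. ennreal (enn2real (c j)) * ennreal (f (x - of_int j / real (Suc n))))" for x
    proof -
      have "R n x = (\<integral>\<^sup>+s. (\<Sum>j\<in>J. ennreal (f (x - of_int j / real (Suc n))) * (ennreal (g s) * indicator {s. \<lfloor>real (Suc n) * s\<rfloor> = j} s)) \<partial>lborel)"
        unfolding R_def q_def using delta[of "\<lambda>j. f (x - of_int j / real (Suc n))"] f(2) g(2)
        by (intro nn_integral_cong) (simp add: ennreal_mult del: of_nat_Suc)
      also have "\<dots> = (\<Sum>j\<in>J. ennreal (f (x - of_int j / real (Suc n))) * c j)"
        unfolding c_def by (subst nn_integral_sum) (auto simp: nn_integral_cmult cm)
      finally show ?thesis using c_fin by (simp add: mult.commute)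
    qed
    have fm: "(\<lambda>x. ennreal (f x)) \<in> borel_measurable lebesgue"
      by (intro measurable_completion) simp
    note ft = rho_translate[OF fm]
    have "\<rho> (R n) \<le> (\<Sum>j\<in>J. \<rho> (\<lambda>x. ennreal (enn2real (c j)) * ennreal (f (x - of_int j / real (Suc n)))))"
      unfolding R_eq[abs_def] by (intro rho_sum borel_measurable_times_ennreal borel_measurable_const ft(1))
    also have "\<dots> = (\<Sum>j\<in>J. c j * \<rho> (\<lambda>x. ennreal (f x)))"
      using c_fin by (intro sum.cong refl) (subst rho_cmult, auto simp: ft)
    also have "\<dots> = \<rho> (\<lambda>x. ennreal (f x)) * (\<integral>\<^sup>+s. ennreal (g s) \<partial>lborel)"
      by (simp add: sum_distrib_right[symmetric] c_sum mult.commute)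
    finally show ?thesis .
  qed
  have Rl: "R n \<in> borel_measurable lebesgue" for n by (intro measurable_completion) simp
  have "\<rho> conv \<le> \<rho> (\<lambda>x. liminf (\<lambda>n. R (r n) x))"
    by (intro rho_mono AE) (auto intro!: measurable_completion)
  also have "\<dots> \<le> liminf (\<lambda>n. \<rho> (R (r n)))" by (rule rho_liminf[OF Rl])
  also have "\<dots> \<le> liminf (\<lambda>n. \<rho> (\<lambda>x. ennreal (f x)) * (\<integral>\<^sup>+s. ennreal (g s) \<partial>lborel))"
    by (intro Liminf_mono always_eventually allI R_bound)
  also have "\<dots> = \<rho> (\<lambda>x. ennreal (f x)) * (\<integral>\<^sup>+s. ennreal (g s) \<partial>lborel)" by (rule Liminf_const) simp
  finally show ?thesis unfolding conv_def .
qed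

text \<open>Cutting both functions off in height and support makes them integrable, bounded and
  compactly supported. At each point the cut-offs are eventually exact, so Fatou's lemma, for the
  inner integral and then for \<open>\<rho>\<close>, removes them without loss.\<close>

lemma rho_convolution:
  fixes f g :: "real \<Rightarrow> real"
  assumes f: "f \<in> borel_measurable borel" "\<And>x. 0 \<le> f x"
    and g: "g \<in> borel_measurable borel" "\<And>x. 0 \<le> g x"
  shows "\<rho> (\<lambda>x. \<integral>\<^sup>+s. ennreal (f (x - s) * g s) \<partial>lborel) \<le> \<rho> (\<lambda>x. ennreal (f x)) * (\<integral>\<^sup>+s. ennreal (g s) \<partial>lborel)"
proof -
  note [measurable] = f(1) g(1)
  define t where "t n h x = (if \<bar>x\<bar> \<le> real n then min (h x) (real n) else 0)" for n and h :: "real \<Rightarrow> real" and x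
  have tm [measurable]: "t n h \<in> borel_measurable borel" if [measurable]: "h \<in> borel_measurable borel" for n h
    unfolding t_def by measurable
  have t: "0 \<le> t n h x" "t n h x \<le> real n" "t n h x \<le> h x" "\<bar>x\<bar> > real n \<Longrightarrow> t n h x = 0" if "\<And>x. 0 \<le> h x" for n h x
    using that[of x] by (auto simp: t_def)
  have t_int: "integrable lborel (t n h)" if "h \<in> borel_measurable borel" "\<And>x. 0 \<le> h x" for n h
  proof (rule Bochner_Integration.integrable_bound[where f="\<lambda>x. real n * indicator {- real n..real n} x"])
    show "AE x in lborel. norm (t n h x) \<le> norm (real n * indicator {- real n..real n} x)"
      using t[of h, OF that(2)] by (intro AE_I2) (auto simp: indicator_def t_def)
  qed (use that in auto)
  have t_ev: "\<forall>\<^sub>F n in sequentially. t n h x = h x" for h x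
  proof -
    obtain N :: nat where N: "max \<bar>x\<bar> (h x) \<le> real N" using real_arch_simple by blast
    have "t n h x = h x" if "n \<ge> N" for n
      using N that by (auto simp: t_def min_def)
    then show ?thesis by (auto simp: eventually_sequentially)
  qed
  define conv where "conv n x = (\<integral>\<^sup>+s. ennreal (t n f (x - s) * t n g s) \<partial>lborel)" for n x
  have cm: "conv n \<in> borel_measurable lebesgue" for n unfolding conv_def by (intro measurable_completion) measurable
  have "(\<integral>\<^sup>+s. ennreal (f (x - s) * g s) \<partial>lborel) \<le> liminf (\<lambda>n. conv n x)" for x
  proof -
    have "(\<integral>\<^sup>+s. ennreal (f (x - s) * g s) \<partial>lborel) = (\<integral>\<^sup>+s. liminf (\<lambda>n. ennreal (t n f (x - s) * t n g s)) \<partial>lborel)"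
    proof (rule nn_integral_cong)
      fix s
      have "\<forall>\<^sub>F n in sequentially. ennreal (t n f (x - s) * t n g s) = ennreal (f (x - s) * g s)"
        using t_ev[of f "x - s"] t_ev[of g s] by eventually_elim simp
      then have "(\<lambda>n. ennreal (t n f (x - s) * t n g s)) \<longlonglongrightarrow> ennreal (f (x - s) * g s)"
        by (rule tendsto_eventually)
      then show "ennreal (f (x - s) * g s) = liminf (\<lambda>n. ennreal (t n f (x - s) * t n g s))"
        by (simp add: lim_imp_Liminf)
    qed
    also have "\<dots> \<le> liminf (\<lambda>n. conv n x)"
      unfolding conv_def by (rule nn_integral_liminf) measurable
    finally show ?thesis .
  qed
  then have "\<rho> (\<lambda>x. \<integral>\<^sup>+s. ennreal (f (x - s) * g s) \<partial>lborel) \<le> \<rho> (\<lambda>x. liminf (\<lambda>n. conv n x))"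
    using cm by (intro rho_mono) (auto intro!: measurable_completion)
  also have "\<dots> \<le> liminf (\<lambda>n. \<rho> (conv n))" by (rule rho_liminf[OF cm])
  also have "\<dots> \<le> liminf (\<lambda>n::nat. \<rho> (\<lambda>x. ennreal (f x)) * (\<integral>\<^sup>+s. ennreal (g s) \<partial>lborel))"
  proof (intro Liminf_mono always_eventually allI)
    fix n
    have "\<rho> (conv n) \<le> \<rho> (\<lambda>x. ennreal (t n f x)) * (\<integral>\<^sup>+s. ennreal (t n g s) \<partial>lborel)"
      unfolding conv_def
      by (rule rho_convolution_compact_support[where B="real n" and m=n]) (use f g t t_int in auto)
    also have "\<dots> \<le> \<rho> (\<lambda>x. ennreal (f x)) * (\<integral>\<^sup>+s. ennreal (g s) \<partial>lborel)"
      using t(3)[of f, OF f(2)] t(3)[of g, OF g(2)]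
      by (intro mult_mono rho_mono nn_integral_mono) (auto intro!: measurable_completion ennreal_leI)
    finally show "\<rho> (conv n) \<le> \<rho> (\<lambda>x. ennreal (f x)) * (\<integral>\<^sup>+s. ennreal (g s) \<partial>lborel)" .
  qed
  also have "\<dots> = \<rho> (\<lambda>x. ennreal (f x)) * (\<integral>\<^sup>+s. ennreal (g s) \<partial>lborel)" by (rule Liminf_const) simp
  finally show ?thesis .
qed

end

section \<open>Banach function spaces\<close>

lemma aefun_measurable: "rep_aefun f \<in> borel_measurable lebesgue"
  using Quotient3_rep_reflp[OF Quotient3_aefun, of f] by (simp add: ae_rel_def)

lemma aefun_abs_rep: "abs_aefun (rep_aefun f) = f"
  by (rule Quotient3_abs_rep[OF Quotient3_aefun])

lemma aefun_rep_abs: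
  assumes "h \<in> borel_measurable lebesgue"
  shows "AE x in lebesgue. rep_aefun (abs_aefun h) x = h x"
proof -
  have "ae_rel h h" using assms by (simp add: ae_rel_def)
  then have "ae_rel (rep_aefun (abs_aefun h)) h" by (rule rep_abs_rsp_left[OF Quotient3_aefun])
  then show ?thesis by (simp add: ae_rel_def)
qed

lemma aefun_abs_eq_iff:
  assumes "h \<in> borel_measurable lebesgue" "k \<in> borel_measurable lebesgue"
  shows "abs_aefun h = abs_aefun k \<longleftrightarrow> (AE x in lebesgue. h x = k x)"
proof -
  have "ae_rel h h" "ae_rel k k" using assms by (simp_all add: ae_rel_def)
  then have "abs_aefun h = abs_aefun k \<longleftrightarrow> ae_rel h k"
    using Quotient3_rel[OF Quotient3_aefun, of h k] by simp
  then show ?thesis using assms by (simp add: ae_rel_def)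
qed

lemma aefun_abs_zero: "abs_aefun (\<lambda>_. 0) = 0"
  by (simp add: zero_aefun_def)

lemma aefun_abs_add:
  assumes "h \<in> borel_measurable lebesgue" "k \<in> borel_measurable lebesgue"
  shows "abs_aefun (\<lambda>x. h x + k x) = abs_aefun h + abs_aefun k"
  using plus_aefun.abs_eq[of h k] assms by (simp add: ae_rel_def)

lemma aefun_abs_diff:
  assumes "h \<in> borel_measurable lebesgue" "k \<in> borel_measurable lebesgue"
  shows "abs_aefun (\<lambda>x. h x - k x) = abs_aefun h - abs_aefun k"
  using minus_aefun.abs_eq[of h k] assms by (simp add: ae_rel_def)

lemma aefun_abs_scaleR:
  assumes "h \<in> borel_measurable lebesgue"
  shows "abs_aefun (\<lambda>x. c * h x) = c *\<^sub>R abs_aefun h"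
  using scaleR_aefun.abs_eq[of h c] assms by (simp add: ae_rel_def)

lemma aefun_abs_sum:
  assumes "\<And>i. i \<in> I \<Longrightarrow> h i \<in> borel_measurable lebesgue"
  shows "abs_aefun (\<lambda>x. \<Sum>i\<in>I. h i x) = (\<Sum>i\<in>I. abs_aefun (h i))"
  using assms
proof (induction I rule: infinite_finite_induct)
  case (insert i I)
  then show ?case
    using aefun_abs_add[of "h i" "\<lambda>x. \<Sum>i\<in>I. h i x"] by (simp add: borel_measurable_sum)
qed (simp_all add: aefun_abs_zero)

lemma aefun_rep_add: "AE x in lebesgue. rep_aefun (f + g) x = rep_aefun f x + rep_aefun g x"
  using aefun_rep_abs[OF borel_measurable_add[OF aefun_measurable aefun_measurable, of f g]]
    aefun_abs_add[OF aefun_measurable aefun_measurable, of f g]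
  by (simp add: aefun_abs_rep)

lemma aefun_rep_scaleR: "AE x in lebesgue. rep_aefun (c *\<^sub>R f) x = c * rep_aefun f x"
proof -
  have m: "(\<lambda>x. c * rep_aefun f x) \<in> borel_measurable lebesgue"
    by (intro borel_measurable_times borel_measurable_const aefun_measurable)
  show ?thesis
    using aefun_rep_abs[OF m] aefun_abs_scaleR[OF aefun_measurable, of c f] by (simp add: aefun_abs_rep)
qed

section \<open>The Banach space of a function norm\<close>

context function_norm
begin

abbreviation N where "N h \<equiv> \<rho> (\<lambda>x. ennreal \<bar>h x\<bar>)"

lemma N_cong:
  assumes "h \<in> borel_measurable lebesgue" "k \<in> borel_measurable lebesgue" "AE x in lebesgue. h x = k x"
  shows "N h = N k"
proof -
  have "AE x in lebesgue. ennreal \<bar>h x\<bar> = ennreal \<bar>k x\<bar>" using assms(3) by eventually_elim simp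
  then show ?thesis using assms(1,2) by (intro rho_cong) auto
qed

lemma pts_function_space: "f \<in> pts (function_space \<rho>) \<longleftrightarrow> N (rep_aefun f) < \<infinity>"
  by (simp add: function_space_def)

lemma nrm_function_space: "nrm (function_space \<rho>) f = enn2real (N (rep_aefun f))"
  by (simp add: function_space_def)

lemma ennreal_nrm: "f \<in> pts (function_space \<rho>) \<Longrightarrow> ennreal (nrm (function_space \<rho>) f) = N (rep_aefun f)"
  by (simp add: pts_function_space nrm_function_space)

lemma abs_mem_function_space:
  "h \<in> borel_measurable lebesgue \<Longrightarrow> abs_aefun h \<in> pts (function_space \<rho>) \<longleftrightarrow> N h < \<infinity>"
  using N_cong[OF aefun_measurable _ aefun_rep_abs, of h] by (simp add: pts_function_space)

lemma nrm_abs_function_space: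
  "h \<in> borel_measurable lebesgue \<Longrightarrow> nrm (function_space \<rho>) (abs_aefun h) = enn2real (N h)"
  using N_cong[OF aefun_measurable _ aefun_rep_abs, of h] by (simp add: nrm_function_space)

lemma N_add:
  assumes "h \<in> borel_measurable lebesgue" "k \<in> borel_measurable lebesgue"
  shows "N (\<lambda>x. h x + k x) \<le> N h + N k"
proof -
  have "N (\<lambda>x. h x + k x) \<le> \<rho> (\<lambda>x. ennreal \<bar>h x\<bar> + ennreal \<bar>k x\<bar>)"
    using assms by (intro rho_mono AE_I2) (auto simp: ennreal_plus[symmetric] simp del: ennreal_plus intro!: ennreal_leI)
  also have "\<dots> \<le> N h + N k" using assms by (intro rho_add) auto
  finally show ?thesis .
qed

lemma N_scale:
  assumes "h \<in> borel_measurable lebesgue"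
  shows "N (\<lambda>x. c * h x) = ennreal \<bar>c\<bar> * N h"
  using rho_cmult[of "\<lambda>x. ennreal \<bar>h x\<bar>" "\<bar>c\<bar>"] assms by (simp add: abs_mult ennreal_mult)

lemma N_rep_add: "N (rep_aefun (f + g)) \<le> N (rep_aefun f) + N (rep_aefun g)"
proof -
  have "N (rep_aefun (f + g)) = N (\<lambda>x. rep_aefun f x + rep_aefun g x)"
    by (intro N_cong aefun_measurable borel_measurable_add aefun_rep_add)
  then show ?thesis using N_add[OF aefun_measurable aefun_measurable] by simp
qed

lemma N_rep_scaleR: "N (rep_aefun (c *\<^sub>R f)) = ennreal \<bar>c\<bar> * N (rep_aefun f)"
proof -
  have "N (rep_aefun (c *\<^sub>R f)) = N (\<lambda>x. c * rep_aefun f x)"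
    by (intro N_cong aefun_measurable borel_measurable_times borel_measurable_const aefun_rep_scaleR)
  then show ?thesis using N_scale[OF aefun_measurable] by simp
qed

lemma N_rep_eq_0: "N (rep_aefun f) = 0 \<longleftrightarrow> f = 0"
proof -
  have "f = 0 \<longleftrightarrow> abs_aefun (rep_aefun f) = abs_aefun (\<lambda>_. 0)"
    by (simp add: aefun_abs_rep aefun_abs_zero)
  also have "\<dots> \<longleftrightarrow> (AE x in lebesgue. rep_aefun f x = 0)"
    by (rule aefun_abs_eq_iff[OF aefun_measurable]) simp
  also have "\<dots> \<longleftrightarrow> (AE x in lebesgue. ennreal \<bar>rep_aefun f x\<bar> = 0)" by simp
  also have "\<dots> \<longleftrightarrow> N (rep_aefun f) = 0"
    using aefun_measurable[of f] by (intro rho_eq_0[symmetric]) auto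
  finally show ?thesis by simp
qed

lemma normed_function_space: "normed_space (function_space \<rho>)"
  unfolding normed_space_def
proof (intro conjI ballI allI)
  show "subspace (pts (function_space \<rho>))"
  proof (rule subspaceI)
    show "0 \<in> pts (function_space \<rho>)" using N_rep_eq_0[of 0] by (simp add: pts_function_space)
    show "f + g \<in> pts (function_space \<rho>)" if "f \<in> pts (function_space \<rho>)" "g \<in> pts (function_space \<rho>)" for f g
      using that N_rep_add[of f g] by (auto simp: pts_function_space intro: order_le_less_trans)
    show "c *\<^sub>R f \<in> pts (function_space \<rho>)" if "f \<in> pts (function_space \<rho>)" for c f
      using that by (simp add: pts_function_space N_rep_scaleR ennreal_mult_less_top)
  qed
  fix f assume f: "f \<in> pts (function_space \<rho>)"
  show "0 \<le> nrm (function_space \<rho>) f" by (simp add: nrm_function_space)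
  show "nrm (function_space \<rho>) f = 0 \<longleftrightarrow> f = 0"
    using f N_rep_eq_0[of f] by (auto simp: nrm_function_space pts_function_space enn2real_eq_0_iff)
  show "nrm (function_space \<rho>) (c *\<^sub>R f) = \<bar>c\<bar> * nrm (function_space \<rho>) f" for c
    by (simp add: nrm_function_space N_rep_scaleR enn2real_mult)
  show "nrm (function_space \<rho>) (f + g) \<le> nrm (function_space \<rho>) f + nrm (function_space \<rho>) g"
    if g: "g \<in> pts (function_space \<rho>)" for g
  proof -
    have "enn2real (N (rep_aefun (f + g))) \<le> enn2real (N (rep_aefun f) + N (rep_aefun g))"
      using f g by (intro enn2real_mono N_rep_add) (auto simp: pts_function_space)
    also have "\<dots> = enn2real (N (rep_aefun f)) + enn2real (N (rep_aefun g))"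
      using f g by (intro enn2real_plus) (auto simp: pts_function_space)
    finally show ?thesis by (simp add: nrm_function_space)
  qed
qed

text \<open>The argument of Riesz and Fischer: the countable triangle inequality bounds the series
  of absolute values in norm, so this series is finite almost everywhere and a pointwise sum
  \<open>a\<close> exists; the same bound for the tails gives convergence in norm.\<close>

lemma banach_function_space: "banach_space (function_space \<rho>)"
proof (rule banach_spaceI_series[OF normed_function_space])
  fix x :: "nat \<Rightarrow> aefun"
  assume x: "\<And>k. x k \<in> pts (function_space \<rho>)" "\<And>k. nrm (function_space \<rho>) (x k) \<le> (1/2)^k"
  define h where "h k = rep_aefun (x k)" for k
  have hm [measurable]: "h k \<in> borel_measurable lebesgue" for k unfolding h_def by (rule aefun_measurable)
  have hN: "N (h k) \<le> ennreal ((1/2)^k)" for k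
    using ennreal_leI[OF x(2)[of k]] ennreal_nrm[OF x(1)[of k]] by (simp add: h_def)
  \<comment> \<open>Used with \<open>n = 0\<close> for convergence almost everywhere and with
    general \<open>n\<close> for the rate.\<close>
  have tail: "\<rho> (\<lambda>t. \<Sum>k. ennreal \<bar>h (k + n) t\<bar>) \<le> ennreal (2 * (1/2)^n)" for n
  proof -
    have "\<rho> (\<lambda>t. \<Sum>k. ennreal \<bar>h (k + n) t\<bar>) \<le> (\<Sum>k. N (h (k + n)))" by (rule rho_suminf) measurable
    also have "\<dots> \<le> (\<Sum>k. ennreal ((1/2)^n * (1/2)^k))"
      using hN[of "_ + n"] by (intro suminf_le summableI) (simp add: power_add mult.commute)
    also have "\<dots> = ennreal (\<Sum>k. (1/2)^n * (1/2)^k)"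
      by (intro suminf_ennreal2 summable_mult summable_geometric) auto
    also have "(\<Sum>k. (1/2)^n * (1/2::real)^k) = 2 * (1/2)^n"
      by (subst suminf_mult) (auto simp: suminf_geometric)
    finally show ?thesis .
  qed
  have "\<rho> (\<lambda>t. \<Sum>k. ennreal \<bar>h k t\<bar>) < \<infinity>" using tail[of 0] by (simp add: order_le_less_trans)
  then have "AE t in lebesgue. (\<Sum>k. ennreal \<bar>h k t\<bar>) < \<infinity>" by (intro rho_finite_AE) measurable
  then have summable: "AE t in lebesgue. summable (\<lambda>k. \<bar>h k t\<bar>)"
    by eventually_elim (intro summable_suminf_not_top, auto)
  define a where "a t = (\<Sum>k. h k t)" for t
  have am [measurable]: "a \<in> borel_measurable lebesgue" unfolding a_def by measurable
  have diff: "N (\<lambda>t. (\<Sum>k<n. h k t) - a t) \<le> ennreal (2 * (1/2)^n)" for n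
  proof -
    have "AE t in lebesgue. ennreal \<bar>(\<Sum>k<n. h k t) - a t\<bar> \<le> (\<Sum>k. ennreal \<bar>h (k + n) t\<bar>)"
      using summable
    proof eventually_elim
      fix t assume s: "summable (\<lambda>k. \<bar>h k t\<bar>)"
      then have s': "summable (\<lambda>k. \<bar>h (k + n) t\<bar>)" by (rule summable_ignore_initial_segment)
      have "a t = (\<Sum>k. h (k + n) t) + (\<Sum>k<n. h k t)"
        unfolding a_def using summable_rabs_cancel[OF s] by (rule suminf_split_initial_segment)
      then have "\<bar>(\<Sum>k<n. h k t) - a t\<bar> \<le> (\<Sum>k. \<bar>h (k + n) t\<bar>)"
        using summable_rabs[OF s'] by simp
      then have "ennreal \<bar>(\<Sum>k<n. h k t) - a t\<bar> \<le> ennreal (\<Sum>k. \<bar>h (k + n) t\<bar>)" by (rule ennreal_leI)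
      also have "\<dots> = (\<Sum>k. ennreal \<bar>h (k + n) t\<bar>)" using s' by (intro suminf_ennreal2[symmetric]) auto
      finally show "ennreal \<bar>(\<Sum>k<n. h k t) - a t\<bar> \<le> (\<Sum>k. ennreal \<bar>h (k + n) t\<bar>)" .
    qed
    then have "N (\<lambda>t. (\<Sum>k<n. h k t) - a t) \<le> \<rho> (\<lambda>t. \<Sum>k. ennreal \<bar>h (k + n) t\<bar>)"
      by (intro rho_mono) measurable
    then show ?thesis using tail order_trans by blast
  qed
  \<comment> \<open>For \<open>n = 0\<close> the partial sum is empty, so \<open>diff\<close> bounds
    \<open>a\<close> itself.\<close>
  have aN: "N a < \<infinity>" using diff[of 0] by (simp add: order_le_less_trans)
  have "nrm (function_space \<rho>) ((\<Sum>k<n. x k) - abs_aefun a) \<le> 2 * (1/2)^n" for n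
  proof -
    have "(\<Sum>k<n. x k) = abs_aefun (\<lambda>t. \<Sum>k<n. h k t)"
      by (subst aefun_abs_sum) (auto simp: h_def aefun_abs_rep aefun_measurable)
    then have "(\<Sum>k<n. x k) - abs_aefun a = abs_aefun (\<lambda>t. (\<Sum>k<n. h k t) - a t)"
      by (subst aefun_abs_diff) auto
    then have "nrm (function_space \<rho>) ((\<Sum>k<n. x k) - abs_aefun a) = enn2real (N (\<lambda>t. (\<Sum>k<n. h k t) - a t))"
      by (simp add: nrm_abs_function_space)
    also have "\<dots> \<le> 2 * (1/2)^n" using diff by (intro enn2real_leI) auto
    finally show ?thesis .
  qed
  moreover have "0 \<le> nrm (function_space \<rho>) ((\<Sum>k<n. x k) - abs_aefun a)" for n
    by (simp add: nrm_function_space)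
  moreover have "(\<lambda>n. 2 * (1/2::real)^n) \<longlonglongrightarrow> 0"
    using tendsto_mult[OF tendsto_const LIMSEQ_power_zero[of "1/2::real"], of 2] by simp
  ultimately have "(\<lambda>n. nrm (function_space \<rho>) ((\<Sum>k<n. x k) - abs_aefun a)) \<longlonglongrightarrow> 0"
    using LIMSEQ_zero_le by presburger
  moreover have "abs_aefun a \<in> pts (function_space \<rho>)" using aN am by (simp add: abs_mem_function_space)
  ultimately show "\<exists>a\<in>pts (function_space \<rho>). (\<lambda>n. nrm (function_space \<rho>) ((\<Sum>k<n. x k) - a)) \<longlonglongrightarrow> 0" by blast
qed

end

text \<open>Both norms control integrals over bounded intervals; this separates points of the sum.\<close>

lemma compatible_couple_function_spaces:
  assumes "function_norm \<rho>0" "function_norm \<rho>1"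
  shows "compatible_couple (function_space \<rho>0) (function_space \<rho>1)"
proof -
  interpret r0: function_norm \<rho>0 by fact
  interpret r1: function_norm \<rho>1 by fact
  let ?X0 = "function_space \<rho>0" and ?X1 = "function_space \<rho>1"
  interpret separated_couple ?X0 ?X1
  proof
    fix x assume x: "x \<in> pts (sum_space ?X0 ?X1)" "K_functional ?X0 ?X1 1 x = 0"
    have "AE t in lebesgue. t \<in> {- real n..real n} \<longrightarrow> rep_aefun x t = 0" for n :: nat
    proof -
      let ?D = "{- real n..real n}"
      obtain c0 where c0: "\<forall>f\<in>borel_measurable lebesgue. (\<integral>\<^sup>+t\<in>?D. f t \<partial>lebesgue) \<le> ennreal c0 * \<rho>0 f"
        by (rule r0.rho_local[of ?D]) auto
      obtain c1 where c1: "\<forall>f\<in>borel_measurable lebesgue. (\<integral>\<^sup>+t\<in>?D. f t \<partial>lebesgue) \<le> ennreal c1 * \<rho>1 f"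
        by (rule r1.rho_local[of ?D]) auto
      \<comment> \<open>The local constants need not be positive (for \<open>n = 0\<close> the
        interval is a null set); the 1 makes \<open>e / c\<close> a positive bound.\<close>
      define c where "c = max 1 (max c0 c1)"
      have c: "0 < c" "c0 \<le> c" "c1 \<le> c" by (auto simp: c_def)
      have le: "(\<integral>\<^sup>+t\<in>?D. ennreal \<bar>rep_aefun x t\<bar> \<partial>lebesgue) \<le> ennreal e" if "0 < e" for e
      proof -
        have "K_functional ?X0 ?X1 1 x < e / c" using x(2) that c by simp
        then obtain y z where yz: "y \<in> pts ?X0" "z \<in> pts ?X1" "x = y + z" "nrm ?X0 y + 1 * nrm ?X1 z < e / c"
          by (rule K_functional_approx[OF x(1)])
        have m: "(\<lambda>t. ennreal \<bar>rep_aefun v t\<bar> * indicator ?D t) \<in> borel_measurable lebesgue" for v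
          using aefun_measurable[of v] by (intro borel_measurable_times_ennreal borel_measurable_indicator) auto
        have m': "(\<lambda>t. ennreal \<bar>rep_aefun v t\<bar>) \<in> borel_measurable lebesgue" for v
          using aefun_measurable[of v] by auto
        have "(\<integral>\<^sup>+t\<in>?D. ennreal \<bar>rep_aefun x t\<bar> \<partial>lebesgue)
          \<le> (\<integral>\<^sup>+t. ennreal \<bar>rep_aefun y t\<bar> * indicator ?D t + ennreal \<bar>rep_aefun z t\<bar> * indicator ?D t \<partial>lebesgue)"
        proof (rule nn_integral_mono_AE)
          show "AE t in lebesgue. ennreal \<bar>rep_aefun x t\<bar> * indicator ?D t \<le>
              ennreal \<bar>rep_aefun y t\<bar> * indicator ?D t + ennreal \<bar>rep_aefun z t\<bar> * indicator ?D t"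
            using aefun_rep_add[of y z] unfolding yz(3)
            by eventually_elim (auto simp: indicator_def ennreal_plus[symmetric] simp del: ennreal_plus intro!: ennreal_leI)
        qed
        also have "\<dots> = (\<integral>\<^sup>+t\<in>?D. ennreal \<bar>rep_aefun y t\<bar> \<partial>lebesgue) + (\<integral>\<^sup>+t\<in>?D. ennreal \<bar>rep_aefun z t\<bar> \<partial>lebesgue)"
          by (intro nn_integral_add m)
        also have "\<dots> \<le> ennreal c0 * r0.N (rep_aefun y) + ennreal c1 * r1.N (rep_aefun z)"
          using c0 c1 m' by (intro add_mono) auto
        also have "\<dots> \<le> ennreal c * r0.N (rep_aefun y) + ennreal c * r1.N (rep_aefun z)"
          using c by (intro add_mono mult_right_mono ennreal_leI) auto
        also have "\<dots> = ennreal c * ennreal (nrm ?X0 y) + ennreal c * ennreal (nrm ?X1 z)"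
          using yz by (simp add: r0.ennreal_nrm r1.ennreal_nrm)
        also have "\<dots> = ennreal (c * (nrm ?X0 y + nrm ?X1 z))"
          using c by (simp add: ennreal_mult ring_distribs ennreal_plus r0.nrm_function_space r1.nrm_function_space)
        also have "\<dots> \<le> ennreal e"
          using yz(4) c by (intro ennreal_leI) (simp add: pos_less_divide_eq mult.commute)
        finally show ?thesis .
      qed
      have "(\<integral>\<^sup>+t\<in>?D. ennreal \<bar>rep_aefun x t\<bar> \<partial>lebesgue) = 0"
      proof (rule antisym[OF ennreal_le_epsilon])
        show "(\<integral>\<^sup>+t\<in>?D. ennreal \<bar>rep_aefun x t\<bar> \<partial>lebesgue) \<le> 0 + ennreal e" if "0 < e" for e
          using le[OF that] by simp
      qed simp
      moreover have "(\<lambda>t. ennreal \<bar>rep_aefun x t\<bar> * indicator ?D t) \<in> borel_measurable lebesgue"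
        using aefun_measurable[of x] by (intro borel_measurable_times_ennreal borel_measurable_indicator) auto
      ultimately have "AE t in lebesgue. ennreal \<bar>rep_aefun x t\<bar> * indicator ?D t = 0"
        by (simp add: nn_integral_0_iff_AE)
      then show ?thesis by eventually_elim (auto simp: indicator_def)
    qed
    then have "AE t in lebesgue. rep_aefun x t = 0" by (rule AE_lebesgue_intervals)
    then have "abs_aefun (rep_aefun x) = abs_aefun (\<lambda>_. 0)"
      by (simp add: aefun_abs_eq_iff aefun_measurable)
    then show "x = 0" by (simp add: aefun_abs_rep aefun_abs_zero)
  qed (rule r0.normed_function_space r1.normed_function_space)+
  show ?thesis by (rule compatible_coupleI[OF r0.banach_function_space r1.banach_function_space])
qed

section \<open>Integral, essential supremum and associate norm as function norms\<close>

lemma AE_incseq_SUP: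
  fixes s :: "nat \<Rightarrow> real \<Rightarrow> ennreal"
  assumes "AE x in lebesgue. incseq (\<lambda>n. s n x) \<and> (\<lambda>n. s n x) \<longlonglongrightarrow> f x"
  shows "AE x in lebesgue. s n x \<le> s (Suc n) x" "AE x in lebesgue. f x = (SUP n. s n x)" "AE x in lebesgue. s n x \<le> f x"
proof -
  show "AE x in lebesgue. s n x \<le> s (Suc n) x" using assms by eventually_elim (auto dest: incseq_SucD)
  show "AE x in lebesgue. f x = (SUP n. s n x)"
    using assms by eventually_elim (auto intro: LIMSEQ_unique LIMSEQ_SUP)
  then show "AE x in lebesgue. s n x \<le> f x" by eventually_elim (auto intro: SUP_upper)
qed

lemma incseq_tendsto_SUP:
  fixes u :: "nat \<Rightarrow> ennreal"
  assumes "\<And>n. u n \<le> u (Suc n)" "l = (SUP n. u n)"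
  shows "incseq u \<and> u \<longlonglongrightarrow> l"
  using assms by (auto intro!: incseq_SucI LIMSEQ_SUP)

lemma function_norm_L1: "function_norm (\<lambda>f. \<integral>\<^sup>+x. f x \<partial>lebesgue)"
proof (unfold_locales, unfold banach_function_norm_def, intro conjI ballI allI impI)
  fix f :: "real \<Rightarrow> ennreal" assume f [measurable]: "f \<in> borel_measurable lebesgue"
  show "(\<integral>\<^sup>+x. f x \<partial>lebesgue) = 0 \<longleftrightarrow> (AE x in lebesgue. f x = 0)" by (rule nn_integral_0_iff_AE[OF f])
  show "(\<integral>\<^sup>+x. ennreal c * f x \<partial>lebesgue) = ennreal c * (\<integral>\<^sup>+x. f x \<partial>lebesgue)" for c
    by (rule nn_integral_cmult[OF f])
next
  fix f g :: "real \<Rightarrow> ennreal" assume [measurable]: "f \<in> borel_measurable lebesgue" "g \<in> borel_measurable lebesgue"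
  show "(\<integral>\<^sup>+x. f x + g x \<partial>lebesgue) \<le> (\<integral>\<^sup>+x. f x \<partial>lebesgue) + (\<integral>\<^sup>+x. g x \<partial>lebesgue)"
    by (subst nn_integral_add) auto
  show "(\<integral>\<^sup>+x. g x \<partial>lebesgue) \<le> (\<integral>\<^sup>+x. f x \<partial>lebesgue)" if "AE x in lebesgue. g x \<le> f x"
    using that by (rule nn_integral_mono_AE)
next
  fix s :: "nat \<Rightarrow> real \<Rightarrow> ennreal" and f :: "real \<Rightarrow> ennreal"
  assume "f \<in> borel_measurable lebesgue"
    and s: "(\<forall>n. s n \<in> borel_measurable lebesgue) \<and> (AE x in lebesgue. incseq (\<lambda>n. s n x) \<and> (\<lambda>n. s n x) \<longlonglongrightarrow> f x)"
  note AE = AE_incseq_SUP[OF conjunct2[OF s]]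
  have "(\<integral>\<^sup>+x. f x \<partial>lebesgue) = (\<integral>\<^sup>+x. (SUP n. s n x) \<partial>lebesgue)" by (rule nn_integral_cong_AE[OF AE(2)])
  also have "\<dots> = (SUP n. \<integral>\<^sup>+x. s n x \<partial>lebesgue)"
    using s by (intro nn_integral_monotone_convergence_SUP_AE AE(1)) auto
  finally have "incseq (\<lambda>n. \<integral>\<^sup>+x. s n x \<partial>lebesgue) \<and> (\<lambda>n. \<integral>\<^sup>+x. s n x \<partial>lebesgue) \<longlonglongrightarrow> (\<integral>\<^sup>+x. f x \<partial>lebesgue)"
    by (intro incseq_tendsto_SUP nn_integral_mono_AE AE(1))
  then show "incseq (\<lambda>n. \<integral>\<^sup>+x. s n x \<partial>lebesgue)" "(\<lambda>n. \<integral>\<^sup>+x. s n x \<partial>lebesgue) \<longlonglongrightarrow> (\<integral>\<^sup>+x. f x \<partial>lebesgue)" by auto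
next
  fix D :: "real set" assume D: "D \<in> sets lebesgue" "emeasure lebesgue D < \<infinity>"
  then show "(\<integral>\<^sup>+x. indicator D x \<partial>lebesgue) < \<infinity>" by simp
  show "\<exists>c::real. \<forall>f\<in>borel_measurable lebesgue. (\<integral>\<^sup>+x\<in>D. f x \<partial>lebesgue) \<le> ennreal c * (\<integral>\<^sup>+x. f x \<partial>lebesgue)"
    by (intro exI[of _ 1] ballI) (auto intro!: nn_integral_mono simp: indicator_def)
qed

lemma function_norm_Linf: "function_norm (esssup lebesgue :: (real \<Rightarrow> ennreal) \<Rightarrow> ennreal)"
proof (unfold_locales, unfold banach_function_norm_def, intro conjI ballI allI impI)
  fix f :: "real \<Rightarrow> ennreal" assume f [measurable]: "f \<in> borel_measurable lebesgue"
  show "esssup lebesgue f = 0 \<longleftrightarrow> (AE x in lebesgue. f x = 0)"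
  proof
    assume "esssup lebesgue f = 0"
    then show "AE x in lebesgue. f x = 0" using esssup_AE[where M=lebesgue and f=f] by simp
  next
    assume "AE x in lebesgue. f x = 0"
    then have "AE x in lebesgue. f x \<le> 0" by eventually_elim simp
    then have "esssup lebesgue f \<le> 0" by (rule esssup_I[OF f])
    then show "esssup lebesgue f = 0" by simp
  qed
  have cm: "esssup lebesgue (\<lambda>x. c * g x) \<le> c * esssup lebesgue g" if "g \<in> borel_measurable lebesgue" for c and g :: "real \<Rightarrow> ennreal"
    using esssup_AE[where M=lebesgue and f=g] that
    by (intro esssup_I) (auto elim!: eventually_mono intro: mult_left_mono)
  fix c :: real assume c: "0 \<le> c"
  show "esssup lebesgue (\<lambda>x. ennreal c * f x) = ennreal c * esssup lebesgue f"
  proof (cases "c = 0")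
    case True
    then show ?thesis using cm[OF f, of 0] by simp
  next
    case False
    with c have "0 < c" by simp
    then have inv: "ennreal (1/c) * ennreal c = 1" "ennreal c * ennreal (1/c) = 1" by (simp_all add: ennreal_mult'[symmetric])
    have "esssup lebesgue f = esssup lebesgue (\<lambda>x. ennreal (1/c) * (ennreal c * f x))"
      using inv by (simp add: mult.assoc[symmetric])
    also have "\<dots> \<le> ennreal (1/c) * esssup lebesgue (\<lambda>x. ennreal c * f x)" by (rule cm) simp
    finally have "ennreal c * esssup lebesgue f \<le> ennreal c * (ennreal (1/c) * esssup lebesgue (\<lambda>x. ennreal c * f x))"
      by (rule mult_left_mono) simp
    then show ?thesis using cm[OF f, of "ennreal c"] inv by (simp add: mult.assoc[symmetric])
  qed
next
  fix f g :: "real \<Rightarrow> ennreal" assume [measurable]: "f \<in> borel_measurable lebesgue" "g \<in> borel_measurable lebesgue"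
  have "AE x in lebesgue. f x + g x \<le> esssup lebesgue f + esssup lebesgue g"
    using esssup_AE[where M=lebesgue and f=f] esssup_AE[where M=lebesgue and f=g] by eventually_elim (rule add_mono)
  then show "esssup lebesgue (\<lambda>x. f x + g x) \<le> esssup lebesgue f + esssup lebesgue g" by (intro esssup_I) auto
  show "esssup lebesgue g \<le> esssup lebesgue f" if "AE x in lebesgue. g x \<le> f x"
    using that by (intro esssup_AE_mono) auto
next
  fix s :: "nat \<Rightarrow> real \<Rightarrow> ennreal" and f :: "real \<Rightarrow> ennreal"
  assume f: "f \<in> borel_measurable lebesgue"
    and s: "(\<forall>n. s n \<in> borel_measurable lebesgue) \<and> (AE x in lebesgue. incseq (\<lambda>n. s n x) \<and> (\<lambda>n. s n x) \<longlonglongrightarrow> f x)"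
  note AE = AE_incseq_SUP[OF conjunct2[OF s]]
  have "esssup lebesgue f = (SUP n. esssup lebesgue (s n))"
  proof (rule antisym)
    have "AE x in lebesgue. \<forall>n. s n x \<le> esssup lebesgue (s n)" by (simp add: AE_all_countable esssup_AE)
    then have "AE x in lebesgue. f x \<le> (SUP n. esssup lebesgue (s n))"
      using AE(2) by eventually_elim (auto intro!: SUP_mono)
    then show "esssup lebesgue f \<le> (SUP n. esssup lebesgue (s n))" by (rule esssup_I[OF f])
    show "(SUP n. esssup lebesgue (s n)) \<le> esssup lebesgue f"
      using s by (intro SUP_least esssup_AE_mono AE(3)) auto
  qed
  then have "incseq (\<lambda>n. esssup lebesgue (s n)) \<and> (\<lambda>n. esssup lebesgue (s n)) \<longlonglongrightarrow> esssup lebesgue f"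
    using s by (intro incseq_tendsto_SUP esssup_AE_mono AE(1)) auto
  then show "incseq (\<lambda>n. esssup lebesgue (s n))" "(\<lambda>n. esssup lebesgue (s n)) \<longlonglongrightarrow> esssup lebesgue f" by auto
next
  fix D :: "real set" assume D: "D \<in> sets lebesgue" "emeasure lebesgue D < \<infinity>"
  have "esssup lebesgue (indicator D :: real \<Rightarrow> ennreal) \<le> 1"
    using D by (intro esssup_I) (auto simp: indicator_def)
  then show "esssup lebesgue (indicator D :: real \<Rightarrow> ennreal) < \<infinity>" by (rule order_le_less_trans) simp
  show "\<exists>c::real. \<forall>f\<in>borel_measurable lebesgue. (\<integral>\<^sup>+x\<in>D. f x \<partial>lebesgue) \<le> ennreal c * esssup lebesgue f"
  proof (intro exI[of _ "measure lebesgue D"] ballI)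
    fix f :: "real \<Rightarrow> ennreal" assume "f \<in> borel_measurable lebesgue"
    have "(\<integral>\<^sup>+x\<in>D. f x \<partial>lebesgue) \<le> (\<integral>\<^sup>+x. esssup lebesgue f * indicator D x \<partial>lebesgue)"
      using esssup_AE[where M=lebesgue and f=f] by (intro nn_integral_mono_AE) (auto elim!: eventually_mono intro: mult_right_mono)
    also have "\<dots> = esssup lebesgue f * emeasure lebesgue D" using D by (rule_tac nn_integral_cmult_indicator)
    also have "\<dots> = ennreal (measure lebesgue D) * esssup lebesgue f"
      using D by (simp add: emeasure_eq_ennreal_measure mult.commute less_top[symmetric])
    finally show "(\<integral>\<^sup>+x\<in>D. f x \<partial>lebesgue) \<le> ennreal (measure lebesgue D) * esssup lebesgue f" .
  qed
qed

context function_norm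
begin

text \<open>Dividing \<open>f\<close> by its norm makes it a competitor in the supremum that defines
  the associate norm; when the norm is 0, the integrand vanishes almost everywhere.\<close>

lemma holder:
  assumes f: "f \<in> borel_measurable lebesgue" and fin: "\<rho> f < \<infinity>" and g: "g \<in> borel_measurable lebesgue"
  shows "(\<integral>\<^sup>+x. f x * g x \<partial>lebesgue) \<le> \<rho> f * associate_norm \<rho> g"
proof (cases "\<rho> f = 0")
  case True
  then have "AE x in lebesgue. f x = 0" using rho_eq_0[OF f] by simp
  then have "AE x in lebesgue. f x * g x = 0" by eventually_elim simp
  then have "(\<integral>\<^sup>+x. f x * g x \<partial>lebesgue) = (\<integral>\<^sup>+x. 0 \<partial>(lebesgue :: real measure))" by (rule nn_integral_cong_AE)
  then show ?thesis by simp
next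
  case False
  define r where "r = enn2real (\<rho> f)"
  have r: "ennreal r = \<rho> f" "0 < r"
    using False fin by (simp_all add: r_def enn2real_positive_iff zero_less_iff_neq_zero)
  have inv: "ennreal r * ennreal (1/r) = 1" using r(2) by (simp add: ennreal_mult'[symmetric])
  let ?h = "\<lambda>x. ennreal (1/r) * f x"
  have hm: "?h \<in> borel_measurable lebesgue" using f by (intro borel_measurable_times_ennreal) auto
  have "\<rho> ?h = ennreal (1/r) * \<rho> f" using r(2) by (intro rho_cmult f) simp
  then have "\<rho> ?h \<le> 1" using inv r(1) by (simp add: mult.commute)
  then have "(\<integral>\<^sup>+x. ?h x * g x \<partial>lebesgue) \<le> associate_norm \<rho> g"
    unfolding associate_norm_def using hm by (intro SUP_upper) simp
  then have "ennreal r * (\<integral>\<^sup>+x. ?h x * g x \<partial>lebesgue) \<le> \<rho> f * associate_norm \<rho> g"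
    unfolding r(1) by (rule mult_left_mono) simp
  moreover have "(\<integral>\<^sup>+x. f x * g x \<partial>lebesgue) = (\<integral>\<^sup>+x. ennreal r * (?h x * g x) \<partial>lebesgue)"
    using inv by (simp add: mult.assoc[symmetric])
  moreover have "\<dots> = ennreal r * (\<integral>\<^sup>+x. ?h x * g x \<partial>lebesgue)"
    by (intro nn_integral_cmult borel_measurable_times_ennreal hm g)
  ultimately show ?thesis by simp
qed

lemma associate_norm_le:
  assumes "\<And>h. h \<in> borel_measurable lebesgue \<Longrightarrow> \<rho> h \<le> 1 \<Longrightarrow> (\<integral>\<^sup>+x. h x * g x \<partial>lebesgue) \<le> c"
  shows "associate_norm \<rho> g \<le> c"
  unfolding associate_norm_def using assms by (intro SUP_least) auto

lemma associate_norm_upper: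
  assumes "h \<in> borel_measurable lebesgue" "\<rho> h \<le> 1"
  shows "(\<integral>\<^sup>+x. h x * g x \<partial>lebesgue) \<le> associate_norm \<rho> g"
  unfolding associate_norm_def using assms by (intro SUP_upper) auto

text \<open>The algebraic properties pass from the integrals to their supremum, and the property of
  increasing sequences follows by interchanging two suprema. The two local properties are dual to
  each other: finiteness on \<open>indicator D\<close> comes from the local integral estimate for
  \<open>\<rho>\<close>, and the local integral estimate comes from finiteness of
  \<open>\<rho> (indicator D)\<close> by Hoelder's inequality.\<close>

lemma function_norm_associate: "function_norm (associate_norm \<rho>)"
proof (unfold_locales, unfold banach_function_norm_def, intro conjI ballI allI impI)
  fix f :: "real \<Rightarrow> ennreal" assume f [measurable]: "f \<in> borel_measurable lebesgue"
  show "associate_norm \<rho> f = 0 \<longleftrightarrow> (AE x in lebesgue. f x = 0)"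
  proof
    assume 0: "associate_norm \<rho> f = 0"
    have "AE x in lebesgue. x \<in> {- real n..real n} \<longrightarrow> f x = 0" for n :: nat
    proof -
      let ?D = "{- real n..real n}"
      have D: "(indicator ?D :: real \<Rightarrow> ennreal) \<in> borel_measurable lebesgue" by (intro borel_measurable_indicator) simp
      have "\<rho> (indicator ?D) < \<infinity>" by (rule rho_indicator) auto
      then have "(\<integral>\<^sup>+x. indicator ?D x * f x \<partial>lebesgue) = 0"
        using holder[OF D _ f] 0 by simp
      then have "AE x in lebesgue. indicator ?D x * f x = 0"
        using D f by (subst (asm) nn_integral_0_iff_AE) (auto intro: borel_measurable_times_ennreal)
      then show ?thesis by eventually_elim (auto simp: indicator_def)
    qed
    then show "AE x in lebesgue. f x = 0" by (rule AE_lebesgue_intervals)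
  next
    assume AE: "AE x in lebesgue. f x = 0"
    have "associate_norm \<rho> f \<le> 0"
    proof (rule associate_norm_le)
      fix h :: "real \<Rightarrow> ennreal"
      have "AE x in lebesgue. h x * f x = 0" using AE by eventually_elim simp
      then have "(\<integral>\<^sup>+x. h x * f x \<partial>lebesgue) = (\<integral>\<^sup>+x. 0 \<partial>(lebesgue :: real measure))" by (rule nn_integral_cong_AE)
      then show "(\<integral>\<^sup>+x. h x * f x \<partial>lebesgue) \<le> 0" by simp
    qed
    then show "associate_norm \<rho> f = 0" by simp
  qed
  fix c :: real assume "0 \<le> c"
  have "(\<integral>\<^sup>+x. h x * (ennreal c * f x) \<partial>lebesgue) = ennreal c * (\<integral>\<^sup>+x. h x * f x \<partial>lebesgue)"
    if "h \<in> borel_measurable lebesgue" for h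
    using that f by (subst nn_integral_cmult[symmetric]) (auto simp: ac_simps)
  then show "associate_norm \<rho> (\<lambda>x. ennreal c * f x) = ennreal c * associate_norm \<rho> f"
    unfolding associate_norm_def by (subst SUP_mult_left_ennreal) (auto intro!: SUP_cong)
next
  fix f g :: "real \<Rightarrow> ennreal" assume f: "f \<in> borel_measurable lebesgue" and g: "g \<in> borel_measurable lebesgue"
  show "associate_norm \<rho> (\<lambda>x. f x + g x) \<le> associate_norm \<rho> f + associate_norm \<rho> g"
  proof (rule associate_norm_le)
    fix h assume h: "h \<in> borel_measurable lebesgue" "\<rho> h \<le> 1"
    have "(\<integral>\<^sup>+x. h x * (f x + g x) \<partial>lebesgue) = (\<integral>\<^sup>+x. h x * f x \<partial>lebesgue) + (\<integral>\<^sup>+x. h x * g x \<partial>lebesgue)"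
      unfolding distrib_left using f g h by (intro nn_integral_add borel_measurable_times_ennreal)
    also have "\<dots> \<le> associate_norm \<rho> f + associate_norm \<rho> g"
      by (intro add_mono associate_norm_upper h)
    finally show "(\<integral>\<^sup>+x. h x * (f x + g x) \<partial>lebesgue) \<le> associate_norm \<rho> f + associate_norm \<rho> g" .
  qed
  show "associate_norm \<rho> g \<le> associate_norm \<rho> f" if le: "AE x in lebesgue. g x \<le> f x"
  proof (rule associate_norm_le)
    fix h assume h: "h \<in> borel_measurable lebesgue" "\<rho> h \<le> 1"
    have "AE x in lebesgue. h x * g x \<le> h x * f x" using le by eventually_elim (rule mult_left_mono, auto)
    then have "(\<integral>\<^sup>+x. h x * g x \<partial>lebesgue) \<le> (\<integral>\<^sup>+x. h x * f x \<partial>lebesgue)" by (rule nn_integral_mono_AE)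
    also have "\<dots> \<le> associate_norm \<rho> f" by (rule associate_norm_upper[OF h])
    finally show "(\<integral>\<^sup>+x. h x * g x \<partial>lebesgue) \<le> associate_norm \<rho> f" .
  qed
next
  fix s :: "nat \<Rightarrow> real \<Rightarrow> ennreal" and f :: "real \<Rightarrow> ennreal"
  assume f: "f \<in> borel_measurable lebesgue"
    and s: "(\<forall>n. s n \<in> borel_measurable lebesgue) \<and> (AE x in lebesgue. incseq (\<lambda>n. s n x) \<and> (\<lambda>n. s n x) \<longlonglongrightarrow> f x)"
  note AE = AE_incseq_SUP[OF conjunct2[OF s]]
  have hSuc: "AE x in lebesgue. h x * s n x \<le> h x * s (Suc n) x" for h :: "real \<Rightarrow> ennreal" and n
    using AE(1)[of n] by eventually_elim (rule mult_left_mono, auto)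
  have "(\<integral>\<^sup>+x. h x * f x \<partial>lebesgue) = (SUP n. \<integral>\<^sup>+x. h x * s n x \<partial>lebesgue)"
    if h: "h \<in> borel_measurable lebesgue" for h
  proof -
    have "AE x in lebesgue. h x * f x = (SUP n. h x * s n x)"
      using AE(2) by eventually_elim (simp add: SUP_mult_left_ennreal)
    then have "(\<integral>\<^sup>+x. h x * f x \<partial>lebesgue) = (\<integral>\<^sup>+x. (SUP n. h x * s n x) \<partial>lebesgue)" by (rule nn_integral_cong_AE)
    also have "\<dots> = (SUP n. \<integral>\<^sup>+x. h x * s n x \<partial>lebesgue)"
      using s h by (intro nn_integral_monotone_convergence_SUP_AE hSuc borel_measurable_times_ennreal) auto
    finally show ?thesis .
  qed
  then have "associate_norm \<rho> f = (SUP n. associate_norm \<rho> (s n))"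
    unfolding associate_norm_def by (subst SUP_commute) (auto intro!: SUP_cong)
  moreover have "associate_norm \<rho> (s n) \<le> associate_norm \<rho> (s (Suc n))" for n
    unfolding associate_norm_def by (intro SUP_mono') (rule nn_integral_mono_AE[OF hSuc])
  ultimately have "incseq (\<lambda>n. associate_norm \<rho> (s n)) \<and> (\<lambda>n. associate_norm \<rho> (s n)) \<longlonglongrightarrow> associate_norm \<rho> f"
    by (intro incseq_tendsto_SUP)
  then show "incseq (\<lambda>n. associate_norm \<rho> (s n))" "(\<lambda>n. associate_norm \<rho> (s n)) \<longlonglongrightarrow> associate_norm \<rho> f" by auto
next
  fix D :: "real set" assume D: "D \<in> sets lebesgue" "emeasure lebesgue D < \<infinity>"
  have iD: "(indicator D :: real \<Rightarrow> ennreal) \<in> borel_measurable lebesgue" using D by (intro borel_measurable_indicator)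
  obtain c where c: "\<forall>f\<in>borel_measurable lebesgue. (\<integral>\<^sup>+x\<in>D. f x \<partial>lebesgue) \<le> ennreal c * \<rho> f"
    by (rule rho_local[OF D])
  have "associate_norm \<rho> (indicator D) \<le> ennreal c"
  proof (rule associate_norm_le)
    fix h assume h: "h \<in> borel_measurable lebesgue" "\<rho> h \<le> 1"
    have "(\<integral>\<^sup>+x. h x * indicator D x \<partial>lebesgue) \<le> ennreal c * \<rho> h" using c h(1) by simp
    also have "\<dots> \<le> ennreal c * 1" using h(2) by (rule mult_left_mono) simp
    finally show "(\<integral>\<^sup>+x. h x * indicator D x \<partial>lebesgue) \<le> ennreal c" by simp
  qed
  then show "associate_norm \<rho> (indicator D) < \<infinity>" by (rule order_le_less_trans) simp
  have fin: "\<rho> (indicator D) < \<infinity>" by (rule rho_indicator[OF D])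
  show "\<exists>c::real. \<forall>f\<in>borel_measurable lebesgue. (\<integral>\<^sup>+x\<in>D. f x \<partial>lebesgue) \<le> ennreal c * associate_norm \<rho> f"
    using holder[OF iD fin] fin by (intro exI[of _ "enn2real (\<rho> (indicator D))"]) (simp add: mult.commute)
qed

end

section \<open>Convolution operators and the interpolation functor\<close>

lemma lebesgue_AE_affine:
  fixes c :: real
  assumes "AE x in lebesgue. P x" "\<bar>c\<bar> = 1"
  shows "AE x in lebesgue. P (t + c * x)"
proof -
  have c0: "c \<noteq> 0" using assms(2) by auto
  have T: "(\<lambda>x. t + c * x) \<in> lebesgue \<rightarrow>\<^sub>M lebesgue"
    using lebesgue_affine_measurable[where c= "\<lambda>x::real. c"] c0 by simp
  have "lebesgue = distr lebesgue lebesgue (\<lambda>x. t + c * x)"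
    using lebesgue_real_affine[OF c0, of t] assms(2) by (simp add: density_1)
  then have "AE x in distr lebesgue lebesgue (\<lambda>x. t + c * x). P x" using assms(1) by metis
  then show ?thesis by (rule AE_distrD[OF T])
qed

lemma ex_borel_version:
  fixes h :: "real \<Rightarrow> real"
  assumes "h \<in> borel_measurable lebesgue"
  obtains h' where "h' \<in> borel_measurable borel" "AE x in lebesgue. h x = h' x"
proof -
  obtain h' where "h' \<in> borel_measurable lborel" "AE x in lborel. h x = h' x"
    using completion_ex_borel_measurable_real[OF assms] by blast
  then show ?thesis using that[of h'] by (simp add: AE_completion)
qed

text \<open>With Borel representatives the integrand of a convolution is jointly measurable in
  \<open>t\<close> and \<open>s\<close>, so that its integral over \<open>s\<close> is measurable in
  \<open>t\<close> and the order of integration may be changed.\<close>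

definition borel_rep :: "aefun \<Rightarrow> real \<Rightarrow> real" where
  "borel_rep v = (SOME h. h \<in> borel_measurable borel \<and> (AE x in lebesgue. rep_aefun v x = h x))"

lemma borel_rep: "borel_rep v \<in> borel_measurable borel" "AE x in lebesgue. rep_aefun v x = borel_rep v x"
proof -
  have "\<exists>h. h \<in> borel_measurable borel \<and> (AE x in lebesgue. rep_aefun v x = h x)"
    using ex_borel_version[OF aefun_measurable] by blast
  from someI_ex[OF this] show "borel_rep v \<in> borel_measurable borel" "AE x in lebesgue. rep_aefun v x = borel_rep v x"
    by (auto simp: borel_rep_def)
qed

lemma borel_rep_abs:
  assumes "h \<in> borel_measurable lebesgue"
  shows "AE x in lebesgue. h x = borel_rep (abs_aefun h) x"
  using aefun_rep_abs[OF assms] borel_rep(2)[of "abs_aefun h"] by eventually_elim simp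

lemma borel_rep_add: "AE x in lebesgue. borel_rep (v + w) x = borel_rep v x + borel_rep w x"
  using aefun_rep_add[of v w] borel_rep(2)[of v] borel_rep(2)[of w] borel_rep(2)[of "v + w"]
  by eventually_elim simp

lemma borel_rep_scaleR: "AE x in lebesgue. borel_rep (c *\<^sub>R v) x = c * borel_rep v x"
  using aefun_rep_scaleR[of c v] borel_rep(2)[of v] borel_rep(2)[of "c *\<^sub>R v"]
  by eventually_elim simp

lemma AE_lborel_of_lebesgue: "AE x in lebesgue. P x \<Longrightarrow> AE x in lborel. P x"
  by (simp add: AE_completion_iff)

definition cv :: "(real \<Rightarrow> real) \<Rightarrow> (real \<Rightarrow> real) \<Rightarrow> real \<Rightarrow> real" where
  "cv f v t = (\<integral>s. f (t - s) * v s \<partial>lborel)"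

text \<open>For \<open>f \<ge> 0\<close> this is the convolution with the absolute value of
  \<open>v\<close>, where infinity is allowed. Size estimates are made for \<open>ncv\<close>; the
  linear operation is \<open>cv\<close>, which is meaningful where \<open>ncv\<close> is finite and
  has the default value 0 elsewhere.\<close>

definition ncv :: "(real \<Rightarrow> real) \<Rightarrow> (real \<Rightarrow> real) \<Rightarrow> real \<Rightarrow> ennreal" where
  "ncv f v t = (\<integral>\<^sup>+s. ennreal (f (t - s) * \<bar>v s\<bar>) \<partial>lborel)"

lemma cv_measurable [measurable]:
  assumes [measurable]: "f \<in> borel_measurable borel" "v \<in> borel_measurable borel"
  shows "cv f v \<in> borel_measurable borel"
  unfolding cv_def by measurable

lemma ncv_measurable [measurable]:
  assumes [measurable]: "f \<in> borel_measurable borel" "v \<in> borel_measurable borel"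
  shows "ncv f v \<in> borel_measurable borel"
  unfolding ncv_def by measurable

lemma cv_integrable_iff:
  assumes [measurable]: "f \<in> borel_measurable borel" "v \<in> borel_measurable borel" and "\<And>x. 0 \<le> f x"
  shows "integrable lborel (\<lambda>s. f (t - s) * v s) \<longleftrightarrow> ncv f v t < \<infinity>"
  unfolding integrable_iff_bounded ncv_def using assms(3) by (simp add: abs_mult)

lemma cv_le_ncv:
  assumes f: "f \<in> borel_measurable borel" "\<And>x. 0 \<le> f x" and v: "v \<in> borel_measurable borel"
  shows "ennreal \<bar>cv f v t\<bar> \<le> ncv f v t"
proof (cases "ncv f v t < \<infinity>")
  case True
  then have "integrable lborel (\<lambda>s. f (t - s) * v s)" using cv_integrable_iff[OF f(1) v f(2)] by simp
  then have "ennreal (norm (cv f v t)) \<le> (\<integral>\<^sup>+s. ennreal (norm (f (t - s) * v s)) \<partial>lborel)"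
    unfolding cv_def by (rule integral_norm_bound_ennreal)
  then show ?thesis using f(2) by (simp add: ncv_def abs_mult)
qed (simp add: not_less top_unique)

lemma ncv_cong:
  assumes "f \<in> borel_measurable borel" "AE x in lebesgue. v x = w x"
  shows "ncv f v t = ncv f w t"
  unfolding ncv_def
proof (rule nn_integral_cong_AE)
  show "AE x in lborel. ennreal (f (t - x) * \<bar>v x\<bar>) = ennreal (f (t - x) * \<bar>w x\<bar>)"
    using AE_lborel_of_lebesgue[OF assms(2)] by eventually_elim simp
qed

lemma cv_cong:
  assumes "f \<in> borel_measurable borel" "v \<in> borel_measurable borel" "w \<in> borel_measurable borel"
    "AE x in lebesgue. v x = w x"
  shows "cv f v t = cv f w t"
  unfolding cv_def
proof (rule integral_cong_AE)
  show "AE x in lborel. f (t - x) * v x = f (t - x) * w x"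
    using AE_lborel_of_lebesgue[OF assms(4)] by eventually_elim simp
qed (use assms in measurable)

lemma ncv_add:
  assumes [measurable]: "f \<in> borel_measurable borel" "v \<in> borel_measurable borel" "w \<in> borel_measurable borel"
    and f: "\<And>x. 0 \<le> f x"
  shows "ncv f (\<lambda>x. v x + w x) t \<le> ncv f v t + ncv f w t"
proof -
  have "ncv f (\<lambda>x. v x + w x) t \<le> (\<integral>\<^sup>+s. ennreal (f (t - s) * \<bar>v s\<bar>) + ennreal (f (t - s) * \<bar>w s\<bar>) \<partial>lborel)"
    unfolding ncv_def
  proof (rule nn_integral_mono)
    fix s
    have "f (t - s) * \<bar>v s + w s\<bar> \<le> f (t - s) * (\<bar>v s\<bar> + \<bar>w s\<bar>)" using f by (intro mult_left_mono) auto
    then show "ennreal (f (t - s) * \<bar>v s + w s\<bar>) \<le> ennreal (f (t - s) * \<bar>v s\<bar>) + ennreal (f (t - s) * \<bar>w s\<bar>)"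
      using f by (simp add: ennreal_plus[symmetric] distrib_left ennreal_leI del: ennreal_plus)
  qed
  also have "\<dots> = ncv f v t + ncv f w t" unfolding ncv_def by (rule nn_integral_add) measurable
  finally show ?thesis .
qed

section \<open>End point estimates for convolutions and their interpolation\<close>

context ri_norm
begin

abbreviation E where "E \<equiv> function_space \<rho>"
abbreviation E' where "E' \<equiv> function_space (associate_norm \<rho>)"

lemma rho_ncv:
  assumes [measurable]: "f \<in> borel_measurable borel" "v \<in> borel_measurable borel" and f: "\<And>x. 0 \<le> f x"
  shows "\<rho> (ncv f v) \<le> \<rho> (\<lambda>x. ennreal (f x)) * (\<integral>\<^sup>+s. ennreal \<bar>v s\<bar> \<partial>lebesgue)"
  using rho_convolution[of f "\<lambda>s. \<bar>v s\<bar>"] f by (simp add: ncv_def[abs_def] nn_integral_completion)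

text \<open>Hoelder's inequality for the reflected translate \<open>s \<mapsto> f (t - s)\<close>,
  which has the same norm as \<open>f\<close>. The bound is uniform in \<open>t\<close>; this is the
  end point in L-infinity.\<close>

lemma ncv_le_associate:
  assumes f: "f \<in> borel_measurable borel" "\<And>x. 0 \<le> f x" "\<rho> (\<lambda>x. ennreal (f x)) < \<infinity>"
    and v: "v \<in> borel_measurable borel"
  shows "ncv f v t \<le> \<rho> (\<lambda>x. ennreal (f x)) * associate_norm \<rho> (\<lambda>s. ennreal \<bar>v s\<bar>)"
proof -
  have fm: "(\<lambda>x. ennreal (f x)) \<in> borel_measurable lebesgue" using f(1) by (intro measurable_completion) simp
  have vm: "(\<lambda>s. ennreal \<bar>v s\<bar>) \<in> borel_measurable lebesgue" using v by (intro measurable_completion) simp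
  note aff = rho_affine[OF fm, of "-1" t, simplified]
  have "ncv f v t = (\<integral>\<^sup>+s. ennreal (f (t - s)) * ennreal \<bar>v s\<bar> \<partial>lebesgue)"
    unfolding ncv_def using f(2) by (simp add: nn_integral_completion ennreal_mult)
  also have "\<dots> \<le> \<rho> (\<lambda>s. ennreal (f (t - s))) * associate_norm \<rho> (\<lambda>s. ennreal \<bar>v s\<bar>)"
    using aff f(3) vm by (intro holder) auto
  finally show ?thesis using aff by simp
qed

lemma compatible_L1_E': "compatible_couple L1_space E'"
  unfolding L1_space_def by (rule compatible_couple_function_spaces[OF function_norm_L1 function_norm_associate])

lemma compatible_E_Linf: "compatible_couple E Linf_space"
  unfolding Linf_space_def
  by (rule compatible_couple_function_spaces[OF function_norm_axioms function_norm_Linf])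

text \<open>Split \<open>v = w + z\<close>. For \<open>w\<close> in L1 the convolution has finite
  norm and is therefore finite almost everywhere; for \<open>z\<close> in \<open>E'\<close> it is
  bounded. This makes convolution additive on the whole sum.\<close>

lemma ncv_AE_finite:
  assumes f: "f \<in> borel_measurable borel" "\<And>x. 0 \<le> f x" "\<rho> (\<lambda>x. ennreal (f x)) < \<infinity>"
    and v: "v \<in> pts (sum_space L1_space E')"
  shows "AE t in lebesgue. ncv f (borel_rep v) t < \<infinity>"
proof -
  interpret L1: function_norm "\<lambda>f. \<integral>\<^sup>+x. f x \<partial>lebesgue" by (rule function_norm_L1)
  interpret A: function_norm "associate_norm \<rho>" by (rule function_norm_associate)
  obtain w z where wz: "w \<in> pts L1_space" "z \<in> pts E'" "v = w + z" using v by (auto simp: sum_space_def)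
  have "(\<integral>\<^sup>+s. ennreal \<bar>borel_rep w s\<bar> \<partial>lebesgue) = (\<integral>\<^sup>+s. ennreal \<bar>rep_aefun w s\<bar> \<partial>lebesgue)"
    using borel_rep(2)[of w] by (intro nn_integral_cong_AE) auto
  then have "(\<integral>\<^sup>+s. ennreal \<bar>borel_rep w s\<bar> \<partial>lebesgue) < \<infinity>"
    using wz(1) by (simp add: L1_space_def L1.pts_function_space)
  then have "\<rho> (ncv f (borel_rep w)) < \<infinity>"
    using rho_ncv[OF f(1) borel_rep(1)[of w] f(2)] f(3) by (auto simp: ennreal_mult_less_top intro: order_le_less_trans)
  then have w: "AE t in lebesgue. ncv f (borel_rep w) t < \<infinity>"
    using f(1) borel_rep(1) by (intro rho_finite_AE measurable_completion) auto
  have "A.N (borel_rep z) = A.N (rep_aefun z)"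
    using borel_rep(2)[of z] by (intro A.N_cong aefun_measurable measurable_completion) (auto simp: borel_rep(1))
  then have z: "ncv f (borel_rep z) t < \<infinity>" for t
    using ncv_le_associate[OF f borel_rep(1)[of z], of t] f(3) wz(2)
    by (auto simp: A.pts_function_space ennreal_mult_less_top intro: order_le_less_trans)
  show ?thesis
    using w
  proof eventually_elim
    fix t assume t: "ncv f (borel_rep w) t < \<infinity>"
    have "ncv f (borel_rep v) t = ncv f (\<lambda>x. borel_rep w x + borel_rep z x) t"
      unfolding wz(3) by (rule ncv_cong[OF f(1) borel_rep_add])
    also have "\<dots> \<le> ncv f (borel_rep w) t + ncv f (borel_rep z) t"
      by (rule ncv_add[OF f(1) borel_rep(1) borel_rep(1) f(2)])
    also have "\<dots> < \<infinity>" using t z by simp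
    finally show "ncv f (borel_rep v) t < \<infinity>" .
  qed
qed

text \<open>The bounded multiplier \<open>h\<close> lets one application of the functor also cover functions that are
  only dominated by a convolution.\<close>

lemma functor_convolution_operator:
  fixes h :: "real \<Rightarrow> real"
  assumes F: "exact_interpolation_functor F"
    and f: "f \<in> borel_measurable borel" "\<And>x. 0 \<le> f x" "\<rho> (\<lambda>x. ennreal (f x)) < \<infinity>"
    and h: "h \<in> borel_measurable lebesgue" "\<And>x. \<bar>h x\<bar> \<le> M"
    and v: "v \<in> pts (F L1_space E')"
  shows "abs_aefun (\<lambda>t. h t * cv f (borel_rep v) t) \<in> pts (F E Linf_space)"
    and "nrm (F E Linf_space) (abs_aefun (\<lambda>t. h t * cv f (borel_rep v) t))
      \<le> M * enn2real (\<rho> (\<lambda>x. ennreal (f x))) * nrm (F L1_space E') v"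
proof -
  interpret L1: function_norm "\<lambda>f. \<integral>\<^sup>+x. f x \<partial>lebesgue" by (rule function_norm_L1)
  interpret Li: function_norm "esssup lebesgue :: (real \<Rightarrow> ennreal) \<Rightarrow> ennreal" by (rule function_norm_Linf)
  interpret A: function_norm "associate_norm \<rho>" by (rule function_norm_associate)
  note cc = compatible_L1_E' compatible_E_Linf
  define S where "S v = abs_aefun (\<lambda>t. h t * cv f (borel_rep v) t)" for v
  define r where "r = enn2real (\<rho> (\<lambda>x. ennreal (f x)))"
  have r: "ennreal r = \<rho> (\<lambda>x. ennreal (f x))" "0 \<le> r" using f(3) by (simp_all add: r_def)
  have M: "0 \<le> M" using h(2)[of 0] by linarith
  have cvm: "cv f (borel_rep v) \<in> borel_measurable lebesgue" for v
    using f(1) borel_rep(1) by (intro measurable_completion) simp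
  have m: "(\<lambda>t. h t * cv f (borel_rep v) t) \<in> borel_measurable lebesgue" for v
    by (intro borel_measurable_times h cvm)
  have dom: "ennreal \<bar>h t * cv f (borel_rep v) t\<bar> \<le> ennreal M * ncv f (borel_rep v) t" for v t
  proof -
    have "ennreal \<bar>h t * cv f (borel_rep v) t\<bar> = ennreal \<bar>h t\<bar> * ennreal \<bar>cv f (borel_rep v) t\<bar>"
      by (simp add: abs_mult ennreal_mult)
    also have "\<dots> \<le> ennreal M * ncv f (borel_rep v) t"
      using h(2) cv_le_ncv[OF f(1,2) borel_rep(1)] by (intro mult_mono ennreal_leI) auto
    finally show ?thesis .
  qed
  have ncvm: "ncv f (borel_rep v) \<in> borel_measurable lebesgue" for v
    using f(1) borel_rep(1) by (intro measurable_completion) simp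
  have lin: "linear_on (pts (sum_space L1_space E')) S"
    unfolding linear_on_def
  proof (intro conjI ballI allI)
    fix v w assume vw: "v \<in> pts (sum_space L1_space E')" "w \<in> pts (sum_space L1_space E')"
    \<comment> \<open>Additivity holds where both convolutions converge absolutely, which is enough
      for classes modulo null sets.\<close>
    have "AE t in lebesgue. h t * cv f (borel_rep (v + w)) t = h t * cv f (borel_rep v) t + h t * cv f (borel_rep w) t"
      using ncv_AE_finite[OF f vw(1)] ncv_AE_finite[OF f vw(2)]
    proof eventually_elim
      fix t assume "ncv f (borel_rep v) t < \<infinity>" "ncv f (borel_rep w) t < \<infinity>"
      then have i: "integrable lborel (\<lambda>s. f (t - s) * borel_rep v s)" "integrable lborel (\<lambda>s. f (t - s) * borel_rep w s)"
        using cv_integrable_iff[OF f(1) borel_rep(1) f(2)] by auto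
      have "cv f (borel_rep (v + w)) t = cv f (\<lambda>x. borel_rep v x + borel_rep w x) t"
        by (rule cv_cong[OF f(1) borel_rep(1) _ borel_rep_add]) (intro borel_measurable_add borel_rep(1))
      also have "\<dots> = cv f (borel_rep v) t + cv f (borel_rep w) t"
        unfolding cv_def distrib_left by (rule Bochner_Integration.integral_add[OF i])
      finally show "h t * cv f (borel_rep (v + w)) t = h t * cv f (borel_rep v) t + h t * cv f (borel_rep w) t"
        by (simp add: distrib_left)
    qed
    then have "S (v + w) = abs_aefun (\<lambda>t. h t * cv f (borel_rep v) t + h t * cv f (borel_rep w) t)"
      unfolding S_def by (subst aefun_abs_eq_iff) (auto intro!: borel_measurable_add m)
    then show "S (v + w) = S v + S w" unfolding S_def by (simp add: aefun_abs_add m)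
  next
    fix v c
    \<comment> \<open>Homogeneity holds at every \<open>t\<close>: if the integral diverges and
      \<open>c\<close> is not 0, both sides have the default value 0.\<close>
    have "cv f (borel_rep (c *\<^sub>R v)) t = c * cv f (borel_rep v) t" for t
    proof -
      have "cv f (borel_rep (c *\<^sub>R v)) t = cv f (\<lambda>x. c * borel_rep v x) t"
        by (rule cv_cong[OF f(1) borel_rep(1) _ borel_rep_scaleR]) (intro borel_measurable_times borel_measurable_const borel_rep(1))
      then show ?thesis by (simp add: cv_def mult.left_commute)
    qed
    then have "S (c *\<^sub>R v) = abs_aefun (\<lambda>t. c * (h t * cv f (borel_rep v) t))"
      unfolding S_def by (simp add: mult.left_commute)
    then show "S (c *\<^sub>R v) = c *\<^sub>R S v" unfolding S_def by (simp add: aefun_abs_scaleR m)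
  qed
  have L1_E: "S v \<in> pts E \<and> nrm E (S v) \<le> M * r * nrm L1_space v" if v: "v \<in> pts L1_space" for v
  proof -
    have "N (\<lambda>t. h t * cv f (borel_rep v) t) \<le> \<rho> (\<lambda>t. ennreal M * ncv f (borel_rep v) t)"
      using m dom ncvm by (intro rho_mono AE_I2) auto
    also have "\<dots> = ennreal M * \<rho> (ncv f (borel_rep v))" by (rule rho_cmult[OF ncvm M])
    also have "\<dots> \<le> ennreal M * (ennreal r * (\<integral>\<^sup>+s. ennreal \<bar>borel_rep v s\<bar> \<partial>lebesgue))"
      unfolding r using rho_ncv[OF f(1) borel_rep(1) f(2)] by (intro mult_left_mono) auto
    also have "(\<integral>\<^sup>+s. ennreal \<bar>borel_rep v s\<bar> \<partial>lebesgue) = (\<integral>\<^sup>+s. ennreal \<bar>rep_aefun v s\<bar> \<partial>lebesgue)"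
      using borel_rep(2)[of v] by (intro nn_integral_cong_AE) auto
    also have "\<dots> = ennreal (nrm L1_space v)" using v L1.ennreal_nrm[of v] by (simp add: L1_space_def)
    also have "ennreal M * (ennreal r * ennreal (nrm L1_space v)) = ennreal (M * r * nrm L1_space v)"
      using M r(2) by (simp add: ennreal_mult mult.assoc L1_space_def L1.nrm_function_space)
    finally have "N (\<lambda>t. h t * cv f (borel_rep v) t) \<le> ennreal (M * r * nrm L1_space v)" .
    then show ?thesis
      unfolding S_def using M r(2) by (auto simp: abs_mem_function_space[OF m] nrm_abs_function_space[OF m]
          L1_space_def L1.nrm_function_space intro: order_le_less_trans intro!: enn2real_leI)
  qed
  have E'_Linf: "S v \<in> pts Linf_space \<and> nrm Linf_space (S v) \<le> M * r * nrm E' v" if v: "v \<in> pts E'" for v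
  proof -
    have eq: "A.N (borel_rep v) = ennreal (nrm E' v)"
      unfolding A.ennreal_nrm[OF v]
      using borel_rep(2)[of v] by (intro A.N_cong aefun_measurable measurable_completion) (auto simp: borel_rep(1))
    have "ennreal \<bar>h t * cv f (borel_rep v) t\<bar> \<le> ennreal (M * r * nrm E' v)" for t
    proof -
      have "ennreal \<bar>h t * cv f (borel_rep v) t\<bar> \<le> ennreal M * ncv f (borel_rep v) t" by (rule dom)
      also have "\<dots> \<le> ennreal M * (ennreal r * ennreal (nrm E' v))"
        using ncv_le_associate[OF f borel_rep(1)[of v], of t] unfolding eq r(1) by (intro mult_left_mono) auto
      also have "\<dots> = ennreal (M * r * nrm E' v)"
        using M r(2) by (simp add: ennreal_mult mult.assoc A.nrm_function_space)
      finally show ?thesis .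
    qed
    then have "esssup lebesgue (\<lambda>t. ennreal \<bar>h t * cv f (borel_rep v) t\<bar>) \<le> ennreal (M * r * nrm E' v)"
      using m[of v] by (intro esssup_I AE_I2) auto
    then show ?thesis
      unfolding S_def Linf_space_def using M r(2)
      by (auto simp: Li.abs_mem_function_space[OF m] Li.nrm_abs_function_space[OF m]
          A.nrm_function_space intro: order_le_less_trans intro!: enn2real_leI)
  qed
  have sub: "\<And>v. v \<in> pts L1_space \<Longrightarrow> v \<in> pts (sum_space L1_space E')" "\<And>v. v \<in> pts E' \<Longrightarrow> v \<in> pts (sum_space L1_space E')"
    using separated_couple.mem_S0[OF compatible_coupleD(3)[OF cc(1)]] separated_couple.mem_S1[OF compatible_coupleD(3)[OF cc(1)]] by auto
  have b: "bounded_linear_on L1_space E S" "bounded_linear_on E' Linf_space S"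
    using lin L1_E E'_Linf sub unfolding bounded_linear_on_def linear_on_def by blast+
  have op: "op_norm L1_space E S \<le> M * r" "op_norm E' Linf_space S \<le> M * r"
    using L1_E E'_Linf M r(2) by (auto intro!: op_norm_le)
  have FS: "bounded_linear_on (F L1_space E') (F E Linf_space) S"
    "op_norm (F L1_space E') (F E Linf_space) S \<le> max (op_norm L1_space E S) (op_norm E' Linf_space S)"
    using F cc lin b unfolding exact_interpolation_functor_def by blast+
  have X: "normed_space (F L1_space E')"
    using F cc unfolding exact_interpolation_functor_def by (blast intro: banach_space_normed)
  show "abs_aefun (\<lambda>t. h t * cv f (borel_rep v) t) \<in> pts (F E Linf_space)"
    using FS(1) v unfolding bounded_linear_on_def S_def by blast
  have "nrm (F E Linf_space) (S v) \<le> op_norm (F L1_space E') (F E Linf_space) S * nrm (F L1_space E') v"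
    by (rule op_norm_bound[OF FS(1) X v])
  \<comment> \<open>Exactness enters: the norm of the interpolated operator is at most the larger of
    the two end point norms, and each of these is at most \<open>M * r\<close>.\<close>
  also have "\<dots> \<le> M * r * nrm (F L1_space E') v"
    using FS(2) op nrm_nonneg[OF X v] by (intro mult_right_mono) auto
  finally show "nrm (F E Linf_space) (abs_aefun (\<lambda>t. h t * cv f (borel_rep v) t))
      \<le> M * enn2real (\<rho> (\<lambda>x. ennreal (f x))) * nrm (F L1_space E') v"
    by (simp add: S_def r_def)
qed

lemma functor_pts_sum:
  assumes "exact_interpolation_functor F" "v \<in> pts (F L1_space E')"
  shows "v \<in> pts (sum_space L1_space E')"
  using assms compatible_L1_E' unfolding exact_interpolation_functor_def bounded_linear_on_def by blast

text \<open>Bridges two forms of the convolution: the one that the weighted functionals produce,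
  with Lebesgue measurable functions and the translate on \<open>g\<close>, and the one estimated
  above, with Borel functions and the translate on \<open>f0\<close>.\<close>

lemma convolution_eq_ncv:
  fixes f g :: "real \<Rightarrow> real"
  assumes "AE x in lebesgue. f x = f0 x" "AE x in lebesgue. g x = v x" "\<And>x. 0 \<le> g x"
    and [measurable]: "f0 \<in> borel_measurable borel" "v \<in> borel_measurable borel"
  shows "(\<integral>\<^sup>+s. ennreal (f s * g (t - s)) \<partial>lebesgue) = ncv f0 v t"
proof -
  have "AE s in lebesgue. g (t - s) = v (t - s)"
    using lebesgue_AE_affine[OF assms(2), of "-1" t] by simp
  then have "AE s in lebesgue. ennreal (f s * g (t - s)) = ennreal (f0 s * \<bar>v (t - s)\<bar>)"
    using assms(1)
  proof eventually_elim
    fix s assume "g (t - s) = v (t - s)" "f s = f0 s"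
    then show "ennreal (f s * g (t - s)) = ennreal (f0 s * \<bar>v (t - s)\<bar>)" using assms(3)[of "t - s"] by simp
  qed
  then have "(\<integral>\<^sup>+s. ennreal (f s * g (t - s)) \<partial>lebesgue) = (\<integral>\<^sup>+s. ennreal (f0 s * \<bar>v (t - s)\<bar>) \<partial>lebesgue)"
    by (rule nn_integral_cong_AE)
  also have "\<dots> = (\<integral>\<^sup>+s. ennreal (f0 s * \<bar>v (t - s)\<bar>) \<partial>lborel)"
    by (rule nn_integral_completion)
  also have "\<dots> = ncv f0 v t"
    unfolding ncv_def by (subst nn_integral_real_affine[where c="-1" and t=t]) auto
  finally show ?thesis .
qed

text \<open>The first claim holds because \<open>g\<close> represents an element of L1 +
  \<open>E'\<close>. For the second, the quotient \<open>h\<close> of \<open>k\<close> by the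
  convolution \<open>c\<close> is bounded by \<open>M\<close>, so that almost everywhere
  \<open>k = h * c\<close>, and this is the image of \<open>g\<close> under one operator to which
  the functor applies.\<close>

lemma functor_convolution:
  fixes f g k :: "real \<Rightarrow> real"
  assumes F: "exact_interpolation_functor F"
    and f: "in_fspace E f" "\<And>x. 0 \<le> f x" and g: "in_fspace (F L1_space E') g" "\<And>x. 0 \<le> g x"
  shows "AE t in lebesgue. (\<integral>\<^sup>+s. ennreal (f s * g (t - s)) \<partial>lebesgue) < \<infinity>"
    and "k \<in> borel_measurable lebesgue \<Longrightarrow> (\<And>t. 0 \<le> k t) \<Longrightarrow> 0 \<le> M \<Longrightarrow>
      (\<And>t. ennreal (k t) \<le> ennreal M * (\<integral>\<^sup>+s. ennreal (f s * g (t - s)) \<partial>lebesgue)) \<Longrightarrow>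
      in_fspace (F E Linf_space) k \<and> fnrm (F E Linf_space) k \<le> M * fnrm E f * fnrm (F L1_space E') g"
proof -
  have fm: "f \<in> borel_measurable lebesgue" and gm: "g \<in> borel_measurable lebesgue"
    using f(1) g(1) by (auto simp: in_fspace_def)
  obtain f1 where f1: "f1 \<in> borel_measurable borel" "AE x in lebesgue. f x = f1 x" by (rule ex_borel_version[OF fm])
  \<comment> \<open>The Borel version \<open>f1\<close> may be negative on a null set, while the
    convolution estimates ask for nonnegativity at every point.\<close>
  define f0 where "f0 x = max 0 (f1 x)" for x
  have f0: "f0 \<in> borel_measurable borel" "\<And>x. 0 \<le> f0 x" unfolding f0_def using f1(1) by auto
  have ff0: "AE x in lebesgue. f x = f0 x"
    using f1(2) by eventually_elim (metis f(2) f0_def max.absorb2)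
  have "N f = \<rho> (\<lambda>x. ennreal (f0 x))"
  proof (rule rho_cong)
    show "AE x in lebesgue. ennreal \<bar>f x\<bar> = ennreal (f0 x)" using ff0 by eventually_elim (simp add: f0(2))
  qed (use fm f0(1) in \<open>auto intro!: measurable_completion\<close>)
  then have rf: "\<rho> (\<lambda>x. ennreal (f0 x)) < \<infinity>" "fnrm E f = enn2real (\<rho> (\<lambda>x. ennreal (f0 x)))"
    using f(1) fm by (auto simp: in_fspace_def abs_mem_function_space fnrm_def nrm_abs_function_space)
  define v where "v = abs_aefun g"
  have v: "v \<in> pts (F L1_space E')" using g(1) by (simp add: v_def in_fspace_def)
  have gv: "AE x in lebesgue. g x = borel_rep v x" unfolding v_def by (rule borel_rep_abs[OF gm])
  have eq: "(\<integral>\<^sup>+s. ennreal (f s * g (t - s)) \<partial>lebesgue) = ncv f0 (borel_rep v) t" for t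
    by (rule convolution_eq_ncv[OF ff0 gv g(2) f0(1) borel_rep(1)])
  have fin: "AE t in lebesgue. ncv f0 (borel_rep v) t < \<infinity>"
    by (rule ncv_AE_finite[OF f0 rf(1) functor_pts_sum[OF F v]])
  then show "AE t in lebesgue. (\<integral>\<^sup>+s. ennreal (f s * g (t - s)) \<partial>lebesgue) < \<infinity>" by (simp add: eq)
  assume km: "k \<in> borel_measurable lebesgue" and k0: "\<And>t. 0 \<le> k t" and M: "0 \<le> M"
    and k: "\<And>t. ennreal (k t) \<le> ennreal M * (\<integral>\<^sup>+s. ennreal (f s * g (t - s)) \<partial>lebesgue)"
  define c where "c = cv f0 (borel_rep v)"
  have cm: "c \<in> borel_measurable lebesgue"
    unfolding c_def using f0(1) borel_rep(1) by (intro measurable_completion) simp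
  \<comment> \<open>Where the convolution diverges, \<open>c\<close> has its default value and the
    comparison with \<open>k\<close> may fail; the value 0 there keeps
    \<open>\<bar>h t\<bar> \<le> M\<close> at every point. Where \<open>c t = 0\<close> and the
    comparison holds, also \<open>k t = 0\<close>, in accordance with division by 0.\<close>
  define h where "h t = (if k t \<le> M * c t then k t / c t else 0)" for t
  have hm: "h \<in> borel_measurable lebesgue"
  proof -
    note [measurable] = km cm
    show ?thesis unfolding h_def by measurable
  qed
  have hM: "\<bar>h t\<bar> \<le> M" for t
  proof (cases "0 < c t")
    case True
    then show ?thesis using k0[of t] M by (auto simp: h_def field_simps)
  next
    case False
    then have "M * c t \<le> 0" using M by (simp add: mult_nonneg_nonpos)
    then have "h t = 0" using k0[of t] by (cases "k t = 0") (auto simp: h_def)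
    then show ?thesis using M by simp
  qed
  have "AE t in lebesgue. h t * c t = k t"
    using fin
  proof eventually_elim
    fix t assume fin: "ncv f0 (borel_rep v) t < \<infinity>"
    have pos: "AE s in lborel. 0 \<le> f0 (t - s) * borel_rep v s"
    proof -
      have "AE s in lborel. g s = borel_rep v s" by (rule AE_lborel_of_lebesgue[OF gv])
      then show ?thesis by eventually_elim (metis mult_nonneg_nonneg f0(2) g(2))
    qed
    have int: "integrable lborel (\<lambda>s. f0 (t - s) * borel_rep v s)"
      using fin cv_integrable_iff[OF f0(1) borel_rep(1) f0(2)] by simp
    have "ncv f0 (borel_rep v) t = (\<integral>\<^sup>+s. ennreal (f0 (t - s) * borel_rep v s) \<partial>lborel)"
      unfolding ncv_def
    proof (rule nn_integral_cong_AE)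
      have "AE s in lborel. g s = borel_rep v s" by (rule AE_lborel_of_lebesgue[OF gv])
      then show "AE s in lborel. ennreal (f0 (t - s) * \<bar>borel_rep v s\<bar>) = ennreal (f0 (t - s) * borel_rep v s)"
        by eventually_elim (metis abs_of_nonneg g(2))
    qed
    also have "\<dots> = ennreal (c t)"
      unfolding c_def cv_def by (rule nn_integral_eq_integral[OF int pos])
    finally have "ennreal (k t) \<le> ennreal M * ennreal (c t)" using k[of t] by (simp add: eq)
    moreover have c0: "0 \<le> c t" unfolding c_def cv_def by (rule integral_nonneg_AE[OF pos])
    ultimately have "k t \<le> M * c t" using M by (simp add: ennreal_mult[symmetric])
    then show "h t * c t = k t" using k0[of t] by (auto simp: h_def)
  qed
  then have "abs_aefun (\<lambda>t. h t * c t) = abs_aefun k"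
    using hm cm km by (subst aefun_abs_eq_iff) auto
  then show "in_fspace (F E Linf_space) k \<and> fnrm (F E Linf_space) k \<le> M * fnrm E f * fnrm (F L1_space E') g"
    using functor_convolution_operator[OF F f0 rf(1) hm hM v] km
    by (simp add: in_fspace_def fnrm_def[of "F E Linf_space"] fnrm_def[of "F L1_space E'"] rf(2) c_def v_def)
qed

end

section \<open>Bilinear operators on couples\<close>

lemma compatible_couple_swap: "compatible_couple X0 X1 \<Longrightarrow> compatible_couple X1 X0"
  unfolding compatible_couple_def by blast

context separated_couple
begin

abbreviation J where "J \<equiv> J_functional X0 X1"
abbreviation I where "I \<equiv> pts X0 \<inter> pts X1"

lemma K_mult_greatest:
  assumes x: "x \<in> S" and a: "0 \<le> a"
    and le: "\<And>x0 x1. x0 \<in> pts X0 \<Longrightarrow> x1 \<in> pts X1 \<Longrightarrow> x = x0 + x1 \<Longrightarrow> c \<le> (nrm X0 x0 + t * nrm X1 x1) * a"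
  shows "c \<le> K t x * a"
proof -
  obtain x0 x1 where "x0 \<in> pts X0" "x1 \<in> pts X1" "x = x0 + x1" using x by (auto simp: sum_space_def)
  then show ?thesis unfolding K_functional_def
    by (intro Inf_mult_bound[where ?M0.0="nrm X0 x0 + t * nrm X1 x1"]) (use a le in auto)
qed

lemma J_nonneg: "x \<in> I \<Longrightarrow> 0 \<le> J t x"
  by (auto simp: J_functional_def le_max_iff_disj nrm_nonneg[OF n0])

lemma J_triangle:
  assumes "0 \<le> t" "x \<in> I" "y \<in> I"
  shows "J t (x + y) \<le> J t x + J t y"
proof -
  have "nrm X0 (x + y) \<le> nrm X0 x + nrm X0 y" using assms n0 by (simp add: nrm_triangle)
  moreover have "t * nrm X1 (x + y) \<le> t * nrm X1 x + t * nrm X1 y"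
    using mult_left_mono[OF nrm_triangle[OF n1, of x y] assms(1)] assms by (simp add: distrib_left)
  ultimately show ?thesis by (auto simp: J_functional_def)
qed

lemma J_scale:
  assumes "x \<in> I"
  shows "J t (c *\<^sub>R x) = \<bar>c\<bar> * J t x"
  using assms by (simp add: J_functional_def nrm_scaleR[OF n0] nrm_scaleR[OF n1] mult.left_commute max_mult_distrib_left)

lemma normed_inter_space: "normed_space (inter_space X0 X1)"
  unfolding normed_space_def
proof (intro conjI ballI allI)
  show "subspace (pts (inter_space X0 X1))"
    unfolding inter_space_def using normed_subspace[OF n0] normed_subspace[OF n1] by (simp add: subspace_inter)
  fix x assume "x \<in> pts (inter_space X0 X1)"
  then have x: "x \<in> I" by (simp add: inter_space_def)
  show "0 \<le> nrm (inter_space X0 X1) x" using J_nonneg[OF x] by (simp add: inter_space_def)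
  show "nrm (inter_space X0 X1) x = 0 \<longleftrightarrow> x = 0"
    using x nrm_eq_0[OF n0, of x] nrm_nonneg[OF n0, of x] nrm_zero[OF n0] nrm_zero[OF n1] nrm_nonneg[OF n1, of x]
    by (auto simp: inter_space_def J_functional_def max_def split: if_splits)
  show "nrm (inter_space X0 X1) (c *\<^sub>R x) = \<bar>c\<bar> * nrm (inter_space X0 X1) x" for c
    using J_scale[OF x] by (simp add: inter_space_def)
  show "nrm (inter_space X0 X1) (x + y) \<le> nrm (inter_space X0 X1) x + nrm (inter_space X0 X1) y"
    if "y \<in> pts (inter_space X0 X1)" for y
    using J_triangle[of 1, OF _ x] that by (simp add: inter_space_def)
qed

lemma pts_inter_space: "pts (inter_space X0 X1) = I"
  by (simp add: inter_space_def)

lemma bounded_linear_inter0: "bounded_linear_on (inter_space X0 X1) X0 (\<lambda>x. x)"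
  unfolding bounded_linear_on_def linear_on_def by (auto simp: inter_space_def J_functional_def intro!: exI[of _ 1])

lemma bounded_linear_inter1: "bounded_linear_on (inter_space X0 X1) X1 (\<lambda>x. x)"
  unfolding bounded_linear_on_def linear_on_def by (auto simp: inter_space_def J_functional_def intro!: exI[of _ 1])

lemma strongly_measurable_inter:
  assumes "strongly_measurable_in (inter_space X0 X1) v"
  shows "strongly_measurable_in X0 v" "strongly_measurable_in X1 v"
  using strongly_measurable_in_linear[OF normed_inter_space n0 bounded_linear_inter0 assms]
    strongly_measurable_in_linear[OF normed_inter_space n1 bounded_linear_inter1 assms] by auto

lemma strongly_measurable_inter_mem:
  "strongly_measurable_in (inter_space X0 X1) v \<Longrightarrow> v s \<in> I"
  using strongly_measurable_in_mem[of "inter_space X0 X1" v s] by (simp add: inter_space_def)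

lemma J_measurable:
  assumes v: "strongly_measurable_in (inter_space X0 X1) v" and r: "r \<in> borel_measurable lebesgue"
  shows "(\<lambda>s. J (r s) (v s)) \<in> borel_measurable lebesgue"
proof -
  note m = strongly_measurable_in_nrm[OF n0 strongly_measurable_inter(1)[OF v]]
    strongly_measurable_in_nrm[OF n1 strongly_measurable_inter(2)[OF v]]
  show ?thesis unfolding J_functional_def by (intro borel_measurable_max borel_measurable_times m r)
qed

text \<open>\<open>K\<close> is monotone in its parameter on the positive half-line. Composition
  with \<open>exp\<close> gives a monotone, hence Borel, function on the whole line, and
  \<open>ln\<close> undoes the substitution.\<close>

lemma K_measurable:
  assumes x: "x \<in> S" and r: "r \<in> borel_measurable lebesgue" "\<And>s. 0 < r s"
  shows "(\<lambda>s. K (r s) x) \<in> borel_measurable lebesgue"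
proof -
  have "mono (\<lambda>t. K (exp t) x)" using x by (intro monoI K_mono) auto
  then have m: "(\<lambda>t. K (exp t) x) \<in> borel_measurable borel" by (rule borel_measurable_mono)
  have "(\<lambda>s. ln (r s)) \<in> borel_measurable lebesgue" using r(1) by (rule borel_measurable_ln)
  then have "(\<lambda>s. K (exp (ln (r s))) x) \<in> borel_measurable lebesgue" using m by (rule measurable_compose)
  then show ?thesis using r(2) by (simp add: exp_ln)
qed

lemma has_bochner_integral_sum0: "has_bochner_integral_in X0 v a \<Longrightarrow> has_bochner_integral_in (sum_space X0 X1) v a"
  by (rule has_bochner_integral_in_linear[OF n0 normed_sum_space bounded_linear_incl0])

lemma has_bochner_integral_sum1: "has_bochner_integral_in X1 v a \<Longrightarrow> has_bochner_integral_in (sum_space X0 X1) v a"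
  by (rule has_bochner_integral_in_linear[OF n1 normed_sum_space bounded_linear_incl1])

end

lemma J_functional_swap:
  assumes "0 < t"
  shows "J_functional X1 X0 (1 / t) x * t = J_functional X0 X1 t x"
  using assms by (auto simp: J_functional_def max_def field_simps)

text \<open>Every decomposition of \<open>x\<close> serves both orders of the couple, with costs
  that differ by the factor \<open>t\<close>. Together with \<open>J_functional_swap\<close> it
  follows that the product of \<open>J\<close> at \<open>exp s\<close> and \<open>K\<close> at
  \<open>exp (- s)\<close> is unchanged when both couples are reversed and \<open>s\<close> changes
  sign.\<close>

lemma K_functional_swap_scale:
  assumes "separated_couple X0 X1" "0 < t" "x \<in> pts (sum_space X0 X1)"
  shows "K_functional X1 X0 t x = t * K_functional X0 X1 (1 / t) x"
proof -
  interpret separated_couple X0 X1 by fact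
  interpret sw: separated_couple X1 X0 by (rule swapped)
  have x': "x \<in> sw.S" using assms(3) sum_space_swap[of X0 X1] by simp
  show ?thesis
  proof (rule antisym)
    have "K_functional X1 X0 t x \<le> K (1/t) x * t"
    proof (rule K_mult_greatest[OF assms(3)])
      fix x0 x1 assume *: "x0 \<in> pts X0" "x1 \<in> pts X1" "x = x0 + x1"
      have "K_functional X1 X0 t (x1 + x0) \<le> nrm X1 x1 + t * nrm X0 x0"
        using * assms(2) by (intro sw.K_le) auto
      also have "\<dots> = (nrm X0 x0 + 1 / t * nrm X1 x1) * t" using assms(2) by (simp add: field_simps)
      finally show "K_functional X1 X0 t x \<le> (nrm X0 x0 + 1 / t * nrm X1 x1) * t"
        using * by (simp add: add.commute)
    qed (use assms(2) in simp)
    then show "K_functional X1 X0 t x \<le> t * K (1/t) x" by (simp add: mult.commute)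
    have "t * K (1/t) x \<le> K_functional X1 X0 t x"
      using x'
    proof (rule K_functional_greatest)
      fix x1 x0 assume *: "x1 \<in> pts X1" "x0 \<in> pts X0" "x = x1 + x0"
      have "t * K (1/t) x \<le> t * (nrm X0 x0 + 1/t * nrm X1 x1)"
        using K_le[of "1/t" x0 x1] * assms(2) by (intro mult_left_mono) (auto simp: add.commute)
      also have "\<dots> = nrm X1 x1 + t * nrm X0 x0" using assms(2) by (simp add: field_simps)
      finally show "t * K (1/t) x \<le> nrm X1 x1 + t * nrm X0 x0" .
    qed
    then show "t * K (1/t) x \<le> K_functional X1 X0 t x" .
  qed
qed

section \<open>The operator on the intersection of one couple and the sum of another\<close>

locale bilinear_couples =
  fixes A0 A1 :: "'a::real_vector nspace"
    and B0 B1 :: "'b::real_vector nspace"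
    and C0 C1 :: "'c::real_vector nspace"
    and T0 T1 :: "'a \<Rightarrow> 'b \<Rightarrow> 'c"
  assumes cA: "compatible_couple A0 A1" and cB: "compatible_couple B0 B1" and cC: "compatible_couple C0 C1"
    and T0: "bounded_bilinear_on A0 B0 C0 T0" and T1: "bounded_bilinear_on A1 B1 C1 T1"
    and agree: "\<And>a b. a \<in> pts A0 \<inter> pts A1 \<Longrightarrow> b \<in> pts B0 \<inter> pts B1 \<Longrightarrow> T0 a b = T1 a b"
begin

lemma swapped: "bilinear_couples A1 A0 B1 B0 C1 C0 T1 T0"
  using cA cB cC T0 T1 agree by unfold_locales (auto intro: compatible_couple_swap)

sublocale A: separated_couple A0 A1 by (rule compatible_coupleD(3)[OF cA])
sublocale B: separated_couple B0 B1 by (rule compatible_coupleD(3)[OF cB])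
sublocale C: separated_couple C0 C1 by (rule compatible_coupleD(3)[OF cC])

lemma bA: "banach_space A0" "banach_space A1" using compatible_coupleD[OF cA] by auto
lemma bC: "banach_space C0" "banach_space C1" using compatible_coupleD[OF cC] by auto

definition Tnorm :: real where
  "Tnorm = max (bilinear_op_norm A0 B0 C0 T0) (bilinear_op_norm A1 B1 C1 T1)"

lemma Tnorm_nonneg: "0 \<le> Tnorm"
  using bilinear_op_norm_bound(1)[OF T0 A.n0 B.n0] by (simp add: Tnorm_def)

lemma T0_le: "x \<in> pts A0 \<Longrightarrow> b \<in> pts B0 \<Longrightarrow> nrm C0 (T0 x b) \<le> Tnorm * nrm A0 x * nrm B0 b"
  using bilinear_op_norm_bound(2)[OF T0 A.n0 B.n0, of x b] nrm_nonneg[OF A.n0, of x] nrm_nonneg[OF B.n0, of b]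
  by (auto simp: Tnorm_def intro!: mult_right_mono elim!: order_trans)

lemma T1_le: "x \<in> pts A1 \<Longrightarrow> b \<in> pts B1 \<Longrightarrow> nrm C1 (T1 x b) \<le> Tnorm * nrm A1 x * nrm B1 b"
  using bilinear_op_norm_bound(2)[OF T1 A.n1 B.n1, of x b] nrm_nonneg[OF A.n1, of x] nrm_nonneg[OF B.n1, of b]
  by (auto simp: Tnorm_def intro!: mult_right_mono elim!: order_trans)

lemma T_mem: "x \<in> pts A0 \<Longrightarrow> b \<in> pts B0 \<Longrightarrow> T0 x b \<in> pts C0" "x \<in> pts A1 \<Longrightarrow> c \<in> pts B1 \<Longrightarrow> T1 x c \<in> pts C1"
  using T0 T1 by (auto simp: bounded_bilinear_on_def)

lemma T_linear:
  "b \<in> pts B0 \<Longrightarrow> linear_on (pts A0) (\<lambda>x. T0 x b)" "c \<in> pts B1 \<Longrightarrow> linear_on (pts A1) (\<lambda>x. T1 x c)"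
  "x \<in> pts A0 \<Longrightarrow> linear_on (pts B0) (T0 x)" "y \<in> pts A1 \<Longrightarrow> linear_on (pts B1) (T1 y)"
  using T0 T1 by (auto simp: bounded_bilinear_on_def)

text \<open>The decomposition of \<open>b\<close> is an arbitrary choice; for \<open>x\<close> in
  the intersection the value does not depend on it.\<close>

definition Tsum :: "'a \<Rightarrow> 'b \<Rightarrow> 'c" where
  "Tsum x b = (let p = SOME p. fst p \<in> pts B0 \<and> snd p \<in> pts B1 \<and> b = fst p + snd p in T0 x (fst p) + T1 x (snd p))"

text \<open>Two decompositions of the same element differ by a member of the intersection of
  \<open>B0\<close> and \<open>B1\<close>, on which \<open>T0\<close> and \<open>T1\<close>
  agree.\<close>

lemma Tsum_eq:
  assumes x: "x \<in> A.I" and b: "b0 \<in> pts B0" "b1 \<in> pts B1"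
  shows "Tsum x (b0 + b1) = T0 x b0 + T1 x b1"
proof -
  define p where "p = (SOME p. fst p \<in> pts B0 \<and> snd p \<in> pts B1 \<and> b0 + b1 = fst p + snd p)"
  have "\<exists>p. fst p \<in> pts B0 \<and> snd p \<in> pts B1 \<and> b0 + b1 = fst p + snd p"
    using b by (intro exI[of _ "(b0, b1)"]) simp
  then have p: "fst p \<in> pts B0" "snd p \<in> pts B1" "b0 + b1 = fst p + snd p"
    using someI_ex[of "\<lambda>p. fst p \<in> pts B0 \<and> snd p \<in> pts B1 \<and> b0 + b1 = fst p + snd p"]
    unfolding p_def by blast+
  have eq: "fst p - b0 = b1 - snd p" using p(3) by (simp add: algebra_simps)
  have mem: "fst p - b0 \<in> pts B0 \<inter> pts B1"
    using normed_diff[OF B.n0 p(1) b(1)] normed_diff[OF B.n1 b(2) p(2)] eq by simp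
  have "T0 x (fst p) - T0 x b0 = T0 x (fst p - b0)"
    using linear_on_diff[OF T_linear(3) p(1) b(1) normed_subspace[OF B.n0], of x] x by simp
  also have "\<dots> = T1 x (b1 - snd p)" using agree[OF x mem] eq by simp
  also have "\<dots> = T1 x b1 - T1 x (snd p)"
    using linear_on_diff[OF T_linear(4) b(2) p(2) normed_subspace[OF B.n1], of x] x by simp
  finally show ?thesis by (simp add: Tsum_def Let_def p_def[symmetric] algebra_simps)
qed

lemma Tsum_mem:
  assumes "x \<in> A.I" "b \<in> B.S"
  shows "Tsum x b \<in> C.S"
proof -
  obtain b0 b1 where "b0 \<in> pts B0" "b1 \<in> pts B1" "b = b0 + b1" using assms(2) by (auto simp: sum_space_def)
  then show ?thesis using Tsum_eq[OF assms(1)] assms(1) by (auto intro!: C.mem_S T_mem)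
qed

text \<open>A decomposition \<open>b = b0 + b1\<close> induces the decomposition
  \<open>T0 x b0 + T1 x b1\<close> of the image. Writing the weight as
  \<open>t = s * (t / s)\<close> lets \<open>J\<close> at \<open>s\<close> bound the norm of
  \<open>x\<close> in both terms, and what remains is the cost of the decomposition of
  \<open>b\<close> at \<open>t / s\<close>.\<close>

lemma Tsum_K_le:
  assumes x: "x \<in> A.I" and b: "b \<in> B.S" and st: "0 < s" "0 < t"
  shows "C.K t (Tsum x b) \<le> Tnorm * (A.J s x * B.K (t / s) b)"
proof -
  have x': "x \<in> pts A0" "x \<in> pts A1" using x by auto
  have "C.K t (Tsum x b) \<le> B.K (t / s) b * (Tnorm * A.J s x)"
  proof (rule B.K_mult_greatest[OF b])
    show "0 \<le> Tnorm * A.J s x" using Tnorm_nonneg A.J_nonneg[OF x] by simp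
    fix b0 b1 assume bb: "b0 \<in> pts B0" "b1 \<in> pts B1" "b = b0 + b1"
    have "C.K t (Tsum x b) \<le> nrm C0 (T0 x b0) + t * nrm C1 (T1 x b1)"
      unfolding bb(3) Tsum_eq[OF x bb(1,2)] using st x' bb by (intro C.K_le T_mem) auto
    also have "\<dots> \<le> Tnorm * nrm A0 x * nrm B0 b0 + t * (Tnorm * nrm A1 x * nrm B1 b1)"
      using st x' bb by (intro add_mono mult_left_mono T0_le T1_le) auto
    also have "\<dots> = Tnorm * nrm A0 x * nrm B0 b0 + Tnorm * (s * nrm A1 x) * (t / s * nrm B1 b1)"
      using st by (simp add: field_simps)
    also have "\<dots> \<le> Tnorm * A.J s x * nrm B0 b0 + Tnorm * A.J s x * (t / s * nrm B1 b1)"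
      using st bb nrm_nonneg[OF B.n0] nrm_nonneg[OF B.n1] Tnorm_nonneg
      by (intro add_mono mult_right_mono mult_left_mono) (auto simp: J_functional_def)
    finally show "C.K t (Tsum x b) \<le> (nrm B0 b0 + t / s * nrm B1 b1) * (Tnorm * A.J s x)"
      by (simp add: algebra_simps)
  qed
  then show ?thesis by (simp add: mult_ac)
qed

lemma Tsum_add_left:
  assumes "x \<in> A.I" "y \<in> A.I" "b \<in> B.S"
  shows "Tsum (x + y) b = Tsum x b + Tsum y b"
proof -
  obtain b0 b1 where b: "b0 \<in> pts B0" "b1 \<in> pts B1" "b = b0 + b1" using assms(3) by (auto simp: sum_space_def)
  have "x + y \<in> A.I" using assms normed_add[OF A.n0] normed_add[OF A.n1] by auto
  then show ?thesis
    using T_linear(1)[OF b(1)] T_linear(2)[OF b(2)] assms(1,2) unfolding b(3)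
    by (simp add: Tsum_eq b(1,2) linear_on_def)
qed

lemma Tsum_scale_left:
  assumes "x \<in> A.I" "b \<in> B.S"
  shows "Tsum (c *\<^sub>R x) b = c *\<^sub>R Tsum x b"
proof -
  obtain b0 b1 where b: "b0 \<in> pts B0" "b1 \<in> pts B1" "b = b0 + b1" using assms(2) by (auto simp: sum_space_def)
  have "c *\<^sub>R x \<in> A.I" using assms normed_scale[OF A.n0] normed_scale[OF A.n1] by auto
  then show ?thesis
    using T_linear(1)[OF b(1)] T_linear(2)[OF b(2)] assms(1) unfolding b(3)
    by (simp add: Tsum_eq b(1,2) linear_on_def scaleR_add_right)
qed

lemma Tsum_add_right:
  assumes "x \<in> A.I" "b \<in> B.S" "c \<in> B.S"
  shows "Tsum x (b + c) = Tsum x b + Tsum x c"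
proof -
  obtain b0 b1 where b: "b0 \<in> pts B0" "b1 \<in> pts B1" "b = b0 + b1" using assms(2) by (auto simp: sum_space_def)
  obtain c0 c1 where c: "c0 \<in> pts B0" "c1 \<in> pts B1" "c = c0 + c1" using assms(3) by (auto simp: sum_space_def)
  have eq: "b + c = (b0 + c0) + (b1 + c1)" using b c by simp
  show ?thesis
    unfolding eq using T_linear(3,4)[of x] assms(1) b c
    by (simp add: Tsum_eq normed_add[OF B.n0] normed_add[OF B.n1] linear_on_def)
qed

lemma Tsum_scale_right:
  assumes "x \<in> A.I" "b \<in> B.S"
  shows "Tsum x (c *\<^sub>R b) = c *\<^sub>R Tsum x b"
proof -
  obtain b0 b1 where b: "b0 \<in> pts B0" "b1 \<in> pts B1" "b = b0 + b1" using assms(2) by (auto simp: sum_space_def)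
  show ?thesis
    unfolding b(3) scaleR_add_right using T_linear(3,4)[of x] assms(1) b
    by (simp add: Tsum_eq normed_scale[OF B.n0] normed_scale[OF B.n1] linear_on_def scaleR_add_right)
qed

lemma Tsum_zero: "b \<in> B.S \<Longrightarrow> Tsum 0 b = 0" "x \<in> A.I \<Longrightarrow> Tsum x 0 = 0"
  using Tsum_scale_left[of 0 b 0] Tsum_scale_right[of x 0 0] normed_zero[OF A.n0] normed_zero[OF A.n1]
    subspace_0[OF B.S_subspace] by auto

lemma Tsum_diff_left:
  assumes "x \<in> A.I" "y \<in> A.I" "b \<in> B.S"
  shows "Tsum (x - y) b = Tsum x b - Tsum y b"
  using Tsum_add_left[of x "(-1) *\<^sub>R y" b] Tsum_scale_left[of y b "-1"] assms
    normed_uminus[OF A.n0] normed_uminus[OF A.n1] by simp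

lemma bounded_linear_Tsum:
  assumes "b \<in> B.S"
  shows "bounded_linear_on (inter_space A0 A1) (sum_space C0 C1) (\<lambda>x. Tsum x b)"
  unfolding bounded_linear_on_def linear_on_def A.pts_inter_space C.nrm_sum_space
  using Tsum_add_left Tsum_scale_left Tsum_mem Tsum_K_le[of _ b 1 1] assms
  by (auto simp: inter_space_def intro!: exI[of _ "Tnorm * B.K 1 b"] simp: mult_ac)

lemma strongly_measurable_Tsum:
  "b \<in> B.S \<Longrightarrow> strongly_measurable_in (inter_space A0 A1) v \<Longrightarrow> strongly_measurable_in (sum_space C0 C1) (\<lambda>s. Tsum (v s) b)"
  by (rule strongly_measurable_in_linear[OF A.normed_inter_space C.normed_sum_space bounded_linear_Tsum])

text \<open>For a fixed decomposition of \<open>b\<close>, the operator \<open>T0\<close> with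
  second argument \<open>b0\<close> is bounded on \<open>A0\<close>, and \<open>T1\<close> with
  \<open>b1\<close> on \<open>A1\<close>. Each commutes with the integral in its own space, and
  because the two integrals have the same value \<open>d\<close>, the results combine to
  \<open>Tsum d b\<close>.\<close>

lemma has_bochner_integral_Tsum:
  assumes v: "\<And>s. v s \<in> A.I" and d: "has_bochner_integral_in A0 v d" "has_bochner_integral_in A1 v d" and b: "b \<in> B.S"
  shows "has_bochner_integral_in (sum_space C0 C1) (\<lambda>s. Tsum (v s) b) (Tsum d b)"
proof -
  obtain b0 b1 where bb: "b0 \<in> pts B0" "b1 \<in> pts B1" "b = b0 + b1" using b by (auto simp: sum_space_def)
  have "bounded_linear_on A0 C0 (\<lambda>x. T0 x b0)"
    unfolding bounded_linear_on_def using T_linear(1)[OF bb(1)] T_mem(1) T0_le[of _ b0] bb(1)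
    by (auto intro!: exI[of _ "Tnorm * nrm B0 b0"] simp: mult_ac)
  then have i0: "has_bochner_integral_in (sum_space C0 C1) (\<lambda>s. T0 (v s) b0) (T0 d b0)"
    by (intro C.has_bochner_integral_sum0 has_bochner_integral_in_linear[OF A.n0 C.n0 _ d(1)])
  have "bounded_linear_on A1 C1 (\<lambda>x. T1 x b1)"
    unfolding bounded_linear_on_def using T_linear(2)[OF bb(2)] T_mem(2) T1_le[of _ b1] bb(2)
    by (auto intro!: exI[of _ "Tnorm * nrm B1 b1"] simp: mult_ac)
  then have i1: "has_bochner_integral_in (sum_space C0 C1) (\<lambda>s. T1 (v s) b1) (T1 d b1)"
    by (intro C.has_bochner_integral_sum1 has_bochner_integral_in_linear[OF A.n1 C.n1 _ d(2)])
  have "d \<in> A.I" using d by (auto dest: has_bochner_integral_inD)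
  then show ?thesis
    using has_bochner_integral_in_add[OF C.normed_sum_space i0 i1] v bb by (simp add: Tsum_eq)
qed

text \<open>If \<open>K(t, b)\<close> stays away from \<open>0\<close> as \<open>t \<rightarrow> 0\<close>, then \<open>v\<close> is integrable in \<open>A\<^sub>0\<close> as well. Otherwise
  the remainder \<open>a - \<integral>v\<close> over \<open>{r \<le> n + 1}\<close> is small in \<open>J\<close> relative to \<open>1 / K(1 / (n + 1), b)\<close>.\<close>

lemma Tsum_integral_one_sided:
  assumes v: "strongly_measurable_in (inter_space A0 A1) v"
    and r: "r \<in> borel_measurable lebesgue" "\<And>s. 0 < r s" "\<And>s. r s < 1 \<Longrightarrow> v s = 0"
    and b: "b \<in> B.S" "b \<noteq> 0"
    and fin: "(\<integral>\<^sup>+s. ennreal (A.J (r s) (v s) * B.K (1 / r s) b) \<partial>lebesgue) < \<infinity>"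
    and a: "has_bochner_integral_in A1 v a" "a \<in> pts A0"
  shows "has_bochner_integral_in (sum_space C0 C1) (\<lambda>s. Tsum (v s) b) (Tsum a b)"
proof -
  define g where "g s = A.J (r s) (v s) * B.K (1 / r s) b" for s
  have vI: "v s \<in> A.I" for s using v by (rule A.strongly_measurable_inter_mem)
  have v0: "v s \<in> pts A0" and v1: "v s \<in> pts A1" for s using vI[of s] by auto
  have zero: "nrm A0 0 = 0" "nrm A1 0 = 0" using nrm_zero[OF A.n0] nrm_zero[OF A.n1] by auto
  have r1: "0 < 1 / r s" for s using r(2)[of s] by simp
  have Kpos: "0 < B.K t b" if "0 < t" for t using B.K_pos[OF that b(1) b(2)] .
  have gm [measurable]: "g \<in> borel_measurable lebesgue"
    unfolding g_def using r r1 by (intro borel_measurable_times A.J_measurable[OF v] B.K_measurable[OF b(1)]) auto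
  have g0: "0 \<le> g s" for s unfolding g_def using A.J_nonneg[OF vI] Kpos[OF r1] by (simp add: less_imp_le)
  have gfin: "(\<integral>\<^sup>+s. ennreal (g s) \<partial>lebesgue) < \<infinity>" using fin by (simp add: g_def)
  have J0: "nrm A0 (v s) \<le> A.J (r s) (v s)" and J1: "r s * nrm A1 (v s) \<le> A.J (r s) (v s)" for s
    by (auto simp: J_functional_def)
  have nn: "0 \<le> nrm A0 (v s)" "0 \<le> nrm A1 (v s)" for s using v0 v1 nrm_nonneg[OF A.n0] nrm_nonneg[OF A.n1] by auto
  \<comment> \<open>The integrand \<open>g\<close> controls, with the common factor
    \<open>K t b\<close>, the norm in \<open>A0\<close> where \<open>r s \<le> 1 / t\<close> and, by
    the next estimate, \<open>1 / t\<close> times the norm in \<open>A1\<close> where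
    \<open>r s \<ge> 1 / t\<close>.\<close>
  have g_ge0: "nrm A0 (v s) * B.K t b \<le> g s" if "0 < t" "t \<le> 1 / r s" for s t
    unfolding g_def using J0[of s] nn B.K_mono[of t "1 / r s" b] that b Kpos[of t]
    by (intro mult_mono) (auto intro: order_trans[OF nn(1)] less_imp_le)
  have g_ge1: "1 / t * nrm A1 (v s) * B.K t b \<le> g s" if t: "1 / r s \<le> t" for s t
  proof -
    have tp: "0 < t" using r1[of s] t by linarith
    have "1 / r s * B.K t b \<le> t * B.K (1 / r s) b" using B.K_ratio[OF r1 t b(1)] .
    then have "1 / t * B.K t b \<le> r s * B.K (1 / r s) b" using tp r(2)[of s] by (simp add: field_simps)
    then have "nrm A1 (v s) * (1 / t * B.K t b) \<le> nrm A1 (v s) * (r s * B.K (1 / r s) b)"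
      using nn by (intro mult_left_mono) auto
    also have "\<dots> = (r s * nrm A1 (v s)) * B.K (1 / r s) b" by simp
    also have "\<dots> \<le> g s" unfolding g_def using J1 Kpos[OF r1[of s]] by (intro mult_right_mono) auto
    finally show ?thesis by (simp add: mult_ac)
  qed
  have int_le: "(\<integral>\<^sup>+s. ennreal (h s) \<partial>lebesgue) < \<infinity>" if "0 < c" "\<And>s. h s * c \<le> g s" for h :: "real \<Rightarrow> real" and c
  proof -
    have "(\<integral>\<^sup>+s. ennreal (h s) \<partial>lebesgue) \<le> (\<integral>\<^sup>+s. ennreal (1 / c) * ennreal (g s) \<partial>lebesgue)"
      using that g0 by (intro nn_integral_mono) (auto simp: ennreal_mult[symmetric] field_simps intro!: ennreal_leI)
    also have "\<dots> = ennreal (1 / c) * (\<integral>\<^sup>+s. ennreal (g s) \<partial>lebesgue)" by (rule nn_integral_cmult) measurable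
    also have "\<dots> < \<infinity>" using gfin by (simp add: ennreal_mult_less_top)
    finally show ?thesis .
  qed
  have aI: "a \<in> A.I" using a by (auto dest: has_bochner_integral_inD)
  show ?thesis
  proof (cases "\<exists>\<kappa>>0. \<forall>t. 0 < t \<longrightarrow> t \<le> 1 \<longrightarrow> \<kappa> \<le> B.K t b")
    case True
    then obtain \<kappa> where \<kappa>: "0 < \<kappa>" "\<And>t. 0 < t \<Longrightarrow> t \<le> 1 \<Longrightarrow> \<kappa> \<le> B.K t b" by blast
    have le: "nrm A0 (v s) * \<kappa> \<le> g s" for s
    proof (cases "r s < 1")
      case True
      then show ?thesis using r(3) g0 zero by simp
    next
      case False
      then have "\<kappa> \<le> B.K (1 / r s) b" using \<kappa>(2)[OF r1] by simp
      then have "nrm A0 (v s) * \<kappa> \<le> nrm A0 (v s) * B.K (1 / r s) b" using nn by (intro mult_left_mono) auto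
      also have "\<dots> \<le> g s" by (rule g_ge0[OF r1]) simp
      finally show ?thesis .
    qed
    have "(\<integral>\<^sup>+s. ennreal (nrm A0 (v s)) \<partial>lebesgue) < \<infinity>" by (rule int_le[OF \<kappa>(1) le])
    then obtain a' where a': "has_bochner_integral_in A0 v a'"
      using has_bochner_integral_in_exists[OF bA(1) A.strongly_measurable_inter(1)[OF v]] by blast
    have "a' = a"
      by (rule has_bochner_integral_in_unique[OF A.normed_sum_space A.has_bochner_integral_sum0[OF a'] A.has_bochner_integral_sum1[OF a(1)]])
    then show ?thesis using has_bochner_integral_Tsum[OF vI _ a(1) b(1)] a' by simp
  next
    case False
    define \<tau> where "\<tau> n = 1 / real (Suc n)" for n
    have \<tau>: "0 < \<tau> n" "\<tau> n \<le> 1" for n by (simp_all add: \<tau>_def)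
    have K_lim: "(\<lambda>n. B.K (\<tau> n) b) \<longlonglongrightarrow> 0"
    proof (rule LIMSEQ_I)
      fix e :: real assume "0 < e"
      then obtain t where t: "0 < t" "t \<le> 1" "B.K t b < e" using False by (meson not_le)
      obtain N where N: "inverse (real (Suc N)) < t" using reals_Archimedean[OF t(1)] by blast
      have "B.K (\<tau> n) b < e" if "n \<ge> N" for n
      proof -
        have "\<tau> n \<le> \<tau> N" using that by (simp add: \<tau>_def frac_le)
        then have "\<tau> n \<le> t" using N by (simp add: \<tau>_def inverse_eq_divide)
        then show ?thesis using B.K_mono[of "\<tau> n" t b] \<tau>[of n] b t by auto
      qed
      then show "\<exists>N. \<forall>n\<ge>N. norm (B.K (\<tau> n) b - 0) < e" using Kpos[OF \<tau>(1)] by (auto simp: less_imp_le)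
    qed
    define P where "P n = {s. r s \<le> real (Suc n)}" for n
    have Pm: "P n \<in> sets lebesgue" for n
      using borel_measurable_le[OF r(1) borel_measurable_const[of "real (Suc n)"]] by (simp add: P_def)
    have P_iff: "s \<in> P n \<longleftrightarrow> \<tau> n \<le> 1 / r s" for s n
      using r(2)[of s] by (simp add: P_def \<tau>_def field_simps del: of_nat_Suc)
    define vn where "vn n s = (if s \<in> P n then v s else 0)" for n s
    have vnI: "vn n s \<in> A.I" for n s using vI normed_zero[OF A.n0] normed_zero[OF A.n1] by (simp add: vn_def)
    have vn_m: "strongly_measurable_in (inter_space A0 A1) (vn n)" for n
      unfolding vn_def by (rule strongly_measurable_in_restrict[OF A.normed_inter_space v Pm])
    \<comment> \<open>The truncation is integrable in both spaces: in \<open>A0\<close> because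
      \<open>r\<close> is bounded above on \<open>P n\<close>, in \<open>A1\<close> because
      \<open>v\<close> vanishes where \<open>r < 1\<close>.\<close>
    have "\<exists>d. has_bochner_integral_in A0 (vn n) d \<and> has_bochner_integral_in A1 (vn n) d" for n
    proof -
      have le0: "nrm A0 (vn n s) * B.K (\<tau> n) b \<le> g s" for s
        using g_ge0[OF \<tau>(1), of n s] P_iff[of s n] g0 zero by (auto simp: vn_def)
      have "(\<integral>\<^sup>+s. ennreal (nrm A0 (vn n s)) \<partial>lebesgue) < \<infinity>" by (rule int_le[OF Kpos[OF \<tau>(1)] le0])
      then obtain d0 where d0: "has_bochner_integral_in A0 (vn n) d0"
        using has_bochner_integral_in_exists[OF bA(1) A.strongly_measurable_inter(1)[OF vn_m]] by blast
      have le1: "nrm A1 (vn n s) * B.K 1 b \<le> g s" for s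
      proof (cases "r s < 1")
        case True
        then show ?thesis using r(3) g0 zero by (simp add: vn_def)
      next
        case False
        then have "1 / r s \<le> 1" using r(2)[of s] by simp
        then show ?thesis using g_ge1[of s 1] g0 zero by (auto simp: vn_def)
      qed
      have "(\<integral>\<^sup>+s. ennreal (nrm A1 (vn n s)) \<partial>lebesgue) < \<infinity>" by (rule int_le[OF Kpos[OF zero_less_one] le1])
      then obtain d1 where d1: "has_bochner_integral_in A1 (vn n) d1"
        using has_bochner_integral_in_exists[OF bA(2) A.strongly_measurable_inter(2)[OF vn_m]] by blast
      have "d0 = d1"
        by (rule has_bochner_integral_in_unique[OF A.normed_sum_space A.has_bochner_integral_sum0[OF d0] A.has_bochner_integral_sum1[OF d1]])
      then show ?thesis using d0 d1 by blast
    qed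
    then obtain D where D: "\<And>n. has_bochner_integral_in A0 (vn n) (D n)" "\<And>n. has_bochner_integral_in A1 (vn n) (D n)"
      by metis
    have DI: "D n \<in> A.I" for n using D[of n] by (auto dest: has_bochner_integral_inD)
    note TD = has_bochner_integral_Tsum[OF vnI D b(1)]
    have T_g: "C.K 1 (Tsum (v s) b) \<le> Tnorm * g s" for s
      unfolding g_def using Tsum_K_le[OF vI b(1) r(2), of 1] by simp
    have Tv_m: "strongly_measurable_in (sum_space C0 C1) (\<lambda>s. Tsum (v s) b)"
      by (rule strongly_measurable_Tsum[OF b(1) v])
    have "(\<integral>\<^sup>+s. ennreal (C.K 1 (Tsum (v s) b)) \<partial>lebesgue) < \<infinity>"
    proof -
      have "(\<integral>\<^sup>+s. ennreal (C.K 1 (Tsum (v s) b)) \<partial>lebesgue) \<le> (\<integral>\<^sup>+s. ennreal Tnorm * ennreal (g s) \<partial>lebesgue)"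
        using T_g Tnorm_nonneg g0 by (intro nn_integral_mono) (auto simp: ennreal_mult[symmetric] intro!: ennreal_leI)
      also have "\<dots> = ennreal Tnorm * (\<integral>\<^sup>+s. ennreal (g s) \<partial>lebesgue)" by (rule nn_integral_cmult) measurable
      also have "\<dots> < \<infinity>" using gfin by (simp add: ennreal_mult_less_top)
      finally show ?thesis .
    qed
    then obtain c where c: "has_bochner_integral_in (sum_space C0 C1) (\<lambda>s. Tsum (v s) b) c"
      using has_bochner_integral_in_exists[OF C.banach_sum_space[OF bC] Tv_m] by (auto simp: C.nrm_sum_space)
    have cS: "c \<in> C.S" using c by (rule has_bochner_integral_inD)
    \<comment> \<open>\<open>G n\<close> is the tail of the integral of \<open>g\<close> beyond the
      cut-off. \<open>H n\<close> integrates the norm in \<open>A0\<close> of the truncated function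
      with the weight \<open>K (\<tau> n) b\<close>; its integrand is dominated by \<open>g\<close>
      and tends to 0 pointwise, as \<open>K (\<tau> n) b\<close> does.\<close>
    define G where "G n = (\<integral>\<^sup>+s. ennreal (if s \<in> P n then 0 else g s) \<partial>lebesgue)" for n
    define H where "H n = (\<integral>\<^sup>+s. ennreal (if s \<in> P n then nrm A0 (v s) * B.K (\<tau> n) b else 0) \<partial>lebesgue)" for n
    have if_m: "(\<lambda>s. ennreal (if s \<in> P n then h s else k s)) \<in> borel_measurable lebesgue"
      if "h \<in> borel_measurable lebesgue" "k \<in> borel_measurable lebesgue" for n and h k :: "real \<Rightarrow> real"
      using that Pm by (intro measurable_compose[OF _ measurable_ennreal] measurable_If_set) auto
    have v0_m: "(\<lambda>s. nrm A0 (v s)) \<in> borel_measurable lebesgue" "(\<lambda>s. nrm A1 (v s)) \<in> borel_measurable lebesgue"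
      using strongly_measurable_in_nrm[OF A.n0 A.strongly_measurable_inter(1)[OF v]]
        strongly_measurable_in_nrm[OF A.n1 A.strongly_measurable_inter(2)[OF v]] by auto
    have P_ev: "\<forall>\<^sub>F n in sequentially. s \<in> P n" for s
    proof -
      obtain N :: nat where "r s \<le> real N" using real_arch_simple by blast
      then show ?thesis by (auto simp: eventually_sequentially P_def intro!: exI[of _ N])
    qed
    have G_lim: "G \<longlonglongrightarrow> 0"
    proof -
      have "G \<longlonglongrightarrow> (\<integral>\<^sup>+s. 0 \<partial>(lebesgue :: real measure))"
        unfolding G_def
      proof (rule nn_integral_dominated_convergence[where w="\<lambda>s. ennreal (g s)"])
        show "AE s in lebesgue. (\<lambda>n. ennreal (if s \<in> P n then 0 else g s)) \<longlonglongrightarrow> 0"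
        proof (rule AE_I2)
          fix s
          have "\<forall>\<^sub>F n in sequentially. ennreal (if s \<in> P n then 0 else g s) = 0" using P_ev[of s] by eventually_elim simp
          then show "(\<lambda>n. ennreal (if s \<in> P n then 0 else g s)) \<longlonglongrightarrow> 0" by (rule tendsto_eventually)
        qed
        show "(\<lambda>s. ennreal (if s \<in> P n then 0 else g s)) \<in> borel_measurable lebesgue" for n
          by (rule if_m) simp_all
      qed (use gfin g0 in \<open>auto intro!: ennreal_leI\<close>)
      then show ?thesis by simp
    qed
    have H_lim: "H \<longlonglongrightarrow> 0"
    proof -
      have "H \<longlonglongrightarrow> (\<integral>\<^sup>+s. 0 \<partial>(lebesgue :: real measure))"
        unfolding H_def
      proof (rule nn_integral_dominated_convergence[where w="\<lambda>s. ennreal (g s)"])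
        show "AE s in lebesgue. (\<lambda>n. ennreal (if s \<in> P n then nrm A0 (v s) * B.K (\<tau> n) b else 0)) \<longlonglongrightarrow> 0"
        proof (rule AE_I2)
          fix s
          have "(\<lambda>n. nrm A0 (v s) * B.K (\<tau> n) b) \<longlonglongrightarrow> 0"
            using tendsto_mult[OF tendsto_const K_lim] by simp
          then have "(\<lambda>n. if s \<in> P n then nrm A0 (v s) * B.K (\<tau> n) b else 0) \<longlonglongrightarrow> 0"
            by (rule LIMSEQ_zero_le[rotated 2]) (use nn Kpos[OF \<tau>(1)] in \<open>auto simp: less_imp_le\<close>)
          then show "(\<lambda>n. ennreal (if s \<in> P n then nrm A0 (v s) * B.K (\<tau> n) b else 0)) \<longlonglongrightarrow> 0"
            using tendsto_ennrealI by fastforce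
        qed
        show "AE s in lebesgue. ennreal (if s \<in> P n then nrm A0 (v s) * B.K (\<tau> n) b else 0) \<le> ennreal (g s)" for n
          using g_ge0[OF \<tau>(1)] P_iff g0 by (intro AE_I2 ennreal_leI) auto
        show "(\<lambda>s. ennreal (if s \<in> P n then nrm A0 (v s) * B.K (\<tau> n) b else 0)) \<in> borel_measurable lebesgue" for n
          using v0_m(1) by (intro if_m borel_measurable_times) simp_all
      qed (use gfin in auto)
      then show ?thesis by simp
    qed
    have bound1: "ennreal (C.K 1 (c - Tsum (D n) b)) \<le> ennreal Tnorm * G n" for n
    proof -
      have "ennreal (C.K 1 (c - Tsum (D n) b)) \<le> (\<integral>\<^sup>+s. ennreal (C.K 1 (Tsum (v s) b - Tsum (vn n s) b)) \<partial>lebesgue)"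
        using has_bochner_integral_in_nrm_le[OF C.normed_sum_space has_bochner_integral_in_diff[OF C.normed_sum_space c TD[of n]]]
        by (simp add: C.nrm_sum_space)
      also have "\<dots> \<le> (\<integral>\<^sup>+s. ennreal Tnorm * ennreal (if s \<in> P n then 0 else g s) \<partial>lebesgue)"
      proof (rule nn_integral_mono)
        fix s
        have "C.K 1 0 = 0" using C.K_zero_iff[of 1 0] subspace_0[OF C.S_subspace] by simp
        then show "ennreal (C.K 1 (Tsum (v s) b - Tsum (vn n s) b)) \<le> ennreal Tnorm * ennreal (if s \<in> P n then 0 else g s)"
          using T_g[of s] Tnorm_nonneg g0[of s] Tsum_zero(1)[OF b(1)]
          by (auto simp: vn_def ennreal_mult[symmetric] intro!: ennreal_leI)
      qed
      also have "\<dots> = ennreal Tnorm * G n" unfolding G_def by (intro nn_integral_cmult if_m) auto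
      finally show ?thesis .
    qed
    \<comment> \<open>\<open>Tsum_K_le\<close> is applied to the remainder at the scale
      \<open>1 / \<tau> n\<close> of the cut-off. The part of \<open>J\<close> in \<open>A0\<close>
      is divided between \<open>a\<close>, a fixed element of \<open>A0\<close>, and
      \<open>D n\<close>, which \<open>H n\<close> bounds; the part in \<open>A1\<close> is an
      integral beyond the cut-off, which \<open>G n\<close> bounds.\<close>
    have bound2: "ennreal (C.K 1 (Tsum a b - Tsum (D n) b)) \<le> ennreal Tnorm * (ennreal (nrm A0 a * B.K (\<tau> n) b) + H n + G n)" for n
    proof -
      have RI: "a - D n \<in> A.I" using aI DI[of n] normed_diff[OF A.n0] normed_diff[OF A.n1] by auto
      then have R0: "a - D n \<in> pts A0" and R1: "a - D n \<in> pts A1" by auto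
      have "C.K 1 (Tsum a b - Tsum (D n) b) \<le> Tnorm * (A.J (1 / \<tau> n) (a - D n) * B.K (\<tau> n) b)"
        using Tsum_K_le[OF RI b(1), of "1 / \<tau> n" 1] \<tau>(1)[of n] Tsum_diff_left[OF aI DI b(1)] by simp
      also have "\<dots> \<le> Tnorm * (nrm A0 (a - D n) * B.K (\<tau> n) b + 1 / \<tau> n * nrm A1 (a - D n) * B.K (\<tau> n) b)"
      proof (intro mult_left_mono Tnorm_nonneg)
        have "A.J (1 / \<tau> n) (a - D n) \<le> nrm A0 (a - D n) + 1 / \<tau> n * nrm A1 (a - D n)"
          using nrm_nonneg[OF A.n0 R0] nrm_nonneg[OF A.n1 R1] \<tau>(1)[of n] by (auto simp: J_functional_def)
        then have "A.J (1 / \<tau> n) (a - D n) * B.K (\<tau> n) b \<le> (nrm A0 (a - D n) + 1 / \<tau> n * nrm A1 (a - D n)) * B.K (\<tau> n) b"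
          using Kpos[OF \<tau>(1)[of n]] by (intro mult_right_mono) auto
        then show "A.J (1 / \<tau> n) (a - D n) * B.K (\<tau> n) b \<le> nrm A0 (a - D n) * B.K (\<tau> n) b + 1 / \<tau> n * nrm A1 (a - D n) * B.K (\<tau> n) b"
          by (simp add: distrib_right)
      qed
      finally have "ennreal (C.K 1 (Tsum a b - Tsum (D n) b))
          \<le> ennreal (Tnorm * (nrm A0 (a - D n) * B.K (\<tau> n) b + 1 / \<tau> n * nrm A1 (a - D n) * B.K (\<tau> n) b))"
        by (rule ennreal_leI)
      also have "\<dots> = ennreal Tnorm * (ennreal (nrm A0 (a - D n) * B.K (\<tau> n) b) + ennreal (1 / \<tau> n * nrm A1 (a - D n) * B.K (\<tau> n) b))"
        using Tnorm_nonneg nrm_nonneg[OF A.n0 R0] nrm_nonneg[OF A.n1 R1] \<tau>(1)[of n] Kpos[OF \<tau>(1)[of n]]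
        by (subst ennreal_mult) (auto simp: ennreal_plus)
      also have "\<dots> \<le> ennreal Tnorm * ((ennreal (nrm A0 a * B.K (\<tau> n) b) + H n) + G n)"
      proof (intro mult_left_mono add_mono)
        have "nrm A0 (a - D n) * B.K (\<tau> n) b \<le> nrm A0 a * B.K (\<tau> n) b + nrm A0 (D n) * B.K (\<tau> n) b"
          using nrm_diff_le[OF A.n0, of a "D n"] aI DI[of n] Kpos[OF \<tau>(1)[of n]]
          by (auto simp: distrib_right[symmetric] intro!: mult_right_mono)
        moreover have D0: "0 \<le> nrm A0 (D n)" "0 \<le> nrm A0 a" using nrm_nonneg[OF A.n0] DI[of n] aI by auto
        ultimately have "ennreal (nrm A0 (a - D n) * B.K (\<tau> n) b) \<le> ennreal (nrm A0 a * B.K (\<tau> n) b) + ennreal (nrm A0 (D n) * B.K (\<tau> n) b)"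
          using Kpos[OF \<tau>(1)[of n]] by (simp add: ennreal_plus[symmetric] ennreal_leI del: ennreal_plus)
        also have "ennreal (nrm A0 (D n) * B.K (\<tau> n) b) \<le> H n"
        proof -
          have "ennreal (nrm A0 (D n) * B.K (\<tau> n) b) = ennreal (nrm A0 (D n)) * ennreal (B.K (\<tau> n) b)"
            using D0 Kpos[OF \<tau>(1)[of n]] by (simp add: ennreal_mult)
          also have "\<dots> \<le> (\<integral>\<^sup>+s. ennreal (nrm A0 (vn n s)) \<partial>lebesgue) * ennreal (B.K (\<tau> n) b)"
            by (intro mult_right_mono has_bochner_integral_in_nrm_le[OF A.n0 D(1)]) simp
          also have "\<dots> = (\<integral>\<^sup>+s. ennreal (nrm A0 (vn n s)) * ennreal (B.K (\<tau> n) b) \<partial>lebesgue)"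
            using strongly_measurable_in_nrm[OF A.n0 A.strongly_measurable_inter(1)[OF vn_m[of n]]]
            by (intro nn_integral_multc[symmetric]) auto
          also have "\<dots> = H n"
            unfolding H_def using nn Kpos[OF \<tau>(1)[of n]] zero by (intro nn_integral_cong) (auto simp: vn_def ennreal_mult)
          finally show ?thesis .
        qed
        finally show "ennreal (nrm A0 (a - D n) * B.K (\<tau> n) b) \<le> ennreal (nrm A0 a * B.K (\<tau> n) b) + H n"
          by (simp add: add_left_mono)
        have "ennreal (1 / \<tau> n * nrm A1 (a - D n) * B.K (\<tau> n) b) = ennreal (nrm A1 (a - D n)) * ennreal (1 / \<tau> n * B.K (\<tau> n) b)"
          using nrm_nonneg[OF A.n1 R1] Kpos[OF \<tau>(1)[of n]] \<tau>(1)[of n] by (simp add: ennreal_mult[symmetric])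
        also have "\<dots> \<le> (\<integral>\<^sup>+s. ennreal (nrm A1 (v s - vn n s)) \<partial>lebesgue) * ennreal (1 / \<tau> n * B.K (\<tau> n) b)"
          by (intro mult_right_mono has_bochner_integral_in_nrm_le[OF A.n1 has_bochner_integral_in_diff[OF A.n1 a(1) D(2)]]) simp
        also have "\<dots> = (\<integral>\<^sup>+s. ennreal (nrm A1 (v s - vn n s)) * ennreal (1 / \<tau> n * B.K (\<tau> n) b) \<partial>lebesgue)"
          using strongly_measurable_in_nrm[OF A.n1 strongly_measurable_in_diff[OF A.n1 A.strongly_measurable_inter(2)[OF v] A.strongly_measurable_inter(2)[OF vn_m[of n]]]]
          by (intro nn_integral_multc[symmetric]) auto
        also have "\<dots> \<le> G n"
          unfolding G_def
        proof (rule nn_integral_mono)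
          fix s
          show "ennreal (nrm A1 (v s - vn n s)) * ennreal (1 / \<tau> n * B.K (\<tau> n) b) \<le> ennreal (if s \<in> P n then 0 else g s)"
          proof (cases "s \<in> P n")
            case False
            then have "1 / \<tau> n * nrm A1 (v s) * B.K (\<tau> n) b \<le> g s" using P_iff[of s n] by (intro g_ge1) simp
            then show ?thesis
              using False nn(2)[of s] Kpos[OF \<tau>(1)[of n]] \<tau>(1)[of n]
              by (auto simp: vn_def ennreal_mult[symmetric] mult_ac intro!: ennreal_leI)
          qed (simp add: vn_def zero)
        qed
        finally show "ennreal (1 / \<tau> n * nrm A1 (a - D n) * B.K (\<tau> n) b) \<le> G n" .
      qed simp
      finally show ?thesis .
    qed
    have Ta: "Tsum a b \<in> C.S" and TDn: "Tsum (D n) b \<in> C.S" for n using Tsum_mem aI DI b(1) by auto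
    have "ennreal (C.K 1 (c - Tsum a b)) \<le> ennreal Tnorm * G n + ennreal Tnorm * (ennreal (nrm A0 a * B.K (\<tau> n) b) + H n + G n)" for n
    proof -
      have m: "c - Tsum (D n) b \<in> C.S" "Tsum a b - Tsum (D n) b \<in> C.S"
        using cS Ta TDn by (auto intro!: subspace_diff[OF C.S_subspace])
      have "C.K 1 (c - Tsum a b) \<le> C.K 1 (c - Tsum (D n) b) + C.K 1 (Tsum a b - Tsum (D n) b)"
        using nrm_diff_le[OF C.normed_sum_space m] by (simp add: C.nrm_sum_space)
      then have "ennreal (C.K 1 (c - Tsum a b)) \<le> ennreal (C.K 1 (c - Tsum (D n) b)) + ennreal (C.K 1 (Tsum a b - Tsum (D n) b))"
        using C.K_nonneg[of 1, OF _ m(1)] C.K_nonneg[of 1, OF _ m(2)] by (simp add: ennreal_plus[symmetric] ennreal_leI del: ennreal_plus)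
      also have "\<dots> \<le> ennreal Tnorm * G n + ennreal Tnorm * (ennreal (nrm A0 a * B.K (\<tau> n) b) + H n + G n)"
        by (rule add_mono[OF bound1 bound2])
      finally show ?thesis .
    qed
    moreover have "(\<lambda>n. ennreal Tnorm * G n + ennreal Tnorm * (ennreal (nrm A0 a * B.K (\<tau> n) b) + H n + G n)) \<longlonglongrightarrow> 0"
    proof -
      have l: "(\<lambda>n. ennreal (nrm A0 a * B.K (\<tau> n) b)) \<longlonglongrightarrow> 0"
        using tendsto_ennrealI[OF tendsto_mult[OF tendsto_const K_lim, of "nrm A0 a"]] by simp
      have "(\<lambda>n. ennreal (nrm A0 a * B.K (\<tau> n) b) + H n + G n) \<longlonglongrightarrow> 0"
        using tendsto_add[OF tendsto_add[OF l H_lim] G_lim] by simp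
      then have l1: "(\<lambda>n. ennreal Tnorm * (ennreal (nrm A0 a * B.K (\<tau> n) b) + H n + G n)) \<longlonglongrightarrow> 0"
        using ennreal_tendsto_cmult[of "ennreal Tnorm"] by fastforce
      have "(\<lambda>n. ennreal Tnorm * G n) \<longlonglongrightarrow> 0"
        using ennreal_tendsto_cmult[OF _ G_lim, of "ennreal Tnorm"] by simp
      then show ?thesis using tendsto_add[OF _ l1] by fastforce
    qed
    ultimately have "ennreal (C.K 1 (c - Tsum a b)) \<le> 0" by (intro LIMSEQ_le_const) auto
    moreover have m: "c - Tsum a b \<in> C.S" using cS Ta by (intro subspace_diff[OF C.S_subspace])
    ultimately have "C.K 1 (c - Tsum a b) = 0" using C.K_nonneg[of 1, OF _ m] by simp
    then have "c = Tsum a b" using C.K_zero_iff[of 1, OF _ m] by simp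
    then show ?thesis using c by simp
  qed
qed

end

section \<open>Independence of the representation\<close>

lemma inter_space_swap: "inter_space X1 X0 = inter_space X0 X1"
  unfolding inter_space_def J_functional_def by (auto simp: Int_commute max.commute)

lemma has_bochner_integral_in_zero:
  fixes X :: "'v::real_vector nspace"
  assumes "normed_space X"
  shows "has_bochner_integral_in X (\<lambda>_. 0) 0"
proof -
  have "simple_integrable (\<lambda>_::real. 0 :: 'v)" by (simp add: simple_bochner_integrable.simps)
  moreover have "simple_integral_of (\<lambda>_::real. 0 :: 'v) = 0" by (simp add: simple_bochner_integral_def)
  moreover have "strongly_measurable_in X (\<lambda>_. 0)"
    using assms by (intro strongly_measurable_in_simple) (auto simp: normed_zero)
  ultimately show ?thesis
    unfolding has_bochner_integral_in_def using assms
    by (intro conjI exI[of _ "\<lambda>_ _. 0"]) (auto simp: normed_zero nrm_zero)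
qed

context bilinear_couples
begin

lemma Tsum_integral_zero:
  assumes u: "strongly_measurable_in (inter_space A0 A1) u"
    and int: "has_bochner_integral_in (sum_space A0 A1) u 0" and b: "b \<in> B.S"
    and fin: "(\<integral>\<^sup>+s. ennreal (A.J (exp s) (u s) * B.K (exp (- s)) b) \<partial>lebesgue) < \<infinity>"
  shows "has_bochner_integral_in (sum_space C0 C1) (\<lambda>s. Tsum (u s) b) 0"
proof (cases "b = 0")
  case True
  then show ?thesis
    using Tsum_zero(2)[OF A.strongly_measurable_inter_mem[OF u]] has_bochner_integral_in_zero[OF C.normed_sum_space]
    by simp
next
  case False
  interpret sw: bilinear_couples A1 A0 B1 B0 C1 C0 T1 T0 by (rule swapped)
  have sw_Tsum: "sw.Tsum x b = Tsum x b" if x: "x \<in> A.I" for x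
  proof -
    obtain b0 b1 where bb: "b0 \<in> pts B0" "b1 \<in> pts B1" "b = b0 + b1" using b by (auto simp: sum_space_def)
    have "sw.Tsum x (b1 + b0) = T1 x b1 + T0 x b0" using x bb by (intro sw.Tsum_eq) auto
    then show ?thesis using Tsum_eq[OF x bb(1,2)] bb(3) by (simp add: add.commute)
  qed
  define g where "g s = A.J (exp s) (u s) * B.K (exp (- s)) b" for s
  have uI: "u s \<in> A.I" for s using u by (rule A.strongly_measurable_inter_mem)
  have zero: "nrm A0 0 = 0" "nrm A1 0 = 0" using nrm_zero[OF A.n0] nrm_zero[OF A.n1] by auto
  have nn: "0 \<le> nrm A0 (u s)" "0 \<le> nrm A1 (u s)" for s using uI[of s] nrm_nonneg[OF A.n0] nrm_nonneg[OF A.n1] by auto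
  have Kpos: "0 < B.K t b" if "0 < t" for t using B.K_pos[OF that b False] .
  have gm [measurable]: "g \<in> borel_measurable lebesgue"
  proof -
    have e: "(\<lambda>s::real. exp s) \<in> borel_measurable lebesgue" "(\<lambda>s::real. exp (- s)) \<in> borel_measurable lebesgue"
      by (intro measurable_completion; measurable)+
    show ?thesis
      unfolding g_def using e by (intro borel_measurable_times A.J_measurable[OF u] B.K_measurable[OF b]) auto
  qed
  have g0: "0 \<le> g s" for s unfolding g_def using A.J_nonneg[OF uI] Kpos[of "exp (- s)"] by simp
  have int_le: "(\<integral>\<^sup>+s. ennreal (h s) \<partial>lebesgue) < \<infinity>" if "\<And>s. h s * B.K 1 b \<le> g s" for h :: "real \<Rightarrow> real"
  proof -
    have "(\<integral>\<^sup>+s. ennreal (h s) \<partial>lebesgue) \<le> (\<integral>\<^sup>+s. ennreal (1 / B.K 1 b) * ennreal (g s) \<partial>lebesgue)"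
      using that g0 Kpos[of 1] by (intro nn_integral_mono) (auto simp: ennreal_mult[symmetric] field_simps intro!: ennreal_leI)
    also have "\<dots> = ennreal (1 / B.K 1 b) * (\<integral>\<^sup>+s. ennreal (g s) \<partial>lebesgue)" by (rule nn_integral_cmult) measurable
    also have "\<dots> < \<infinity>" using fin by (simp add: ennreal_mult_less_top g_def)
    finally show ?thesis .
  qed
  define p where "p s = (if s \<in> {0..} then u s else 0)" for s
  define m where "m s = (if s \<in> {..<0} then u s else 0)" for s
  have pm: "strongly_measurable_in (inter_space A0 A1) p" unfolding p_def
    by (rule strongly_measurable_in_restrict[OF A.normed_inter_space u]) simp
  have mm: "strongly_measurable_in (inter_space A0 A1) m" unfolding m_def
    by (rule strongly_measurable_in_restrict[OF A.normed_inter_space u]) simp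
  have J0: "A.J t 0 = 0" for t using zero by (simp add: J_functional_def)
  \<comment> \<open>For \<open>s \<ge> 0\<close> the quotient estimate
    \<open>exp (- s) * K 1 b \<le> K (exp (- s)) b\<close> lets \<open>g\<close> dominate the norm
    in \<open>A1\<close>; in \<open>mg\<close>, for \<open>s < 0\<close>, monotonicity of
    \<open>K\<close> does the same for \<open>A0\<close>.\<close>
  have pg: "nrm A1 (p s) * B.K 1 b \<le> g s" for s
  proof (cases "0 \<le> s")
    case True
    have "exp (- s) * B.K 1 b \<le> 1 * B.K (exp (- s)) b" using True b by (intro B.K_ratio) auto
    then have "exp s * nrm A1 (u s) * (exp (- s) * B.K 1 b) \<le> A.J (exp s) (u s) * B.K (exp (- s)) b"
      using nn[of s] Kpos[of 1] by (intro mult_mono) (auto simp: J_functional_def intro: order_trans[OF nn(1)])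
    then show ?thesis using True by (simp add: p_def g_def exp_minus field_simps)
  qed (simp add: p_def zero g0)
  have mg: "nrm A0 (m s) * B.K 1 b \<le> g s" for s
  proof (cases "s < 0")
    case True
    then have "nrm A0 (u s) * B.K 1 b \<le> A.J (exp s) (u s) * B.K (exp (- s)) b"
      using nn[of s] Kpos[of 1] b by (intro mult_mono B.K_mono) (auto simp: J_functional_def intro: order_trans[OF nn(1)])
    then show ?thesis using True by (simp add: m_def g_def)
  qed (simp add: m_def zero g0)
  obtain ap where ap: "has_bochner_integral_in A1 p ap"
    using has_bochner_integral_in_exists[OF bA(2) A.strongly_measurable_inter(2)[OF pm] int_le[OF pg]] by blast
  obtain am where am: "has_bochner_integral_in A0 m am"
    using has_bochner_integral_in_exists[OF bA(1) A.strongly_measurable_inter(1)[OF mm] int_le[OF mg]] by blast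
  have pm_eq: "p s + m s = u s" for s by (simp add: p_def m_def)
  have "ap + am = 0"
    using has_bochner_integral_in_add[OF A.normed_sum_space A.has_bochner_integral_sum1[OF ap] A.has_bochner_integral_sum0[OF am]]
    unfolding pm_eq by (rule has_bochner_integral_in_unique[OF A.normed_sum_space _ int])
  then have ap_eq: "ap = - am" by (simp add: eq_neg_iff_add_eq_0)
  have ap0: "ap \<in> pts A0" using has_bochner_integral_inD(1)[OF am] normed_uminus[OF A.n0] by (simp add: ap_eq)
  have am1: "am \<in> pts A1" using has_bochner_integral_inD(1)[OF ap] normed_uminus[OF A.n1, of ap] by (simp add: ap_eq)
  have i1: "has_bochner_integral_in (sum_space C0 C1) (\<lambda>s. Tsum (p s) b) (Tsum ap b)"
  proof (rule Tsum_integral_one_sided[OF pm, where r=exp])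
    show "(\<integral>\<^sup>+s. ennreal (A.J (exp s) (p s) * B.K (1 / exp s) b) \<partial>lebesgue) < \<infinity>"
    proof (rule order_le_less_trans[OF nn_integral_mono fin])
      fix s show "ennreal (A.J (exp s) (p s) * B.K (1 / exp s) b) \<le> ennreal (A.J (exp s) (u s) * B.K (exp (- s)) b)"
        using g0[of s] by (auto simp: p_def J0 g_def exp_minus inverse_eq_divide)
    qed
    show "exp \<in> borel_measurable (lebesgue :: real measure)" by (intro measurable_completion) measurable
  qed (use ap ap0 b False in \<open>auto simp: p_def\<close>)
  \<comment> \<open>The negative half-line is treated as the positive one for the reversed couples,
    with the scale \<open>exp (- s)\<close>.\<close>
  have "has_bochner_integral_in (sum_space C1 C0) (\<lambda>s. sw.Tsum (m s) b) (sw.Tsum am b)"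
  proof (rule sw.Tsum_integral_one_sided[where r="\<lambda>s. exp (- s)"])
    show "strongly_measurable_in (inter_space A1 A0) m" using mm by (simp add: inter_space_swap[of A1 A0])
    show "b \<in> sw.B.S" using b by (simp add: sum_space_swap[of B1 B0])
    show "(\<integral>\<^sup>+s. ennreal (sw.A.J (exp (- s)) (m s) * sw.B.K (1 / exp (- s)) b) \<partial>lebesgue) < \<infinity>"
    proof (rule order_le_less_trans[OF nn_integral_mono fin])
      fix s
      have "sw.A.J (exp (- s)) x * sw.B.K (1 / exp (- s)) b = A.J (exp s) x * B.K (exp (- s)) b" for x
      proof -
        have "sw.B.K (exp s) b = exp s * B.K (1 / exp s) b"
          by (rule K_functional_swap_scale[OF B.separated_couple_axioms _ b]) simp
        moreover have "sw.A.J (1 / exp s) x * exp s = A.J (exp s) x" by (rule J_functional_swap) simp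
        ultimately show ?thesis by (simp add: exp_minus inverse_eq_divide mult.assoc[symmetric])
      qed
      then show "ennreal (sw.A.J (exp (- s)) (m s) * sw.B.K (1 / exp (- s)) b) \<le> ennreal (A.J (exp s) (u s) * B.K (exp (- s)) b)"
        using g0[of s] by (auto simp: m_def J0 g_def)
    qed
    show "(\<lambda>s. exp (- s)) \<in> borel_measurable (lebesgue :: real measure)" by (intro measurable_completion) measurable
    show "m s = 0" if "exp (- s) < 1" for s using that by (simp add: m_def)
  qed (use am am1 False in simp_all)
  then have i2: "has_bochner_integral_in (sum_space C0 C1) (\<lambda>s. Tsum (m s) b) (Tsum am b)"
    using sw_Tsum A.strongly_measurable_inter_mem[OF mm] has_bochner_integral_inD(1)[OF am] am1
    by (simp add: sum_space_swap[of C1 C0])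
  have ampI: "ap \<in> A.I" "am \<in> A.I" using ap0 am1 has_bochner_integral_inD(1)[OF ap] has_bochner_integral_inD(1)[OF am] by auto
  have "Tsum (p s) b + Tsum (m s) b = Tsum (u s) b" for s
    using Tsum_zero(1)[OF b] by (simp add: p_def m_def)
  moreover have "Tsum ap b + Tsum am b = 0"
    using Tsum_add_left[OF ampI b] \<open>ap + am = 0\<close> Tsum_zero(1)[OF b] by simp
  ultimately show ?thesis using has_bochner_integral_in_add[OF C.normed_sum_space i1 i2] by simp
qed

section \<open>The extended operator and its bilinearity\<close>

abbreviation JK where
  "JK u b s \<equiv> A.J (exp s) (u s) * B.K (exp (- s)) b"

text \<open>This isolates what the construction of the operator asks of a representation:
  convergence of the pairing of \<open>J\<close> with \<open>K\<close> at reciprocal scales. It is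
  phrased in the couples alone and is stable under linear combinations in either argument, by the
  triangle inequalities for \<open>J\<close> and \<open>K\<close>.\<close>

definition admissible :: "'a \<Rightarrow> 'b \<Rightarrow> (real \<Rightarrow> 'a) \<Rightarrow> bool" where
  "admissible a b u \<longleftrightarrow> b \<in> B.S \<and> strongly_measurable_in (inter_space A0 A1) u \<and>
     has_bochner_integral_in (sum_space A0 A1) u a \<and>
     (\<integral>\<^sup>+s. ennreal (JK u b s) \<partial>lebesgue) < \<infinity>"

text \<open>The description is definite as soon as some admissible \<open>u\<close> exists: the
  K-estimate makes the integral converge, and \<open>admissible_integral_unique\<close> makes its
  value independent of \<open>u\<close>.\<close>

definition T_ext :: "'a \<Rightarrow> 'b \<Rightarrow> 'c" where
  "T_ext a b = (THE c. \<exists>u. admissible a b u \<and> has_bochner_integral_in (sum_space C0 C1) (\<lambda>s. Tsum (u s) b) c)"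

lemma JK_measurable:
  assumes "strongly_measurable_in (inter_space A0 A1) u" "b \<in> B.S"
  shows "(\<lambda>s. ennreal (JK u b s)) \<in> borel_measurable lebesgue"
proof -
  have e: "(\<lambda>s::real. exp s) \<in> borel_measurable lebesgue" "(\<lambda>s::real. exp (- s)) \<in> borel_measurable lebesgue"
    by (intro measurable_completion; measurable)+
  have "(\<lambda>s. JK u b s) \<in> borel_measurable lebesgue"
    using e assms by (intro borel_measurable_times A.J_measurable B.K_measurable) auto
  then show ?thesis by (rule measurable_compose) simp
qed

lemma admissibleD:
  assumes "admissible a b u"
  shows "b \<in> B.S" "strongly_measurable_in (inter_space A0 A1) u" "has_bochner_integral_in (sum_space A0 A1) u a"
    "(\<integral>\<^sup>+s. ennreal (JK u b s) \<partial>lebesgue) < \<infinity>" "u s \<in> A.I"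
  using assms A.strongly_measurable_inter_mem unfolding admissible_def by blast+

lemma JK_finite_le:
  assumes u: "admissible a b u" and v: "admissible a' c v"
    and le: "\<And>s. h s \<le> JK u b s + JK v c s"
  shows "(\<integral>\<^sup>+s. ennreal (h s) \<partial>lebesgue) < \<infinity>"
proof -
  have nn: "0 \<le> JK u b s" "0 \<le> JK v c s" for s
    by (intro mult_nonneg_nonneg A.J_nonneg B.K_nonneg admissibleD[OF u] admissibleD[OF v] exp_ge_zero)+
  have "(\<integral>\<^sup>+s. ennreal (h s) \<partial>lebesgue) \<le> (\<integral>\<^sup>+s. ennreal (JK u b s) +
      ennreal (JK v c s) \<partial>lebesgue)"
    using le nn by (intro nn_integral_mono) (simp add: ennreal_plus[symmetric] ennreal_leI del: ennreal_plus)
  also have "\<dots> = (\<integral>\<^sup>+s. ennreal (JK u b s) \<partial>lebesgue) +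
      (\<integral>\<^sup>+s. ennreal (JK v c s) \<partial>lebesgue)"
    by (intro nn_integral_add JK_measurable admissibleD[OF u] admissibleD[OF v])
  also have "\<dots> < \<infinity>" using admissibleD(4)[OF u] admissibleD(4)[OF v] by simp
  finally show ?thesis .
qed

lemma JK_finite_cmult:
  assumes u: "admissible a b u" and d: "0 \<le> d"
    and eq: "\<And>s. h s = d * (JK u b s)"
  shows "(\<integral>\<^sup>+s. ennreal (h s) \<partial>lebesgue) < \<infinity>"
proof -
  have "(\<integral>\<^sup>+s. ennreal (h s) \<partial>lebesgue) = (\<integral>\<^sup>+s. ennreal d * ennreal (JK u b s) \<partial>lebesgue)"
    using d by (simp add: eq ennreal_mult')
  also have "\<dots> = ennreal d * (\<integral>\<^sup>+s. ennreal (JK u b s) \<partial>lebesgue)"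
    by (intro nn_integral_cmult JK_measurable admissibleD[OF u])
  also have "\<dots> < \<infinity>" using admissibleD(4)[OF u] by (simp add: ennreal_mult_less_top)
  finally show ?thesis .
qed

lemma admissible_add_left:
  assumes u: "admissible a b u" and v: "admissible a' b v"
  shows "admissible (a + a') b (\<lambda>s. u s + v s)"
  unfolding admissible_def
proof (intro conjI)
  show "(\<integral>\<^sup>+s. ennreal (A.J (exp s) (u s + v s) * B.K (exp (- s)) b) \<partial>lebesgue) < \<infinity>"
  proof (rule JK_finite_le[OF u v])
    fix s
    have "A.J (exp s) (u s + v s) * B.K (exp (- s)) b \<le> (A.J (exp s) (u s) + A.J (exp s) (v s)) * B.K (exp (- s)) b"
      by (intro mult_right_mono A.J_triangle B.K_nonneg admissibleD[OF u] admissibleD[OF v] exp_ge_zero)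
    then show "A.J (exp s) (u s + v s) * B.K (exp (- s)) b \<le>
      JK u b s + JK v b s"
      by (simp add: distrib_right)
  qed
qed (intro admissibleD[OF u] admissibleD[OF v] strongly_measurable_in_add[OF A.normed_inter_space]
      has_bochner_integral_in_add[OF A.normed_sum_space])+

lemma admissible_add_right:
  assumes u: "admissible a b u" and v: "admissible a c u"
  shows "admissible a (b + c) u"
  unfolding admissible_def
proof (intro conjI)
  show "(\<integral>\<^sup>+s. ennreal (A.J (exp s) (u s) * B.K (exp (- s)) (b + c)) \<partial>lebesgue) < \<infinity>"
  proof (rule JK_finite_le[OF u v])
    fix s
    have "A.J (exp s) (u s) * B.K (exp (- s)) (b + c) \<le> A.J (exp s) (u s) * (B.K (exp (- s)) b + B.K (exp (- s)) c)"
      by (intro mult_left_mono A.J_nonneg B.K_triangle admissibleD[OF u] admissibleD[OF v] exp_ge_zero)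
    then show "A.J (exp s) (u s) * B.K (exp (- s)) (b + c) \<le>
      JK u b s + JK u c s"
      by (simp add: distrib_left)
  qed
qed (intro admissibleD[OF u] admissibleD[OF v] subspace_add[OF B.S_subspace])+

lemma admissible_scale_left:
  assumes u: "admissible a b u"
  shows "admissible (c *\<^sub>R a) b (\<lambda>s. c *\<^sub>R u s)"
  unfolding admissible_def
proof (intro conjI)
  show "(\<integral>\<^sup>+s. ennreal (A.J (exp s) (c *\<^sub>R u s) * B.K (exp (- s)) b) \<partial>lebesgue) < \<infinity>"
    by (rule JK_finite_cmult[OF u, of "\<bar>c\<bar>"]) (simp_all only: A.J_scale[OF admissibleD(5)[OF u]] abs_ge_zero mult.assoc)
qed (intro admissibleD[OF u]
    strongly_measurable_in_linear[OF A.normed_inter_space A.normed_inter_space bounded_linear_scaleR[OF A.normed_inter_space]]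
    has_bochner_integral_in_linear[OF A.normed_sum_space A.normed_sum_space bounded_linear_scaleR[OF A.normed_sum_space]])+

lemma admissible_scale_right:
  assumes u: "admissible a b u"
  shows "admissible a (c *\<^sub>R b) u"
  unfolding admissible_def
proof (intro conjI)
  show "(\<integral>\<^sup>+s. ennreal (A.J (exp s) (u s) * B.K (exp (- s)) (c *\<^sub>R b)) \<partial>lebesgue) < \<infinity>"
    by (rule JK_finite_cmult[OF u, of "\<bar>c\<bar>"])
      (simp_all only: B.K_scale[OF exp_ge_zero admissibleD(1)[OF u]] abs_ge_zero mult.left_commute)
qed (intro admissibleD[OF u] subspace_scale[OF B.S_subspace])+

lemma admissible_mem: "admissible a b u \<Longrightarrow> u s \<in> A.I" "admissible a b u \<Longrightarrow> b \<in> B.S"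
  using admissibleD(1,5) by blast+

text \<open>The difference of two representations of \<open>a\<close> represents 0 and is again
  admissible, so its image integrates to 0.\<close>

lemma admissible_integral_unique:
  assumes u: "admissible a b u" "has_bochner_integral_in (sum_space C0 C1) (\<lambda>s. Tsum (u s) b) c"
    and v: "admissible a b v" "has_bochner_integral_in (sum_space C0 C1) (\<lambda>s. Tsum (v s) b) d"
  shows "c = d"
proof -
  have "admissible (a - a) b (\<lambda>s. u s - v s)"
    using admissible_add_left[OF u(1) admissible_scale_left[OF v(1), of "-1"]] by simp
  then have 0: "has_bochner_integral_in (sum_space C0 C1) (\<lambda>s. Tsum (u s - v s) b) 0"
    unfolding admissible_def by (intro Tsum_integral_zero) auto
  have "has_bochner_integral_in (sum_space C0 C1) (\<lambda>s. Tsum (u s - v s) b) (c - d)"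
    using has_bochner_integral_in_diff[OF C.normed_sum_space u(2) v(2)] admissible_mem[OF u(1)] admissible_mem(1)[OF v(1)]
    by (simp add: Tsum_diff_left)
  then have "c - d = 0" by (rule has_bochner_integral_in_unique[OF C.normed_sum_space _ 0])
  then show ?thesis by simp
qed

lemma has_bochner_integral_T_ext:
  assumes u: "admissible a b u"
  shows "has_bochner_integral_in (sum_space C0 C1) (\<lambda>s. Tsum (u s) b) (T_ext a b)"
proof -
  note U = u[unfolded admissible_def]
  have uI: "u s \<in> A.I" for s using admissible_mem[OF u] by blast
  have "(\<integral>\<^sup>+s. ennreal (C.K 1 (Tsum (u s) b)) \<partial>lebesgue) \<le>
      (\<integral>\<^sup>+s. ennreal (Tnorm * (JK u b s)) \<partial>lebesgue)"
  proof (intro nn_integral_mono ennreal_leI)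
    fix s show "C.K 1 (Tsum (u s) b) \<le> Tnorm * (JK u b s)"
      using Tsum_K_le[OF uI admissibleD(1)[OF u], of "exp s" 1 s] by (simp add: exp_minus inverse_eq_divide)
  qed
  also have "\<dots> < \<infinity>" by (rule JK_finite_cmult[OF u Tnorm_nonneg refl])
  finally have fin: "(\<integral>\<^sup>+s. ennreal (nrm (sum_space C0 C1) (Tsum (u s) b)) \<partial>lebesgue) < \<infinity>"
    by (simp add: C.nrm_sum_space)
  have "strongly_measurable_in (sum_space C0 C1) (\<lambda>s. Tsum (u s) b)" using U by (intro strongly_measurable_Tsum) auto
  then obtain c where c: "has_bochner_integral_in (sum_space C0 C1) (\<lambda>s. Tsum (u s) b) c"
    using has_bochner_integral_in_exists[OF C.banach_sum_space[OF bC] _ fin] by blast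
  have "T_ext a b = c"
    unfolding T_ext_def
  proof (rule the_equality)
    show "\<exists>u. admissible a b u \<and> has_bochner_integral_in (sum_space C0 C1) (\<lambda>s. Tsum (u s) b) c" using u c by blast
    show "d = c" if "\<exists>v. admissible a b v \<and> has_bochner_integral_in (sum_space C0 C1) (\<lambda>s. Tsum (v s) b) d" for d
      using that admissible_integral_unique[OF _ _ u c] by (elim exE conjE)
  qed
  then show ?thesis using c by simp
qed

lemma T_ext_eqI:
  assumes "admissible a b u" "has_bochner_integral_in (sum_space C0 C1) (\<lambda>s. Tsum (u s) b) c"
  shows "T_ext a b = c"
  by (rule admissible_integral_unique[OF assms(1) has_bochner_integral_T_ext[OF assms(1)] assms])

lemma T_ext_add_left:
  assumes u: "admissible a b u" and v: "admissible a' b v"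
  shows "T_ext (a + a') b = T_ext a b + T_ext a' b"
  using has_bochner_integral_in_add[OF C.normed_sum_space has_bochner_integral_T_ext[OF u] has_bochner_integral_T_ext[OF v]]
    admissible_mem[OF u] admissible_mem[OF v]
  by (intro T_ext_eqI[OF admissible_add_left[OF u v]]) (simp add: Tsum_add_left)

lemma T_ext_scale_left:
  assumes u: "admissible a b u"
  shows "T_ext (c *\<^sub>R a) b = c *\<^sub>R T_ext a b"
  using has_bochner_integral_in_linear[OF C.normed_sum_space C.normed_sum_space bounded_linear_scaleR[OF C.normed_sum_space, of c] has_bochner_integral_T_ext[OF u]]
    admissible_mem[OF u]
  by (intro T_ext_eqI[OF admissible_scale_left[OF u]]) (simp add: Tsum_scale_left)

lemma T_ext_add_right:
  assumes u: "admissible a b u" and v: "admissible a c u"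
  shows "T_ext a (b + c) = T_ext a b + T_ext a c"
  using has_bochner_integral_in_add[OF C.normed_sum_space has_bochner_integral_T_ext[OF u] has_bochner_integral_T_ext[OF v]]
    admissible_mem[OF u] admissible_mem[OF v]
  by (intro T_ext_eqI[OF admissible_add_right[OF u v]]) (simp add: Tsum_add_right)

lemma T_ext_scale_right:
  assumes u: "admissible a b u"
  shows "T_ext a (c *\<^sub>R b) = c *\<^sub>R T_ext a b"
  using has_bochner_integral_in_linear[OF C.normed_sum_space C.normed_sum_space bounded_linear_scaleR[OF C.normed_sum_space, of c] has_bochner_integral_T_ext[OF u]]
    admissible_mem[OF u]
  by (intro T_ext_eqI[OF admissible_scale_right[OF u]]) (simp add: Tsum_scale_right)

lemma T_ext_zero_right: "admissible a 0 u \<Longrightarrow> T_ext a 0 = 0"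
  using T_ext_scale_right[of a 0 u 0] by simp

text \<open>The identity from the sum to the sum normed by \<open>K t\<close> is bounded, so the
  integral that defines \<open>T_ext\<close> also converges in the latter norm and is estimated
  under the integral sign. The scale of \<open>J\<close> follows the variable of
  integration.\<close>

lemma T_ext_K_le:
  assumes u: "admissible a b u" and t: "0 < t"
  shows "ennreal (C.K t (T_ext a b)) \<le> ennreal Tnorm * (\<integral>\<^sup>+s. ennreal (A.J (exp s) (u s) * B.K (t / exp s) b) \<partial>lebesgue)"
proof -
  note U = u[unfolded admissible_def]
  have uI: "u s \<in> A.I" for s using admissible_mem[OF u] by blast
  have "has_bochner_integral_in (C.K_normed t) (\<lambda>s. Tsum (u s) b) (T_ext a b)"
    by (rule has_bochner_integral_in_linear[OF C.normed_K_normed[OF zero_less_one] C.normed_K_normed[OF t]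
          C.bounded_linear_K_normed[OF zero_less_one t] has_bochner_integral_T_ext[OF u, unfolded C.sum_space_eq]])
  from has_bochner_integral_in_nrm_le[OF C.normed_K_normed[OF t] this]
  have "ennreal (C.K t (T_ext a b)) \<le> (\<integral>\<^sup>+s. ennreal (C.K t (Tsum (u s) b)) \<partial>lebesgue)" by simp
  also have "\<dots> \<le> (\<integral>\<^sup>+s. ennreal Tnorm * ennreal (A.J (exp s) (u s) * B.K (t / exp s) b) \<partial>lebesgue)"
  proof (rule nn_integral_mono)
    fix s
    have "ennreal (C.K t (Tsum (u s) b)) \<le> ennreal (Tnorm * (A.J (exp s) (u s) * B.K (t / exp s) b))"
      by (intro ennreal_leI Tsum_K_le uI admissibleD[OF u] t exp_gt_zero)
    then show "ennreal (C.K t (Tsum (u s) b)) \<le> ennreal Tnorm * ennreal (A.J (exp s) (u s) * B.K (t / exp s) b)"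
      by (simp add: ennreal_mult' Tnorm_nonneg)
  qed
  also have "\<dots> = ennreal Tnorm * (\<integral>\<^sup>+s. ennreal (A.J (exp s) (u s) * B.K (t / exp s) b) \<partial>lebesgue)"
  proof (rule nn_integral_cmult)
    have e: "(\<lambda>s::real. exp s) \<in> borel_measurable lebesgue" "(\<lambda>s::real. t / exp s) \<in> borel_measurable lebesgue"
      by (intro measurable_completion; measurable)+
    have "(\<lambda>s. A.J (exp s) (u s) * B.K (t / exp s) b) \<in> borel_measurable lebesgue"
      using e U t by (intro borel_measurable_times A.J_measurable B.K_measurable) auto
    then show "(\<lambda>s. ennreal (A.J (exp s) (u s) * B.K (t / exp s) b)) \<in> borel_measurable lebesgue"
      by (rule measurable_compose) simp
  qed
  finally show ?thesis .
qed

end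

section \<open>Slowly varying functions\<close>

lemma slowly_varying_pos: "slowly_varying \<phi> \<Longrightarrow> 0 < t \<Longrightarrow> 0 < \<phi> t"
  by (simp add: slowly_varying_def)

text \<open>The exponent \<open>\<epsilon> = 1\<close> suffices. For \<open>t \<ge> 1\<close>,
  \<open>\<phi> s / s\<close> is equivalent to a decreasing function of \<open>s\<close>, which
  gives the bound \<open>t * C / c\<close>; for \<open>t < 1\<close>, \<open>s * \<phi> s\<close> is
  equivalent to an increasing one, which gives \<open>C / (c * t)\<close>. Only for a bounded set
  does the real-valued supremum in \<open>m_sv\<close> have its intended meaning.\<close>

lemma slowly_varying_quotient_bdd:
  assumes \<phi>: "slowly_varying \<phi>" and t: "0 < t"
  shows "bdd_above ((\<lambda>s. \<phi> (t * s) / \<phi> s) ` {0<..})"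
proof (cases "1 \<le> t")
  case True
  obtain g where g: "monotone_on {0<..} (\<le>) (\<ge>) g" "equivalent_on_pos (\<lambda>t. t powr (- 1) * \<phi> t) g"
    using \<phi> unfolding slowly_varying_def by (meson zero_less_one)
  obtain c C where cC: "0 < c" "0 < C" "\<And>t. 0 < t \<Longrightarrow> c * g t \<le> t powr (- 1) * \<phi> t" "\<And>t. 0 < t \<Longrightarrow> t powr (- 1) * \<phi> t \<le> C * g t"
    using g(2) unfolding equivalent_on_pos_def by blast
  have "\<phi> (t * s) / \<phi> s \<le> t * C / c" if s: "0 < s" for s
  proof -
    have ts: "0 < t * s" "s \<le> t * s" using t s True by simp_all
    have "(t * s) powr (- 1) * \<phi> (t * s) \<le> C * g (t * s)" by (rule cC(4)[OF ts(1)])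
    also have "\<dots> \<le> C * g s" using g(1) ts s cC(2) by (intro mult_left_mono) (auto simp: monotone_on_def)
    also have "C * g s \<le> C * (s powr (- 1) * \<phi> s / c)"
      using cC(3)[OF s] cC(1,2) by (intro mult_left_mono) (simp_all only: pos_le_divide_eq mult.commute less_imp_le)
    finally show ?thesis
      using ts s t cC(1) slowly_varying_pos[OF \<phi> s] by (simp add: powr_minus field_simps)
  qed
  then show ?thesis by (intro bdd_aboveI[of _ "t * C / c"]) auto
next
  case False
  obtain g where g: "monotone_on {0<..} (\<le>) (\<le>) g" "equivalent_on_pos (\<lambda>t. t powr 1 * \<phi> t) g"
    using \<phi> unfolding slowly_varying_def by (meson zero_less_one)
  obtain c C where cC: "0 < c" "0 < C" "\<And>t. 0 < t \<Longrightarrow> c * g t \<le> t powr 1 * \<phi> t" "\<And>t. 0 < t \<Longrightarrow> t powr 1 * \<phi> t \<le> C * g t"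
    using g(2) unfolding equivalent_on_pos_def by blast
  have "\<phi> (t * s) / \<phi> s \<le> C / (c * t)" if s: "0 < s" for s
  proof -
    have ts: "0 < t * s" "t * s \<le> s" using t s False by simp_all
    have "(t * s) powr 1 * \<phi> (t * s) \<le> C * g (t * s)" by (rule cC(4)[OF ts(1)])
    also have "\<dots> \<le> C * g s" using g(1) ts s cC(2) by (intro mult_left_mono) (auto simp: monotone_on_def)
    also have "\<dots> \<le> C / c * (s powr 1 * \<phi> s)" using cC(3)[OF s] cC(1,2) by (simp add: field_simps)
    finally show ?thesis
      using ts s t cC(1) slowly_varying_pos[OF \<phi> s] by (simp add: field_simps)
  qed
  then show ?thesis by (intro bdd_aboveI[of _ "C / (c * t)"]) auto
qed

lemma m_sv_bound:
  assumes \<phi>: "slowly_varying \<phi>" and "0 < t" "0 < s"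
  shows "\<phi> (t * s) \<le> m_sv \<phi> t * \<phi> s" "0 < m_sv \<phi> t"
proof -
  have le: "\<phi> (t * r) / \<phi> r \<le> m_sv \<phi> t" if "0 < r" for r
    unfolding m_sv_def using that by (intro cSUP_upper slowly_varying_quotient_bdd assms) simp
  show "\<phi> (t * s) \<le> m_sv \<phi> t * \<phi> s" using le[OF assms(3)] slowly_varying_pos[OF \<phi> assms(3)] by (simp add: field_simps)
  have "0 < \<phi> (t * s) / \<phi> s" using assms slowly_varying_pos[OF \<phi>] by simp
  then show "0 < m_sv \<phi> t" using le[OF assms(3)] by linarith
qed

section \<open>The interpolation estimate\<close>

locale bilinear_interpolation = bilinear_couples A0 A1 B0 B1 C0 C1 T0 T1 + ri_norm \<rho>
  for A0 A1 :: "'a::real_vector nspace" and B0 B1 :: "'b::real_vector nspace" and C0 C1 :: "'c::real_vector nspace"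
    and T0 T1 and \<rho> :: "(real \<Rightarrow> ennreal) \<Rightarrow> ennreal" +
  fixes \<theta> :: real and \<phi> :: "real \<Rightarrow> real" and F :: "aefun nspace \<Rightarrow> aefun nspace \<Rightarrow> aefun nspace"
  assumes sv: "slowly_varying \<phi>" and F: "exact_interpolation_functor F"
begin

abbreviation AJ where "AJ \<equiv> J_space A0 A1 \<theta> (m_sv \<phi>) E"
abbreviation BK where "BK \<equiv> K_space B0 B1 \<theta> \<phi> (F L1_space E')"
abbreviation CK where "CK \<equiv> K_space C0 C1 \<theta> \<phi> (F E Linf_space)"
abbreviation J_rep where "J_rep \<equiv> J_representation A0 A1 \<theta> (m_sv \<phi>) E"
abbreviation Jw where "Jw \<equiv> J_weighted A0 A1 \<theta> (m_sv \<phi>)"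
abbreviation KwB where "KwB \<equiv> K_weighted B0 B1 \<theta> \<phi>"
abbreviation KwC where "KwC \<equiv> K_weighted C0 C1 \<theta> \<phi>"

lemma J_repD:
  assumes "J_rep a u"
  shows "strongly_measurable_in (inter_space A0 A1) (\<lambda>t. u (exp t))"
    "has_bochner_integral_in (sum_space A0 A1) (\<lambda>t. u (exp t)) a"
    "in_fspace E (Jw u)" "u (exp t) \<in> A.I" "0 \<le> Jw u t"
proof -
  show *: "strongly_measurable_in (inter_space A0 A1) (\<lambda>t. u (exp t))"
    "has_bochner_integral_in (sum_space A0 A1) (\<lambda>t. u (exp t)) a" "in_fspace E (Jw u)"
    using assms unfolding J_representation_def by blast+
  show I: "u (exp t) \<in> A.I" using A.strongly_measurable_inter_mem[OF *(1)] .
  show "0 \<le> Jw u t"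
    unfolding J_weighted_def using A.J_nonneg[OF I] m_sv_bound(2)[OF sv, of "exp t" 1] by simp
qed

lemma BKD:
  assumes "b \<in> pts BK"
  shows "b \<in> B.S" "in_fspace (F L1_space E') (KwB b)" "0 \<le> KwB b t"
proof -
  show b: "b \<in> B.S" "in_fspace (F L1_space E') (KwB b)" using assms by (auto simp: K_space_def)
  show "0 \<le> KwB b t"
    unfolding K_weighted_def using B.K_nonneg[OF _ b(1)] slowly_varying_pos[OF sv, of "exp t"] by simp
qed

text \<open>Along \<open>t = s + (t - s)\<close> the exponential factor splits exactly, and
  \<open>\<phi>\<close> splits up to an inequality by the definition of \<open>m_sv\<close>. So the
  weight distributes over \<open>J\<close> and \<open>K\<close>, and the product becomes the
  integrand of a convolution on the line.\<close>

lemma weight_le: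
  assumes u: "J_rep a u" and b: "b \<in> pts BK"
  shows "exp (- \<theta> * t) * \<phi> (exp t) * (A.J (exp s) (u (exp s)) * B.K (exp t / exp s) b) \<le> Jw u s * KwB b (t - s)"
proof -
  have "\<phi> (exp s * exp (t - s)) \<le> m_sv \<phi> (exp s) * \<phi> (exp (t - s))" by (rule m_sv_bound(1)[OF sv]) simp_all
  then have "\<phi> (exp t) \<le> m_sv \<phi> (exp s) * \<phi> (exp (t - s))" by (simp add: exp_add[symmetric])
  moreover have "exp (- \<theta> * t) = exp (- \<theta> * s) * exp (- \<theta> * (t - s))" by (simp add: exp_add[symmetric] algebra_simps)
  ultimately have "exp (- \<theta> * t) * \<phi> (exp t) \<le> (exp (- \<theta> * s) * m_sv \<phi> (exp s)) * (exp (- \<theta> * (t - s)) * \<phi> (exp (t - s)))"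
    by (simp add: mult_left_mono mult_ac)
  then have "exp (- \<theta> * t) * \<phi> (exp t) * (A.J (exp s) (u (exp s)) * B.K (exp t / exp s) b) \<le>
     (exp (- \<theta> * s) * m_sv \<phi> (exp s)) * (exp (- \<theta> * (t - s)) * \<phi> (exp (t - s))) * (A.J (exp s) (u (exp s)) * B.K (exp t / exp s) b)"
    using A.J_nonneg[OF J_repD(4)[OF u]] B.K_nonneg[OF _ BKD(1)[OF b]] by (intro mult_right_mono) auto
  then show ?thesis by (simp add: J_weighted_def K_weighted_def exp_diff mult_ac)
qed

text \<open>The convolution of the two weighted functionals is finite at some \<open>t\<close>; the weights and the
  quasi-monotonicity of \<open>K\<close> move this to \<open>t = 0\<close>.\<close>

lemma admissible_J_rep:
  assumes u: "J_rep a u" and b: "b \<in> pts BK"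
  shows "admissible a b (\<lambda>s. u (exp s))"
proof -
  have "AE t in lebesgue. (\<integral>\<^sup>+s. ennreal (Jw u s * KwB b (t - s)) \<partial>lebesgue) < \<infinity>"
    by (rule functor_convolution(1)[OF F J_repD(3,5)[OF u] BKD(2,3)[OF b]])
  moreover have "ae_filter (lebesgue :: real measure) \<noteq> bot" by (simp add: ae_filter_eq_bot_iff)
  ultimately have "\<exists>t. (\<integral>\<^sup>+s. ennreal (Jw u s * KwB b (t - s)) \<partial>lebesgue) < \<infinity>"
    by (rule eventually_happens'[rotated])
  then obtain t where t: "(\<integral>\<^sup>+s. ennreal (Jw u s * KwB b (t - s)) \<partial>lebesgue) < \<infinity>" by blast
  define w where "w = exp (- \<theta> * t) * \<phi> (exp t)"
  \<comment> \<open>\<open>1 / w\<close> removes the weight at \<open>t\<close>, and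
    \<open>max 1 (exp (- t))\<close> is the price for moving \<open>K\<close> from
    \<open>exp (t - s)\<close> to \<open>exp (- s)\<close>; it is the same for all
    \<open>s\<close>.\<close>
  define d where "d = max 1 (exp (- t)) / w"
  have w: "0 < w" using slowly_varying_pos[OF sv, of "exp t"] by (simp add: w_def)
  have d: "0 \<le> d" using w by (simp add: d_def)
  have le: "A.J (exp s) (u (exp s)) * B.K (exp (- s)) b \<le> d * (Jw u s * KwB b (t - s))" for s
  proof -
    have "B.K (exp (- s)) b \<le> max 1 (exp (- s) / (exp t / exp s)) * B.K (exp t / exp s) b"
      by (rule B.K_le_max[OF _ _ BKD(1)[OF b]]) simp_all
    also have "exp (- s) / (exp t / exp s) = exp (- t)" by (simp add: exp_minus field_simps)
    finally have "A.J (exp s) (u (exp s)) * B.K (exp (- s)) b \<le> A.J (exp s) (u (exp s)) * (max 1 (exp (- t)) * B.K (exp t / exp s) b)"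
      by (rule mult_left_mono[OF _ A.J_nonneg[OF J_repD(4)[OF u]]])
    also have "\<dots> = d * (w * (A.J (exp s) (u (exp s)) * B.K (exp t / exp s) b))"
      using w by (simp add: d_def)
    also have "\<dots> \<le> d * (Jw u s * KwB b (t - s))"
      using weight_le[OF u b, of t s] d unfolding w_def by (intro mult_left_mono)
    finally show ?thesis .
  qed
  have "(\<integral>\<^sup>+s. ennreal (A.J (exp s) (u (exp s)) * B.K (exp (- s)) b) \<partial>lebesgue)
      \<le> (\<integral>\<^sup>+s. ennreal d * ennreal (Jw u s * KwB b (t - s)) \<partial>lebesgue)"
    using le d by (intro nn_integral_mono) (simp add: ennreal_mult'[symmetric] ennreal_leI)
  also have "\<dots> = ennreal d * (\<integral>\<^sup>+s. ennreal (Jw u s * KwB b (t - s)) \<partial>lebesgue)"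
  proof (rule nn_integral_cmult)
    have "Jw u \<in> borel_measurable lebesgue" "KwB b \<in> borel_measurable lebesgue"
      using J_repD(3)[OF u] BKD(2)[OF b] by (auto simp: in_fspace_def)
    then have "(\<lambda>s. Jw u s * KwB b (t + (-1) *\<^sub>R s)) \<in> borel_measurable lebesgue"
      by (intro borel_measurable_times borel_measurable_affine) auto
    then show "(\<lambda>s. ennreal (Jw u s * KwB b (t - s))) \<in> borel_measurable lebesgue" by simp
  qed
  also have "\<dots> < \<infinity>" using t by (simp add: ennreal_mult_less_top)
  finally show ?thesis
    unfolding admissible_def using J_repD(1,2)[OF u] BKD(1)[OF b] by blast
qed

text \<open>Composing a Lebesgue measurable \<open>\<phi>\<close> with \<open>exp\<close> directly
  would involve the images of null sets under \<open>ln\<close>. Membership of \<open>b\<close> in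
  the K-space already provides a measurable product of the weight and the K-functional, and division
  by the latter, which is positive for \<open>b \<noteq> 0\<close>, isolates the weight.\<close>

lemma weight_measurable:
  assumes b: "b \<in> pts BK" "b \<noteq> 0"
  shows "(\<lambda>t. exp (- \<theta> * t) * \<phi> (exp t)) \<in> borel_measurable lebesgue"
proof -
  have e: "(\<lambda>s::real. exp s) \<in> borel_measurable lebesgue" by (intro measurable_completion) measurable
  have "KwB b \<in> borel_measurable lebesgue" using BKD(2)[OF b(1)] by (simp add: in_fspace_def)
  then have "(\<lambda>t. KwB b t / B.K (exp t) b) \<in> borel_measurable lebesgue"
    using e by (intro borel_measurable_divide B.K_measurable BKD(1)[OF b(1)]) auto
  moreover have "KwB b t / B.K (exp t) b = exp (- \<theta> * t) * \<phi> (exp t)" for t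
    using B.K_pos[OF _ BKD(1)[OF b(1)] b(2), of "exp t"] by (simp add: K_weighted_def)
  ultimately show ?thesis by simp
qed

lemma T_ext_CK:
  assumes u: "J_rep a u" and b: "b \<in> pts BK"
  shows "T_ext a b \<in> pts CK" "nrm CK (T_ext a b) \<le> Tnorm * fnrm E (Jw u) * nrm BK b"
proof -
  note adm = admissible_J_rep[OF u b]
  have TS: "T_ext a b \<in> C.S" using has_bochner_integral_T_ext[OF adm] by (rule has_bochner_integral_inD)
  have wpos: "0 < exp (- \<theta> * t) * \<phi> (exp t)" for t using slowly_varying_pos[OF sv, of "exp t"] by simp
  have "KwC (T_ext a b) \<in> borel_measurable lebesgue"
  \<comment> \<open>For \<open>b = 0\<close> the weight cannot be recovered from the weighted
    functional of \<open>b\<close>, but the image is 0 as well.\<close>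
  proof (cases "b = 0")
    case True
    then have "T_ext a b = 0" using adm T_ext_zero_right by blast
    then have "KwC (T_ext a b) = (\<lambda>t. 0)"
      using C.K_zero_iff[of _ 0] subspace_0[OF C.S_subspace] by (auto simp: K_weighted_def)
    then show ?thesis by simp
  next
    case False
    have e: "(\<lambda>s::real. exp s) \<in> borel_measurable lebesgue" by (intro measurable_completion) measurable
    show ?thesis
      unfolding K_weighted_def using e by (intro borel_measurable_times weight_measurable[OF b False] C.K_measurable TS) auto
  qed
  moreover have "0 \<le> KwC (T_ext a b) t" for t
    unfolding K_weighted_def using C.K_nonneg[OF _ TS, of "exp t"] wpos[of t] by simp
  moreover have "ennreal (KwC (T_ext a b) t) \<le> ennreal Tnorm * (\<integral>\<^sup>+s. ennreal (Jw u s * KwB b (t - s)) \<partial>lebesgue)" for t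
  proof -
    define w where "w = exp (- \<theta> * t) * \<phi> (exp t)"
    have w: "0 \<le> w" using wpos[of t] by (simp add: w_def)
    have e: "(\<lambda>s::real. exp s) \<in> borel_measurable lebesgue" "(\<lambda>s::real. exp t / exp s) \<in> borel_measurable lebesgue"
      by (intro measurable_completion; measurable)+
    have "(\<lambda>s. A.J (exp s) (u (exp s)) * B.K (exp t / exp s) b) \<in> borel_measurable lebesgue"
      using e by (intro borel_measurable_times A.J_measurable[OF J_repD(1)[OF u]] B.K_measurable BKD(1)[OF b]) auto
    then have m: "(\<lambda>s. ennreal (A.J (exp s) (u (exp s)) * B.K (exp t / exp s) b)) \<in> borel_measurable lebesgue"
      by (rule measurable_compose) simp
    have "ennreal (KwC (T_ext a b) t) = ennreal w * ennreal (C.K (exp t) (T_ext a b))"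
      using w by (simp add: K_weighted_def w_def ennreal_mult'[symmetric])
    also have "\<dots> \<le> ennreal w * (ennreal Tnorm * (\<integral>\<^sup>+s. ennreal (A.J (exp s) (u (exp s)) * B.K (exp t / exp s) b) \<partial>lebesgue))"
      by (intro mult_left_mono T_ext_K_le[OF adm]) simp_all
    also have "\<dots> = ennreal Tnorm * (\<integral>\<^sup>+s. ennreal w * ennreal (A.J (exp s) (u (exp s)) * B.K (exp t / exp s) b) \<partial>lebesgue)"
      by (simp add: nn_integral_cmult[OF m] mult.left_commute)
    also have "\<dots> \<le> ennreal Tnorm * (\<integral>\<^sup>+s. ennreal (Jw u s * KwB b (t - s)) \<partial>lebesgue)"
      using weight_le[OF u b, of t] w unfolding w_def
      by (intro mult_left_mono nn_integral_mono) (simp_all add: ennreal_mult'[symmetric] ennreal_leI)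
    finally show ?thesis .
  qed
  ultimately have "in_fspace (F E Linf_space) (KwC (T_ext a b)) \<and>
      fnrm (F E Linf_space) (KwC (T_ext a b)) \<le> Tnorm * fnrm E (Jw u) * fnrm (F L1_space E') (KwB b)"
    by (intro functor_convolution(2)[OF F J_repD(3,5)[OF u] BKD(2,3)[OF b]] Tnorm_nonneg)
  then show "T_ext a b \<in> pts CK" "nrm CK (T_ext a b) \<le> Tnorm * fnrm E (Jw u) * nrm BK b"
    using TS by (simp_all add: K_space_def)
qed

lemma bilinear_extension_T_ext: "bilinear_extension A0 A1 B0 B1 C0 C1 \<theta> (m_sv \<phi>) E BK T0 T1 T_ext"
  unfolding bilinear_extension_def
proof (intro allI impI, elim conjE)
  fix a u b b0 b1
  assume u: "J_rep a u" and b: "b \<in> pts BK" and bb: "b0 \<in> pts B0" "b1 \<in> pts B1" "b = b0 + b1"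
  have "(\<lambda>t. T0 (u (exp t)) b0 + T1 (u (exp t)) b1) = (\<lambda>t. Tsum (u (exp t)) b)"
    unfolding bb(3) using Tsum_eq[OF J_repD(4)[OF u] bb(1,2)] by simp
  then show "has_bochner_integral_in (sum_space C0 C1) (\<lambda>t. T0 (u (exp t)) b0 + T1 (u (exp t)) b1) (T_ext a b)"
    using has_bochner_integral_T_ext[OF admissible_J_rep[OF u b]] by simp
qed

text \<open>\<open>T_ext a b\<close> does not depend on the representation, so the estimate for each
  \<open>u\<close> passes to the infimum that defines the J-norm.\<close>

lemma T_ext_nrm_le:
  assumes a: "a \<in> pts AJ" and b: "b \<in> pts BK"
  shows "nrm CK (T_ext a b) \<le> Tnorm * nrm AJ a * nrm BK b"
proof -
  obtain u where u: "J_rep a u" using a by (auto simp: J_space_def)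
  have "normed_space (F L1_space E')"
    using F compatible_L1_E' unfolding exact_interpolation_functor_def by (blast intro: banach_space_normed)
  then have "0 \<le> nrm BK b"
    using BKD(2)[OF b] by (simp add: K_space_def fnrm_def in_fspace_def nrm_nonneg)
  then have nn: "0 \<le> Tnorm * nrm BK b" using Tnorm_nonneg by simp
  have "nrm CK (T_ext a b) \<le> Inf {fnrm E (Jw u) | u. J_rep a u} * (Tnorm * nrm BK b)"
  proof (rule Inf_mult_bound[OF _ _ nn])
    show "fnrm E (Jw u) \<in> {fnrm E (Jw u) | u. J_rep a u}" using u by blast
    show "nrm CK (T_ext a b) \<le> M * (Tnorm * nrm BK b)" if "M \<in> {fnrm E (Jw u) | u. J_rep a u}" for M
      using that T_ext_CK(2)[OF _ b] by (auto simp: mult_ac)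
  qed
  then show ?thesis by (simp add: J_space_def mult_ac)
qed

lemma bounded_bilinear_T_ext: "bounded_bilinear_on AJ BK CK T_ext"
  unfolding bounded_bilinear_on_def
proof (intro conjI ballI)
  have adm: "\<exists>u. J_rep a u" if "a \<in> pts AJ" for a using that by (auto simp: J_space_def)
  show "linear_on (pts AJ) (\<lambda>a. T_ext a b)" if b: "b \<in> pts BK" for b
    unfolding linear_on_def
  proof (intro conjI ballI allI)
    fix a a' assume "a \<in> pts AJ" "a' \<in> pts AJ"
    then obtain u u' where "J_rep a u" "J_rep a' u'" using adm by blast
    then show "T_ext (a + a') b = T_ext a b + T_ext a' b"
      using T_ext_add_left[OF admissible_J_rep[OF _ b] admissible_J_rep[OF _ b]] by simp
  next
    fix a c assume "a \<in> pts AJ"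
    then obtain u where "J_rep a u" using adm by blast
    then show "T_ext (c *\<^sub>R a) b = c *\<^sub>R T_ext a b"
      using T_ext_scale_left[OF admissible_J_rep[OF _ b]] by simp
  qed
  \<comment> \<open>One representation of \<open>a\<close> is admissible for every \<open>b\<close>
    in the K-space, so linearity in \<open>b\<close> can be read off a single
    \<open>u\<close>.\<close>
  show "linear_on (pts BK) (T_ext a)" if a: "a \<in> pts AJ" for a
  proof -
    obtain u where u: "J_rep a u" using adm[OF a] by blast
    show ?thesis
      unfolding linear_on_def
      using T_ext_add_right[OF admissible_J_rep[OF u] admissible_J_rep[OF u]]
        T_ext_scale_right[OF admissible_J_rep[OF u]] by simp
  qed
  show "T_ext a b \<in> pts CK" if "a \<in> pts AJ" "b \<in> pts BK" for a b
    using adm[OF that(1)] T_ext_CK(1)[OF _ that(2)] by blast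
  show "\<exists>M. \<forall>a\<in>pts AJ. \<forall>b\<in>pts BK. nrm CK (T_ext a b) \<le> M * nrm AJ a * nrm BK b"
    using T_ext_nrm_le by blast
qed

end

theorem theorem3p4:
  fixes A0 A1 :: "'a::real_vector nspace"
    and B0 B1 :: "'b::real_vector nspace"
    and C0 C1 :: "'c::real_vector nspace"
    and T0 T1 :: "'a \<Rightarrow> 'b \<Rightarrow> 'c"
    and \<theta> :: real
    and \<phi> :: "real \<Rightarrow> real"
    and \<rho> :: "(real \<Rightarrow> ennreal) \<Rightarrow> ennreal"
    and F :: "aefun nspace \<Rightarrow> aefun nspace \<Rightarrow> aefun nspace"
  assumes "compatible_couple A0 A1" "compatible_couple B0 B1" "compatible_couple C0 C1"
    and "bounded_bilinear_on A0 B0 C0 T0" "bounded_bilinear_on A1 B1 C1 T1"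
    and "\<And>a b. a \<in> pts A0 \<inter> pts A1 \<Longrightarrow> b \<in> pts B0 \<inter> pts B1 \<Longrightarrow> T0 a b = T1 a b"
    and "0 \<le> \<theta>" "\<theta> \<le> 1"
    and "slowly_varying \<phi>"
    and "rearrangement_invariant_norm \<rho>"
    and "exact_interpolation_functor F"
  defines "E \<equiv> function_space \<rho>"
    and "E' \<equiv> function_space (associate_norm \<rho>)"
  defines "AJ \<equiv> J_space A0 A1 \<theta> (m_sv \<phi>) E"
    and "BK \<equiv> K_space B0 B1 \<theta> \<phi> (F L1_space E')"
    and "CK \<equiv> K_space C0 C1 \<theta> \<phi> (F E Linf_space)"
  shows "\<exists>T. bilinear_extension A0 A1 B0 B1 C0 C1 \<theta> (m_sv \<phi>) E BK T0 T1 T \<and>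
             bounded_bilinear_on AJ BK CK T \<and>
             bilinear_op_norm AJ BK CK T
               \<le> max (bilinear_op_norm A0 B0 C0 T0) (bilinear_op_norm A1 B1 C1 T1)"
proof -
  interpret bilinear_interpolation A0 A1 B0 B1 C0 C1 T0 T1 \<rho> \<theta> \<phi> F
    using assms by unfold_locales
  show ?thesis
    unfolding AJ_def BK_def CK_def E_def E'_def
    using bilinear_extension_T_ext bounded_bilinear_T_ext bilinear_op_norm_le[OF Tnorm_nonneg T_ext_nrm_le]
    unfolding Tnorm_def by blast
qed

end
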